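(* Let $\alpha$ be an ordinal. Then any algebra homomorphism from $\mathscr{B}(C([0,\alpha]))$ into a Banach algebra is continuous.
   Context: All spaces and algebras are over a scalar field $\mathbb{K}$ which is either $\mathbb{R}$ or $\mathbb{C}$. $[0,\alpha]$ is the set of ordinals $\le\alpha$ with the order topology, $C([0,\alpha])$ is the Banach space of continuous $\mathbb{K}$-valued functions on it with the supremum norm, and $\mathscr{B}(X)$ denotes the Banach algebra of bounded linear operators on a Banach space $X$ with the operator norm. Homomorphisms are linear and multiplicative maps, not assumed bounded. *)

theory Defs
  imports "HOL-Analysis.Analysis"
begin

text \<open>
  The scalar field is a type \<open>'k\<close> of class \<open>real_normed_field\<close>; it is only ever
  instantiated with \<open>real\<close> and \<open>complex\<close>. The library's normed spaces carry real scalars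
  only, so multiplication by scalars in \<open>'k\<close> is added on top of them.

  If the topological space \<open>'a\<close> is compact, \<open>'a \<Rightarrow>\<^sub>C 'k\<close> consists of all continuous functions,
  with the supremum norm.
\<close>

unbundle bcontfun.lifting

lift_definition scaleK_bcontfun ::
  "'k::real_normed_field \<Rightarrow> ('a::topological_space \<Rightarrow>\<^sub>C 'k) \<Rightarrow> ('a \<Rightarrow>\<^sub>C 'k)"
  is "\<lambda>c f x. c * f x"
proof -
  fix c :: 'k and f :: "'a \<Rightarrow> 'k"
  assume f: "f \<in> bcontfun"
  then have "bounded ((*) c ` range f)"
    by (intro bounded_linear_image bounded_linear_mult_right) (simp add: bcontfun_def)
  with f show "(\<lambda>x. c * f x) \<in> bcontfun"
    by (simp add: bcontfun_def image_image continuous_on_mult_left)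
qed

lemma norm_scaleK_bcontfun_le: "norm (scaleK_bcontfun c f) \<le> norm c * norm f"
  by (rule norm_bound) (auto simp: scaleK_bcontfun.rep_eq norm_mult intro!: mult_left_mono norm_bounded)

lemma bounded_linear_scaleK_bcontfun:
  "bounded_linear (scaleK_bcontfun c :: ('a::topological_space \<Rightarrow>\<^sub>C 'k::real_normed_field) \<Rightarrow> _)"
proof (rule bounded_linear_intro[where K = "norm c"])
  show "norm (scaleK_bcontfun c f) \<le> norm f * norm c" for f :: "'a \<Rightarrow>\<^sub>C 'k"
    using norm_scaleK_bcontfun_le[of c f] by (simp add: mult.commute)
qed (auto intro!: bcontfun_eqI simp: scaleK_bcontfun.rep_eq algebra_simps)

definition scaleK_op ::
  "'k::real_normed_field \<Rightarrow> (('a::topological_space \<Rightarrow>\<^sub>C 'k) \<Rightarrow>\<^sub>L ('a \<Rightarrow>\<^sub>C 'k)) \<Rightarrow> (('a \<Rightarrow>\<^sub>C 'k) \<Rightarrow>\<^sub>L ('a \<Rightarrow>\<^sub>C 'k))"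
  where "scaleK_op c T = Blinfun (\<lambda>f. scaleK_bcontfun c (blinfun_apply T f))"

lemma scaleK_op_apply: "blinfun_apply (scaleK_op c T) f = scaleK_bcontfun c (blinfun_apply T f)"
  unfolding scaleK_op_def
  by (subst bounded_linear_Blinfun_apply)
     (auto intro: bounded_linear_compose[OF bounded_linear_scaleK_bcontfun] blinfun.bounded_linear_right)

text \<open>
  The algebra of bounded \<open>'k\<close>-linear operators: \<open>blinfun\<close> only requires linearity over the
  reals. The norm is that of \<open>blinfun\<close>, the operator norm, and the product is \<open>(o\<^sub>L)\<close>.
\<close>

definition bounded_ops :: "(('a::topological_space \<Rightarrow>\<^sub>C 'k::real_normed_field) \<Rightarrow>\<^sub>L ('a \<Rightarrow>\<^sub>C 'k)) set"
  where "bounded_ops = {T. \<forall>c f. blinfun_apply T (scaleK_bcontfun c f) = scaleK_bcontfun c (blinfun_apply T f)}"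

lemma bounded_ops_add: "S \<in> bounded_ops \<Longrightarrow> T \<in> bounded_ops \<Longrightarrow> S + T \<in> bounded_ops"
  by (auto simp: bounded_ops_def blinfun.add_left
      bounded_linear.linear[OF bounded_linear_scaleK_bcontfun, THEN linear_add])

lemma bounded_ops_scaleK: "T \<in> bounded_ops \<Longrightarrow> scaleK_op c T \<in> bounded_ops"
  by (auto simp: bounded_ops_def scaleK_op_apply scaleK_bcontfun.rep_eq intro!: bcontfun_eqI)

lemma bounded_ops_compose: "S \<in> bounded_ops \<Longrightarrow> T \<in> bounded_ops \<Longrightarrow> S o\<^sub>L T \<in> bounded_ops"
  by (auto simp: bounded_ops_def)

lemma bounded_ops_real: "(bounded_ops :: (('a::topological_space \<Rightarrow>\<^sub>C real) \<Rightarrow>\<^sub>L ('a \<Rightarrow>\<^sub>C real)) set) = UNIV"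
proof -
  have "scaleK_bcontfun c f = c *\<^sub>R f" for c and f :: "'a \<Rightarrow>\<^sub>C real"
    by (rule bcontfun_eqI) (simp add: scaleK_bcontfun.rep_eq)
  then show ?thesis
    by (simp add: bounded_ops_def blinfun.scaleR_right)
qed

text \<open>
  A Banach algebra over \<open>'k\<close>, not necessarily unital, with scalar multiplication \<open>scl\<close>.
  The first assumption identifies the real scalar multiplication of the type class with the
  restriction of \<open>scl\<close>; for \<open>'k = real\<close> it forces \<open>scl = scaleR\<close>.
\<close>

locale banach_algebra_over = vector_space scl
  for scl :: "'k::real_normed_field \<Rightarrow> 'b::{real_normed_algebra,banach} \<Rightarrow> 'b" +
  assumes scl_of_real: "scl (of_real r) x = r *\<^sub>R x"
    and norm_scl: "norm (scl c x) = norm c * norm x"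
    and scl_mult_left: "scl c x * y = scl c (x * y)"
    and scl_mult_right: "x * scl c y = scl c (x * y)"

text \<open>Only the values of \<open>\<theta>\<close> on \<open>bounded_ops\<close> matter.\<close>

definition algebra_hom_on_ops ::
  "('k::real_normed_field \<Rightarrow> 'b::real_normed_algebra \<Rightarrow> 'b) \<Rightarrow>
   ((('a::topological_space \<Rightarrow>\<^sub>C 'k) \<Rightarrow>\<^sub>L ('a \<Rightarrow>\<^sub>C 'k)) \<Rightarrow> 'b) \<Rightarrow> bool"
  where "algebra_hom_on_ops scl \<theta> \<longleftrightarrow>
    (\<forall>S\<in>bounded_ops. \<forall>T\<in>bounded_ops. \<theta> (S + T) = \<theta> S + \<theta> T) \<and>
    (\<forall>c. \<forall>T\<in>bounded_ops. \<theta> (scaleK_op c T) = scl c (\<theta> T)) \<and>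
    (\<forall>S\<in>bounded_ops. \<forall>T\<in>bounded_ops. \<theta> (S o\<^sub>L T) = \<theta> S * \<theta> T)"

end

theory Submission
  imports Defs
begin

text \<open>
  For fixed \<open>R\<close> the operators \<open>T\<close> for which \<open>S \<mapsto> \<theta> (T o\<^sub>L S o\<^sub>L R)\<close> is bounded form a two-sided
  ideal, and similarly for \<open>R\<close>. By a gliding hump argument such an ideal contains every projection
  \<open>p\<close> of which the space contains infinitely many copies. Let \<open>\<beta>\<close> be the least ordinal such that
  restriction to the initial segment \<open>{..\<beta>}\<close> is not in the ideal. By minimality every end segment
  of \<open>{..\<beta>}\<close> is isomorphic to \<open>{..\<beta>}\<close>. Hence for each sufficiently sparse club \<open>C\<close> in \<open>\<beta>\<close>, the
  functions vanishing on \<open>C\<close> form a \<open>c\<^sub>0\<close>-sum that contains infinitely many copies of itself, so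
  the projection onto them is in the ideal. The complementary projection has range \<open>C(C \<union> {\<beta>})\<close>;
  as it is not in the ideal, \<open>C\<close> has order type \<open>\<beta>\<close>. Therefore \<open>\<beta>\<close> is a regular uncountable cardinal.

  If \<open>\<theta>\<close> is discontinuous, this argument, used on the left and then on the right, yields \<open>\<beta>\<close> and
  \<open>\<gamma>\<close> and a bounded sequence of operators from functions on \<open>{..\<gamma>}\<close> vanishing at \<open>\<gamma>\<close> to functions on
  \<open>{..\<beta>}\<close> vanishing at \<open>\<beta>\<close>, whose images under \<open>\<theta>\<close> are unbounded. If \<open>\<gamma> \<noteq> \<beta>\<close>, regularity makes
  the sequence factor through a smaller initial segment, where \<open>\<theta>\<close> is bounded. If \<open>\<gamma> = \<beta>\<close>, all
  operators of the sequence act on a common club as multiplication by scalars (Loy and Willis);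
  up to the projection above, the sequence then consists of multiples of a single operator.
\<close>

text \<open>The library proves completeness only for functions on metric spaces.\<close>

instance bcontfun :: (topological_space, complete_space) complete_space
proof
  fix f :: "nat \<Rightarrow> ('a \<Rightarrow>\<^sub>C 'b)"
  assume "Cauchy f"
  then obtain g where "uniform_limit UNIV f g sequentially"
    using uniformly_convergent_eq_cauchy[of "\<lambda>_. True" f]
    unfolding Cauchy_def uniform_limit_sequentially_iff
    by (metis dist_fun_lt_imp_dist_val_lt)
  then show "convergent f"
    by (rule uniform_limit_bcontfunE) (auto intro: convergentI)
qed

instance bcontfun :: (topological_space, banach) banach ..

subsection \<open>Operators given by composition\<close>

text \<open>The operators needed later are differences of \<open>f \<circ> u\<close> and
  \<open>f \<circ> v\<close>, cut off to sets. Cutting off each term separately may destroy the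
  continuity that the difference has, so both terms are kept in one formula.\<close>

definition diff_comp ::
  "'a set \<Rightarrow> ('a \<Rightarrow> 'a) \<Rightarrow> 'a set \<Rightarrow> ('a \<Rightarrow> 'a) \<Rightarrow> ('a \<Rightarrow> 'k::real_normed_field) \<Rightarrow> 'a \<Rightarrow> 'k"
  where "diff_comp A u B v f = (\<lambda>x. (if x \<in> A then f (u x) else 0) - (if x \<in> B then f (v x) else 0))"

definition diff_comp_op ::
  "'a::topological_space set \<Rightarrow> ('a \<Rightarrow> 'a) \<Rightarrow> 'a set \<Rightarrow> ('a \<Rightarrow> 'a) \<Rightarrow>
    ('a \<Rightarrow>\<^sub>C 'k::real_normed_field) \<Rightarrow>\<^sub>L ('a \<Rightarrow>\<^sub>C 'k)"
  where "diff_comp_op A u B v = Blinfun (\<lambda>f. Bcontfun (diff_comp A u B v (apply_bcontfun f)))"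

lemma scaleK_apply [simp]: "apply_bcontfun (scaleK_bcontfun c f) x = c * apply_bcontfun f x"
  by (simp add: scaleK_bcontfun.rep_eq)

lemma norm_diff_comp_le:
  "norm (diff_comp A u B v (apply_bcontfun f) x) \<le> 2 * norm (f :: 'a::topological_space \<Rightarrow>\<^sub>C 'k::real_normed_field)"
proof -
  have "norm (apply_bcontfun f y) \<le> norm f" for y
    by (rule norm_bounded)
  then have "norm (if x \<in> A then apply_bcontfun f (u x) else 0) \<le> norm f"
    and "norm (if x \<in> B then apply_bcontfun f (v x) else 0) \<le> norm f"
    by auto
  then show ?thesis
    unfolding diff_comp_def using norm_triangle_ineq4 by (smt (verit))
qed

lemma bcontfun_diff_comp:
  fixes f :: "'a::topological_space \<Rightarrow>\<^sub>C 'k::real_normed_field"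
  assumes "continuous_on UNIV (diff_comp A u B v (apply_bcontfun f))"
  shows "diff_comp A u B v (apply_bcontfun f) \<in> bcontfun"
  using assms norm_diff_comp_le[of A u B v f] by (auto simp: bcontfun_def bounded_iff)

context
  fixes A B :: "'a::topological_space set" and u v and k :: "'k::real_normed_field itself"
  assumes cont: "\<And>f :: 'a \<Rightarrow>\<^sub>C 'k. continuous_on UNIV (diff_comp A u B v (apply_bcontfun f))"
begin

lemma bounded_linear_diff_comp:
  "bounded_linear (\<lambda>f :: 'a \<Rightarrow>\<^sub>C 'k. Bcontfun (diff_comp A u B v (apply_bcontfun f)))"
proof (rule bounded_linear_intro[where K = 2])
  have app: "apply_bcontfun (Bcontfun (diff_comp A u B v (apply_bcontfun f))) x =
      diff_comp A u B v (apply_bcontfun f) x" for f :: "'a \<Rightarrow>\<^sub>C 'k" and x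
    by (simp add: Bcontfun_inverse bcontfun_diff_comp[OF cont])
  show "norm (Bcontfun (diff_comp A u B v (apply_bcontfun f))) \<le> norm f * 2" for f :: "'a \<Rightarrow>\<^sub>C 'k"
    using norm_diff_comp_le[of A u B v f] by (intro norm_bound) (simp add: app mult.commute)
  show "Bcontfun (diff_comp A u B v (apply_bcontfun (f + g))) =
      Bcontfun (diff_comp A u B v (apply_bcontfun f)) + Bcontfun (diff_comp A u B v (apply_bcontfun g))"
    for f g :: "'a \<Rightarrow>\<^sub>C 'k"
    by (rule bcontfun_eqI, subst app) (simp add: app, simp add: diff_comp_def)
  show "Bcontfun (diff_comp A u B v (apply_bcontfun (r *\<^sub>R f))) =
      r *\<^sub>R Bcontfun (diff_comp A u B v (apply_bcontfun f))" for r and f :: "'a \<Rightarrow>\<^sub>C 'k"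
    by (rule bcontfun_eqI, subst app) (simp add: app, simp add: diff_comp_def algebra_simps)
qed

lemma diff_comp_op_apply:
  "apply_bcontfun (blinfun_apply (diff_comp_op A u B v) (f :: 'a \<Rightarrow>\<^sub>C 'k)) x =
    (if x \<in> A then apply_bcontfun f (u x) else 0) - (if x \<in> B then apply_bcontfun f (v x) else 0)"
proof -
  have "blinfun_apply (diff_comp_op A u B v) f = Bcontfun (diff_comp A u B v (apply_bcontfun f))"
    unfolding diff_comp_op_def by (rule bounded_linear_Blinfun_apply[OF bounded_linear_diff_comp, THEN fun_cong])
  then show ?thesis
    using Bcontfun_inverse[OF bcontfun_diff_comp[OF cont]] by (simp add: diff_comp_def del: if_split)
qed

lemma diff_comp_op_mem: "(diff_comp_op A u B v :: ('a \<Rightarrow>\<^sub>C 'k) \<Rightarrow>\<^sub>L _) \<in> bounded_ops"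
  unfolding bounded_ops_def
  by (auto intro!: bcontfun_eqI simp: diff_comp_op_apply algebra_simps)

end

definition comp_op ::
  "'a::topological_space set \<Rightarrow> ('a \<Rightarrow> 'a) \<Rightarrow> ('a \<Rightarrow>\<^sub>C 'k::real_normed_field) \<Rightarrow>\<^sub>L ('a \<Rightarrow>\<^sub>C 'k)"
  where "comp_op A u = diff_comp_op A u {} id"

lemma
  fixes A :: "'a::topological_space set"
  assumes "\<And>f :: 'a \<Rightarrow>\<^sub>C 'k::real_normed_field. continuous_on UNIV (\<lambda>x. if x \<in> A then apply_bcontfun f (u x) else 0)"
  shows comp_op_apply:
      "apply_bcontfun (blinfun_apply (comp_op A u) (f :: 'a \<Rightarrow>\<^sub>C 'k)) x = (if x \<in> A then apply_bcontfun f (u x) else 0)"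
    and comp_op_mem: "(comp_op A u :: ('a \<Rightarrow>\<^sub>C 'k) \<Rightarrow>\<^sub>L _) \<in> bounded_ops"
proof -
  have *: "continuous_on UNIV (diff_comp A u {} id (apply_bcontfun f))" for f :: "'a \<Rightarrow>\<^sub>C 'k"
    using assms[of f] by (simp add: diff_comp_def)
  show "apply_bcontfun (blinfun_apply (comp_op A u) f) x = (if x \<in> A then apply_bcontfun f (u x) else 0)"
    unfolding comp_op_def by (subst diff_comp_op_apply[OF *]) simp
  show "(comp_op A u :: ('a \<Rightarrow>\<^sub>C 'k) \<Rightarrow>\<^sub>L _) \<in> bounded_ops"
    unfolding comp_op_def by (rule diff_comp_op_mem[OF *])
qed

lemma bounded_ops_zero: "0 \<in> bounded_ops"
  by (auto simp: bounded_ops_def intro!: bcontfun_eqI)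

lemma bounded_ops_id: "id_blinfun \<in> bounded_ops"
  by (auto simp: bounded_ops_def)

lemma bounded_ops_uminus: "T \<in> bounded_ops \<Longrightarrow> - T \<in> bounded_ops"
  by (auto simp: bounded_ops_def blinfun.minus_left intro!: bcontfun_eqI)

lemma bounded_ops_diff: "S \<in> bounded_ops \<Longrightarrow> T \<in> bounded_ops \<Longrightarrow> S - T \<in> bounded_ops"
  using bounded_ops_add[of S "- T"] bounded_ops_uminus[of T] by simp

lemma bounded_ops_scaleR: "T \<in> bounded_ops \<Longrightarrow> r *\<^sub>R T \<in> bounded_ops"
  by (auto simp: bounded_ops_def blinfun.scaleR_left intro!: bcontfun_eqI)

lemma blinfun_compose_assoc: "(R o\<^sub>L S) o\<^sub>L T = R o\<^sub>L (S o\<^sub>L T)"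
  by (auto intro!: blinfun_eqI)

lemma blinfun_compose_id [simp]: "id_blinfun o\<^sub>L T = T" "T o\<^sub>L id_blinfun = T"
  by (auto intro!: blinfun_eqI)

lemma scaleK_op_of_real: "scaleK_op (of_real r) T = r *\<^sub>R T"
  by (auto intro!: blinfun_eqI bcontfun_eqI simp: scaleK_op_apply blinfun.scaleR_left scaleR_conv_of_real)

lemma blinfun_apply_suminf:
  fixes W :: "nat \<Rightarrow> 'x::real_normed_vector \<Rightarrow>\<^sub>L 'y::banach"
  assumes "summable W"
  shows "blinfun_apply (suminf W) f = (\<Sum>n. blinfun_apply (W n) f)"
    and "summable (\<lambda>n. blinfun_apply (W n) f)"
  using bounded_linear.suminf[OF blinfun.bounded_linear_left assms]
    bounded_linear.summable[OF blinfun.bounded_linear_left assms] by auto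

text \<open>The sum is formed among real-linear operators. Scalars of \<open>'k\<close> pass through
  it because \<open>scaleK_bcontfun c\<close> is bounded and real-linear.\<close>

lemma bounded_ops_suminf:
  fixes W :: "nat \<Rightarrow> ('a::topological_space \<Rightarrow>\<^sub>C 'k::{real_normed_field,banach}) \<Rightarrow>\<^sub>L _"
  assumes W: "summable W" "\<And>n. W n \<in> bounded_ops"
  shows "suminf W \<in> bounded_ops"
  unfolding bounded_ops_def
proof (safe, goal_cases)
  case (1 c f)
  have "(\<Sum>n. blinfun_apply (W n) (scaleK_bcontfun c f)) = (\<Sum>n. scaleK_bcontfun c (blinfun_apply (W n) f))"
    using W(2) by (simp add: bounded_ops_def)
  also have "\<dots> = scaleK_bcontfun c (\<Sum>n. blinfun_apply (W n) f)"
    by (rule bounded_linear.suminf[OF bounded_linear_scaleK_bcontfun blinfun_apply_suminf(2)[OF W(1)], symmetric])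
  finally show ?case
    by (simp add: blinfun_apply_suminf(1)[OF W(1)])
qed

subsection \<open>Ideals of continuity\<close>

text \<open>Isolates what the left and the right continuity ideals share, so that the analysis of
  \<beta> is done once for both. In \<open>infinite_multiple\<close>, \<open>U n\<close> embeds and
  \<open>V n\<close> recovers the n-th of infinitely many independent copies of the range of
  \<open>p\<close>.\<close>

locale ops_ideal =
  fixes I :: "(('a::topological_space \<Rightarrow>\<^sub>C 'k::{real_normed_field,banach}) \<Rightarrow>\<^sub>L ('a \<Rightarrow>\<^sub>C 'k)) set"
  assumes add: "S \<in> I \<Longrightarrow> T \<in> I \<Longrightarrow> S + T \<in> I"
    and lmult: "S \<in> bounded_ops \<Longrightarrow> T \<in> I \<Longrightarrow> S o\<^sub>L T \<in> I"
    and rmult: "T \<in> I \<Longrightarrow> S \<in> bounded_ops \<Longrightarrow> T o\<^sub>L S \<in> I"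
    and infinite_multiple: "\<And>p U V. p \<in> bounded_ops \<Longrightarrow> p o\<^sub>L p = p \<Longrightarrow>
      (\<And>n::nat. U n \<in> bounded_ops) \<Longrightarrow> (\<And>n. V n \<in> bounded_ops) \<Longrightarrow>
      (\<And>m n. V m o\<^sub>L U n = (if m = n then p else 0)) \<Longrightarrow> p \<in> I"

locale ops_hom = banach_algebra_over scl
  for scl :: "'k::{real_normed_field,banach} \<Rightarrow> 'b::{real_normed_algebra,banach} \<Rightarrow> 'b" +
  fixes \<theta> :: "(('a::topological_space \<Rightarrow>\<^sub>C 'k) \<Rightarrow>\<^sub>L ('a \<Rightarrow>\<^sub>C 'k)) \<Rightarrow> 'b"
  assumes hom: "algebra_hom_on_ops scl \<theta>"
begin

lemma hom_add: "S \<in> bounded_ops \<Longrightarrow> T \<in> bounded_ops \<Longrightarrow> \<theta> (S + T) = \<theta> S + \<theta> T"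
  and hom_scaleK: "T \<in> bounded_ops \<Longrightarrow> \<theta> (scaleK_op c T) = scl c (\<theta> T)"
  and hom_mult: "S \<in> bounded_ops \<Longrightarrow> T \<in> bounded_ops \<Longrightarrow> \<theta> (S o\<^sub>L T) = \<theta> S * \<theta> T"
  using hom by (auto simp: algebra_hom_on_ops_def)

lemma hom_scaleR: "T \<in> bounded_ops \<Longrightarrow> \<theta> (r *\<^sub>R T) = r *\<^sub>R \<theta> T"
  using hom_scaleK[of T "of_real r"] by (simp add: scaleK_op_of_real scl_of_real)

lemma hom_diff: "S \<in> bounded_ops \<Longrightarrow> T \<in> bounded_ops \<Longrightarrow> \<theta> (S - T) = \<theta> S - \<theta> T"
  using hom_add[of S "(-1) *\<^sub>R T"] hom_scaleR[of T "-1"] bounded_ops_scaleR[of T "-1"] by simp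

definition sandwich_bounded where
  "sandwich_bounded T R \<longleftrightarrow> (\<exists>M. \<forall>S\<in>bounded_ops. norm (\<theta> (T o\<^sub>L S o\<^sub>L R)) \<le> M * norm S)"

lemma sandwich_boundedE:
  assumes "sandwich_bounded T R"
  obtains M where "M \<ge> 0" "\<And>S. S \<in> bounded_ops \<Longrightarrow> norm (\<theta> (T o\<^sub>L S o\<^sub>L R)) \<le> M * norm S"
proof -
  obtain M where M: "\<And>S. S \<in> bounded_ops \<Longrightarrow> norm (\<theta> (T o\<^sub>L S o\<^sub>L R)) \<le> M * norm S"
    using assms by (auto simp: sandwich_bounded_def)
  have le: "M * x \<le> \<bar>M\<bar> * x" if "x \<ge> 0" for x
    using that by (simp add: mult_right_mono)
  have "norm (\<theta> (T o\<^sub>L S o\<^sub>L R)) \<le> \<bar>M\<bar> * norm S" if "S \<in> bounded_ops" for S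
    using order_trans[OF M[OF that] le[OF norm_ge_zero]] .
  then show ?thesis
    using that[of "\<bar>M\<bar>"] by simp
qed

text \<open>Unboundedness is invariant under scaling, so a large value can be combined with any
  prescribed bound on the norm of \<open>S\<close>.\<close>

lemma sandwich_unboundedE:
  assumes "\<not> sandwich_bounded T R" "T \<in> bounded_ops" "R \<in> bounded_ops" "e > 0"
  obtains S where "S \<in> bounded_ops" "norm S \<le> e" "norm (\<theta> (T o\<^sub>L S o\<^sub>L R)) > N"
proof -
  \<comment> \<open>Boundedness is refuted with the constant \<open>\<bar>N\<bar> / e\<close>, which
    turns into \<open>\<bar>N\<bar>\<close> when \<open>S\<close> is rescaled to norm
    \<open>e\<close>.\<close>
  obtain S where S: "S \<in> bounded_ops" "norm (\<theta> (T o\<^sub>L S o\<^sub>L R)) > \<bar>N\<bar> / e * norm S"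
    using assms(1) unfolding sandwich_bounded_def by (meson not_le)
  have "\<theta> 0 = 0"
    using hom_scaleR[OF bounded_ops_zero, of 0] by simp
  with S assms(4) have "S \<noteq> 0"
    by auto
  define r where "r = e / norm S"
  have r: "r > 0" using assms(4) \<open>S \<noteq> 0\<close> by (simp add: r_def)
  have eq: "T o\<^sub>L (r *\<^sub>R S) o\<^sub>L R = r *\<^sub>R (T o\<^sub>L S o\<^sub>L R)"
    by (auto intro!: blinfun_eqI simp: blinfun.scaleR_left blinfun.scaleR_right)
  have "norm (\<theta> (T o\<^sub>L (r *\<^sub>R S) o\<^sub>L R)) = r * norm (\<theta> (T o\<^sub>L S o\<^sub>L R))"
    unfolding eq using r S(1) assms by (simp add: hom_scaleR bounded_ops_compose)
  also have "\<dots> > r * (\<bar>N\<bar> / e * norm S)"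
    using S(2) r by (intro mult_strict_left_mono) auto
  also have "r * (\<bar>N\<bar> / e * norm S) = \<bar>N\<bar>"
    using assms(4) \<open>S \<noteq> 0\<close> by (simp add: r_def)
  finally have "norm (\<theta> (T o\<^sub>L (r *\<^sub>R S) o\<^sub>L R)) > N"
    by linarith
  moreover have "norm (r *\<^sub>R S) \<le> e"
    using \<open>S \<noteq> 0\<close> assms(4) by (simp add: r_def)
  ultimately show ?thesis
    using that bounded_ops_scaleR[OF S(1)] by blast
qed

lemma sandwich_bounded_add_left:
  assumes "sandwich_bounded T R" "sandwich_bounded T' R"
    and "T \<in> bounded_ops" "T' \<in> bounded_ops" "R \<in> bounded_ops"
  shows "sandwich_bounded (T + T') R"
proof -
  obtain M where M: "\<And>S. S \<in> bounded_ops \<Longrightarrow> norm (\<theta> (T o\<^sub>L S o\<^sub>L R)) \<le> M * norm S"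
    using assms(1) by (rule sandwich_boundedE) blast
  obtain M' where M': "\<And>S. S \<in> bounded_ops \<Longrightarrow> norm (\<theta> (T' o\<^sub>L S o\<^sub>L R)) \<le> M' * norm S"
    using assms(2) by (rule sandwich_boundedE) blast
  have "norm (\<theta> ((T + T') o\<^sub>L S o\<^sub>L R)) \<le> (M + M') * norm S" if "S \<in> bounded_ops" for S
  proof -
    have "(T + T') o\<^sub>L S o\<^sub>L R = (T o\<^sub>L S o\<^sub>L R) + (T' o\<^sub>L S o\<^sub>L R)"
      by (auto intro!: blinfun_eqI simp: blinfun.add_left)
    then have "\<theta> ((T + T') o\<^sub>L S o\<^sub>L R) = \<theta> (T o\<^sub>L S o\<^sub>L R) + \<theta> (T' o\<^sub>L S o\<^sub>L R)"
      using assms that by (simp add: hom_add bounded_ops_compose)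
    then show ?thesis
      using M[OF that] M'[OF that] by (smt (verit) norm_triangle_ineq distrib_right)
  qed
  then show ?thesis by (auto simp: sandwich_bounded_def)
qed

lemma sandwich_bounded_add_right:
  assumes "sandwich_bounded T R" "sandwich_bounded T R'"
    and "T \<in> bounded_ops" "R \<in> bounded_ops" "R' \<in> bounded_ops"
  shows "sandwich_bounded T (R + R')"
proof -
  obtain M where M: "\<And>S. S \<in> bounded_ops \<Longrightarrow> norm (\<theta> (T o\<^sub>L S o\<^sub>L R)) \<le> M * norm S"
    using assms(1) by (rule sandwich_boundedE) blast
  obtain M' where M': "\<And>S. S \<in> bounded_ops \<Longrightarrow> norm (\<theta> (T o\<^sub>L S o\<^sub>L R')) \<le> M' * norm S"
    using assms(2) by (rule sandwich_boundedE) blast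
  have "norm (\<theta> (T o\<^sub>L S o\<^sub>L (R + R'))) \<le> (M + M') * norm S" if "S \<in> bounded_ops" for S
  proof -
    have "T o\<^sub>L S o\<^sub>L (R + R') = (T o\<^sub>L S o\<^sub>L R) + (T o\<^sub>L S o\<^sub>L R')"
      by (auto intro!: blinfun_eqI simp: blinfun.add_left blinfun.add_right)
    then have "\<theta> (T o\<^sub>L S o\<^sub>L (R + R')) = \<theta> (T o\<^sub>L S o\<^sub>L R) + \<theta> (T o\<^sub>L S o\<^sub>L R')"
      using assms that by (simp add: hom_add bounded_ops_compose)
    then show ?thesis
      using M[OF that] M'[OF that] by (smt (verit) norm_triangle_ineq distrib_right)
  qed
  then show ?thesis by (auto simp: sandwich_bounded_def)
qed

text \<open>Multiplicativity takes \<open>U\<close> and \<open>V\<close> out of the argument of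
  \<theta>, at the cost of the constants \<open>norm (\<theta> U)\<close> and
  \<open>norm (\<theta> V)\<close>.\<close>

lemma sandwich_bounded_outer:
  assumes "sandwich_bounded T R"
    and "T \<in> bounded_ops" "R \<in> bounded_ops" "U \<in> bounded_ops" "V \<in> bounded_ops"
  shows "sandwich_bounded (U o\<^sub>L T) (R o\<^sub>L V)"
proof -
  obtain M where M: "\<And>S. S \<in> bounded_ops \<Longrightarrow> norm (\<theta> (T o\<^sub>L S o\<^sub>L R)) \<le> M * norm S"
    using assms(1) by (rule sandwich_boundedE) blast
  have "norm (\<theta> ((U o\<^sub>L T) o\<^sub>L S o\<^sub>L (R o\<^sub>L V))) \<le> (norm (\<theta> U) * M * norm (\<theta> V)) * norm S"
    if S: "S \<in> bounded_ops" for S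
  proof -
    have "(U o\<^sub>L T) o\<^sub>L S o\<^sub>L (R o\<^sub>L V) = U o\<^sub>L (T o\<^sub>L S o\<^sub>L R) o\<^sub>L V"
      by (simp add: blinfun_compose_assoc)
    then have "\<theta> ((U o\<^sub>L T) o\<^sub>L S o\<^sub>L (R o\<^sub>L V)) = \<theta> U * \<theta> (T o\<^sub>L S o\<^sub>L R) * \<theta> V"
      using S by (simp add: hom_mult bounded_ops_compose assms)
    also have "norm \<dots> \<le> norm (\<theta> U) * norm (\<theta> (T o\<^sub>L S o\<^sub>L R)) * norm (\<theta> V)"
      by (meson norm_mult_ineq mult_right_mono norm_ge_zero order_trans)
    also have "\<dots> \<le> norm (\<theta> U) * (M * norm S) * norm (\<theta> V)"
      using M[OF S] by (intro mult_right_mono mult_left_mono) auto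
    finally show ?thesis by (simp add: mult_ac)
  qed
  then show ?thesis by (auto simp: sandwich_bounded_def)
qed

text \<open>Here the extra factors are absorbed into the variable \<open>S\<close>, at the cost of
  their operator norms. Together with outer factors this makes the ideals two-sided.\<close>

lemma sandwich_bounded_inner:
  assumes "sandwich_bounded T R"
    and "T \<in> bounded_ops" "R \<in> bounded_ops" "U \<in> bounded_ops" "V \<in> bounded_ops"
  shows "sandwich_bounded (T o\<^sub>L U) (V o\<^sub>L R)"
proof -
  obtain M where M: "M \<ge> 0" "\<And>S. S \<in> bounded_ops \<Longrightarrow> norm (\<theta> (T o\<^sub>L S o\<^sub>L R)) \<le> M * norm S"
    using assms(1) by (rule sandwich_boundedE) blast
  have "norm (\<theta> ((T o\<^sub>L U) o\<^sub>L S o\<^sub>L (V o\<^sub>L R))) \<le> (M * norm U * norm V) * norm S"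
    if S: "S \<in> bounded_ops" for S
  proof -
    have "(T o\<^sub>L U) o\<^sub>L S o\<^sub>L (V o\<^sub>L R) = T o\<^sub>L (U o\<^sub>L S o\<^sub>L V) o\<^sub>L R"
      by (simp add: blinfun_compose_assoc)
    then have "norm (\<theta> ((T o\<^sub>L U) o\<^sub>L S o\<^sub>L (V o\<^sub>L R))) \<le> M * norm (U o\<^sub>L S o\<^sub>L V)"
      using M(2)[of "U o\<^sub>L S o\<^sub>L V"] S by (simp add: bounded_ops_compose assms)
    also have "\<dots> \<le> M * (norm U * norm S * norm V)"
      by (intro mult_left_mono M order_trans[OF norm_blinfun_compose] mult_right_mono) auto
    finally show ?thesis by (simp add: mult_ac)
  qed
  then show ?thesis by (auto simp: sandwich_bounded_def)
qed

text \<open>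
  Gliding hump: if \<open>p\<close> were not in the ideal, there would be small operators \<open>S n\<close> for which
  \<open>\<theta> (p o\<^sub>L S n o\<^sub>L R)\<close> is large, and \<open>V m\<close> recovers \<open>p o\<^sub>L S m\<close> from the sum of all
  \<open>U n o\<^sub>L p o\<^sub>L S n\<close>.
\<close>

lemma sandwich_bounded_infinite_multiple_left:
  assumes p: "p \<in> bounded_ops" "p o\<^sub>L p = p" and R: "R \<in> bounded_ops"
    and U: "\<And>n::nat. U n \<in> bounded_ops" and V: "\<And>n. V n \<in> bounded_ops"
    and VU: "\<And>m n. V m o\<^sub>L U n = (if m = n then p else 0)"
  shows "sandwich_bounded p R"
proof (rule ccontr)
  assume "\<not> sandwich_bounded p R"
  \<comment> \<open>The upper bound makes the series of the \<open>W n\<close> below converge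
    geometrically, and adding 1 keeps the denominator positive. The lower bound will force
    \<open>norm (\<theta> (T o\<^sub>L R))\<close> above every n.\<close>
  then have "\<exists>S. S \<in> bounded_ops \<and> norm S \<le> (1/2)^n / (norm (U n o\<^sub>L p) + 1) \<and>
      norm (\<theta> (p o\<^sub>L S o\<^sub>L R)) > real n * norm (\<theta> (V n))" for n
    by (rule sandwich_unboundedE[of p R "(1/2)^n / (norm (U n o\<^sub>L p) + 1)" "real n * norm (\<theta> (V n))"])
      (use p R in \<open>auto simp: add_nonneg_pos\<close>)
  then obtain S where S: "\<And>n. S n \<in> bounded_ops" "\<And>n. norm (S n) \<le> (1/2)^n / (norm (U n o\<^sub>L p) + 1)"
      "\<And>n. norm (\<theta> (p o\<^sub>L S n o\<^sub>L R)) > real n * norm (\<theta> (V n))"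
    by metis
  define W where "W n = U n o\<^sub>L p o\<^sub>L S n" for n
  have W: "W n \<in> bounded_ops" for n
    by (simp add: W_def bounded_ops_compose U p S)
  have "norm (W n) \<le> (1/2)^n" for n
  proof -
    have "norm (W n) \<le> norm (U n o\<^sub>L p) * norm (S n)"
      unfolding W_def by (rule norm_blinfun_compose)
    also have "\<dots> \<le> (norm (U n o\<^sub>L p) + 1) * ((1/2)^n / (norm (U n o\<^sub>L p) + 1))"
      using S(2) by (intro mult_mono) auto
    also have "\<dots> = (1/2)^n"
      by (simp add: add_nonneg_eq_0_iff)
    finally show ?thesis .
  qed
  moreover have "summable (\<lambda>n. (1/2::real)^n)"
    by (rule summable_geometric) simp
  ultimately have sW: "summable W"
    by (rule summable_comparison_test'[where N = 0, rotated])
  define T where "T = suminf W"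
  have T: "T \<in> bounded_ops"
    unfolding T_def by (rule bounded_ops_suminf[OF sW W])
  have VT: "V m o\<^sub>L T = p o\<^sub>L S m" for m
  proof (rule blinfun_eqI)
    fix f
    have "blinfun_apply (V m o\<^sub>L T) f = blinfun_apply (V m) (\<Sum>n. blinfun_apply (W n) f)"
      by (simp add: T_def blinfun_apply_suminf(1)[OF sW])
    also have "\<dots> = (\<Sum>n. blinfun_apply (V m) (blinfun_apply (W n) f))"
      by (rule bounded_linear.suminf[OF blinfun.bounded_linear_right blinfun_apply_suminf(2)[OF sW]])
    also have "(\<lambda>n. blinfun_apply (V m) (blinfun_apply (W n) f)) =
        (\<lambda>n. if n = m then blinfun_apply (p o\<^sub>L S m) f else 0)"
    proof
      fix n
      have "blinfun_apply (V m) (blinfun_apply (W n) f) = blinfun_apply (V m o\<^sub>L U n o\<^sub>L p o\<^sub>L S n) f"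
        by (simp add: W_def)
      also have "\<dots> = (if n = m then blinfun_apply (p o\<^sub>L p o\<^sub>L S m) f else 0)"
        unfolding VU by simp
      finally show "blinfun_apply (V m) (blinfun_apply (W n) f) =
          (if n = m then blinfun_apply (p o\<^sub>L S m) f else 0)"
        unfolding p(2) .
    qed
    also have "suminf \<dots> = blinfun_apply (p o\<^sub>L S m) f"
      by (subst suminf_finite[of "{m}"]) auto
    finally show "blinfun_apply (V m o\<^sub>L T) f = blinfun_apply (p o\<^sub>L S m) f" .
  qed
  have "real n < norm (\<theta> (T o\<^sub>L R))" for n
  proof -
    have "V n o\<^sub>L (T o\<^sub>L R) = p o\<^sub>L S n o\<^sub>L R"
      by (simp add: VT blinfun_compose_assoc[symmetric])
    then have "\<theta> (p o\<^sub>L S n o\<^sub>L R) = \<theta> (V n) * \<theta> (T o\<^sub>L R)"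
      using hom_mult[of "V n" "T o\<^sub>L R"] V T R by (simp add: bounded_ops_compose)
    then have "norm (\<theta> (V n)) * real n < norm (\<theta> (V n)) * norm (\<theta> (T o\<^sub>L R))"
      using S(3)[of n] norm_mult_ineq[of "\<theta> (V n)" "\<theta> (T o\<^sub>L R)"] by (simp add: mult.commute)
    then show ?thesis
      by (simp add: mult_less_cancel_left)
  qed
  then show False
    by (meson less_asym reals_Archimedean2)
qed

text \<open>The mirror image: the sum of all \<open>S n o\<^sub>L (p o\<^sub>L V n)\<close> is
  composed with \<open>U m\<close> on the right, which recovers
  \<open>S m o\<^sub>L p\<close>.\<close>

lemma sandwich_bounded_infinite_multiple_right:
  assumes p: "p \<in> bounded_ops" "p o\<^sub>L p = p" and R: "R \<in> bounded_ops"
    and U: "\<And>n::nat. U n \<in> bounded_ops" and V: "\<And>n. V n \<in> bounded_ops"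
    and VU: "\<And>m n. V m o\<^sub>L U n = (if m = n then p else 0)"
  shows "sandwich_bounded R p"
proof (rule ccontr)
  assume "\<not> sandwich_bounded R p"
  then have "\<exists>S. S \<in> bounded_ops \<and> norm S \<le> (1/2)^n / (norm (p o\<^sub>L V n) + 1) \<and>
      norm (\<theta> (R o\<^sub>L S o\<^sub>L p)) > real n * norm (\<theta> (U n))" for n
    by (rule sandwich_unboundedE[of R p "(1/2)^n / (norm (p o\<^sub>L V n) + 1)" "real n * norm (\<theta> (U n))"])
      (use p R in \<open>auto simp: add_nonneg_pos\<close>)
  then obtain S where S: "\<And>n. S n \<in> bounded_ops" "\<And>n. norm (S n) \<le> (1/2)^n / (norm (p o\<^sub>L V n) + 1)"
      "\<And>n. norm (\<theta> (R o\<^sub>L S n o\<^sub>L p)) > real n * norm (\<theta> (U n))"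
    by metis
  define W where "W n = S n o\<^sub>L (p o\<^sub>L V n)" for n
  have W: "W n \<in> bounded_ops" for n
    by (simp add: W_def bounded_ops_compose V p S)
  have "norm (W n) \<le> (1/2)^n" for n
  proof -
    have "norm (W n) \<le> norm (S n) * norm (p o\<^sub>L V n)"
      unfolding W_def by (rule norm_blinfun_compose)
    also have "\<dots> \<le> ((1/2)^n / (norm (p o\<^sub>L V n) + 1)) * (norm (p o\<^sub>L V n) + 1)"
      using S(2) by (intro mult_mono) auto
    also have "\<dots> = (1/2)^n"
      by (simp add: add_nonneg_eq_0_iff)
    finally show ?thesis .
  qed
  moreover have "summable (\<lambda>n. (1/2::real)^n)"
    by (rule summable_geometric) simp
  ultimately have sW: "summable W"
    by (rule summable_comparison_test'[where N = 0, rotated])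
  define T where "T = suminf W"
  have T: "T \<in> bounded_ops"
    unfolding T_def by (rule bounded_ops_suminf[OF sW W])
  have TU: "T o\<^sub>L U m = S m o\<^sub>L p" for m
  proof (rule blinfun_eqI)
    fix f
    have "blinfun_apply (T o\<^sub>L U m) f = (\<Sum>n. blinfun_apply (W n) (blinfun_apply (U m) f))"
      by (simp add: T_def blinfun_apply_suminf(1)[OF sW])
    also have "(\<lambda>n. blinfun_apply (W n) (blinfun_apply (U m) f)) =
        (\<lambda>n. if n = m then blinfun_apply (S m o\<^sub>L p) f else 0)"
    proof
      fix n
      have "blinfun_apply (W n) (blinfun_apply (U m) f) = blinfun_apply (S n o\<^sub>L (p o\<^sub>L (V n o\<^sub>L U m))) f"
        by (simp add: W_def)
      also have "\<dots> = (if n = m then blinfun_apply (S m o\<^sub>L (p o\<^sub>L p)) f else 0)"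
        unfolding VU by simp
      finally show "blinfun_apply (W n) (blinfun_apply (U m) f) =
          (if n = m then blinfun_apply (S m o\<^sub>L p) f else 0)"
        unfolding p(2) .
    qed
    also have "suminf \<dots> = blinfun_apply (S m o\<^sub>L p) f"
      by (subst suminf_finite[of "{m}"]) auto
    finally show "blinfun_apply (T o\<^sub>L U m) f = blinfun_apply (S m o\<^sub>L p) f" .
  qed
  have "real n < norm (\<theta> (R o\<^sub>L T))" for n
  proof -
    have "(R o\<^sub>L T) o\<^sub>L U n = R o\<^sub>L S n o\<^sub>L p"
      by (simp add: TU blinfun_compose_assoc)
    then have "\<theta> (R o\<^sub>L S n o\<^sub>L p) = \<theta> (R o\<^sub>L T) * \<theta> (U n)"
      using hom_mult[of "R o\<^sub>L T" "U n"] U T R by (simp add: bounded_ops_compose)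
    then have "norm (\<theta> (U n)) * real n < norm (\<theta> (U n)) * norm (\<theta> (R o\<^sub>L T))"
      using S(3)[of n] norm_mult_ineq[of "\<theta> (R o\<^sub>L T)" "\<theta> (U n)"] by (simp add: mult.commute)
    then show ?thesis
      by (simp add: mult_less_cancel_left)
  qed
  then show False
    by (meson less_asym reals_Archimedean2)
qed

lemma ops_ideal_left:
  assumes [simp]: "R \<in> bounded_ops"
  shows "ops_ideal {T \<in> bounded_ops. sandwich_bounded T R}"
proof
  fix S T :: "('a \<Rightarrow>\<^sub>C 'k) \<Rightarrow>\<^sub>L ('a \<Rightarrow>\<^sub>C 'k)"
  assume "S \<in> bounded_ops" "T \<in> {T \<in> bounded_ops. sandwich_bounded T R}"
  then show "S o\<^sub>L T \<in> {T \<in> bounded_ops. sandwich_bounded T R}"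
    "T o\<^sub>L S \<in> {T \<in> bounded_ops. sandwich_bounded T R}"
    using sandwich_bounded_outer[of T R S id_blinfun] sandwich_bounded_inner[of T R S id_blinfun]
    by (simp_all add: bounded_ops_compose bounded_ops_id)
next
  fix p and U V :: "nat \<Rightarrow> ('a \<Rightarrow>\<^sub>C 'k) \<Rightarrow>\<^sub>L ('a \<Rightarrow>\<^sub>C 'k)"
  assume "p \<in> bounded_ops" "p o\<^sub>L p = p" "\<And>n. U n \<in> bounded_ops" "\<And>n. V n \<in> bounded_ops"
    "\<And>m n. V m o\<^sub>L U n = (if m = n then p else 0)"
  then show "p \<in> {T \<in> bounded_ops. sandwich_bounded T R}"
    using sandwich_bounded_infinite_multiple_left[of p R U V] by simp
qed (auto intro: sandwich_bounded_add_left bounded_ops_add)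

lemma ops_ideal_right:
  assumes [simp]: "R \<in> bounded_ops"
  shows "ops_ideal {T \<in> bounded_ops. sandwich_bounded R T}"
proof
  fix S T :: "('a \<Rightarrow>\<^sub>C 'k) \<Rightarrow>\<^sub>L ('a \<Rightarrow>\<^sub>C 'k)"
  assume "S \<in> bounded_ops" "T \<in> {T \<in> bounded_ops. sandwich_bounded R T}"
  then show "S o\<^sub>L T \<in> {T \<in> bounded_ops. sandwich_bounded R T}"
    "T o\<^sub>L S \<in> {T \<in> bounded_ops. sandwich_bounded R T}"
    using sandwich_bounded_outer[of R T id_blinfun S] sandwich_bounded_inner[of R T id_blinfun S]
    by (simp_all add: bounded_ops_compose bounded_ops_id)
next
  fix p and U V :: "nat \<Rightarrow> ('a \<Rightarrow>\<^sub>C 'k) \<Rightarrow>\<^sub>L ('a \<Rightarrow>\<^sub>C 'k)"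
  assume "p \<in> bounded_ops" "p o\<^sub>L p = p" "\<And>n. U n \<in> bounded_ops" "\<And>n. V n \<in> bounded_ops"
    "\<And>m n. V m o\<^sub>L U n = (if m = n then p else 0)"
  then show "p \<in> {T \<in> bounded_ops. sandwich_bounded R T}"
    using sandwich_bounded_infinite_multiple_right[of p R U V] by simp
qed (auto intro: sandwich_bounded_add_right bounded_ops_add)

lemma continuous_on_hom:
  assumes "sandwich_bounded id_blinfun id_blinfun"
  shows "continuous_on bounded_ops \<theta>"
proof -
  obtain M where M: "M \<ge> 0" "\<And>S. S \<in> bounded_ops \<Longrightarrow> norm (\<theta> S) \<le> M * norm S"
    using assms by (rule sandwich_boundedE) simp
  have "M-lipschitz_on bounded_ops \<theta>"
  proof (rule lipschitz_onI[OF _ M(1)])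
    fix S T :: "('a \<Rightarrow>\<^sub>C 'k) \<Rightarrow>\<^sub>L ('a \<Rightarrow>\<^sub>C 'k)"
    assume "S \<in> bounded_ops" "T \<in> bounded_ops"
    then show "dist (\<theta> S) (\<theta> T) \<le> M * dist S T"
      using M(2)[of "S - T"] by (simp add: dist_norm hom_diff bounded_ops_diff)
  qed
  then show ?thesis
    by (rule lipschitz_on_continuous_on)
qed

end

subsection \<open>The order topology of a well-order\<close>

lemma wellorder_open_atMost: "open {..x :: 'a::{wellorder,linorder_topology}}"
proof (cases "\<exists>y. x < y")
  case True
  then have "x < (LEAST y. x < y)"
    by (rule LeastI_ex)
  then have "{..x} = {..<(LEAST y. x < y)}"
    using not_less_Least[of _ "\<lambda>y. x < y"] by (auto simp: not_less)
  then show ?thesis by simp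
next
  case False
  then have "{..x} = UNIV" by (auto simp: not_less)
  then show ?thesis by simp
qed

lemma wellorder_open_greaterThanAtMost: "open {x<..y :: 'a::{wellorder,linorder_topology}}"
  unfolding greaterThanAtMost_def by (intro open_Int wellorder_open_atMost) simp

text \<open>Since \<open>{..z}\<close> is open, only the behaviour to the left of \<open>z\<close> matters.\<close>

lemma wellorder_continuous_iff:
  fixes F :: "'a::{wellorder,linorder_topology} \<Rightarrow> 'b::metric_space"
  shows "continuous_on UNIV F \<longleftrightarrow>
    (\<forall>z e. 0 < e \<longrightarrow> (\<exists>v. v < z) \<longrightarrow> (\<exists>w<z. \<forall>x. w < x \<and> x \<le> z \<longrightarrow> dist (F x) (F z) < e))"
  (is "_ \<longleftrightarrow> ?R")
proof
  assume F: "continuous_on UNIV F"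
  show ?R
  proof (intro allI impI)
    fix z :: 'a and e :: real
    assume e: "0 < e" and v: "\<exists>v. v < z"
    have "open (F -` ball (F z) e)"
      using F by (simp add: continuous_on_open_vimage)
    moreover have "z \<in> F -` ball (F z) e" using e by simp
    ultimately obtain w where "w < z" "{w<..z} \<subseteq> F -` ball (F z) e"
      using open_left[of _ z] v by blast
    then show "\<exists>w<z. \<forall>x. w < x \<and> x \<le> z \<longrightarrow> dist (F x) (F z) < e"
      by (intro exI[of _ w]) (auto simp: dist_commute)
  qed
next
  assume R: ?R
  show "continuous_on UNIV F"
    unfolding continuous_on_eq_continuous_within
  proof
    fix z
    have "\<forall>\<^sub>F x in nhds z. dist (F x) (F z) < e" if "e > 0" for e
    proof (cases "\<exists>v. v < z")
      case True
      then obtain w where "w < z" "\<forall>x. w < x \<and> x \<le> z \<longrightarrow> dist (F x) (F z) < e"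
        using R \<open>e > 0\<close> by blast
      then show ?thesis
        by (intro eventually_nhds[THEN iffD2] exI[of _ "{w<..z}"])
          (auto simp: wellorder_open_greaterThanAtMost)
    next
      case False
      then have "{..z} = {z}" by (auto simp: not_less intro: antisym)
      then show ?thesis
        using \<open>e > 0\<close> wellorder_open_atMost[of z]
        by (intro eventually_nhds[THEN iffD2] exI[of _ "{z}"]) auto
    qed
    then have "(F \<longlongrightarrow> F z) (nhds z)"
      by (intro tendstoI)
    then show "continuous (at z within UNIV) F"
      by (simp add: continuous_within tendsto_at_iff_tendsto_nhds)
  qed
qed

lemma wellorder_continuousD:
  fixes F :: "'a::{wellorder,linorder_topology} \<Rightarrow> 'b::metric_space"
  assumes "continuous_on UNIV F" "0 < e" "v < z"
  obtains w where "w < z" "\<And>x. w < x \<Longrightarrow> x \<le> z \<Longrightarrow> dist (F x) (F z) < e"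
  using assms unfolding wellorder_continuous_iff by meson

lemma continuous_on_if_clopen:
  fixes f :: "'a::topological_space \<Rightarrow> 'b::{topological_space,zero}"
  assumes "continuous_on A f" "open A" "closed A"
  shows "continuous_on UNIV (\<lambda>x. if x \<in> A then f x else 0)"
proof -
  have "continuous_on (A \<union> - A) (\<lambda>x. if x \<in> A then f x else 0)"
    using assms by (intro continuous_on_If) (auto simp: closed_Compl)
  then show ?thesis by simp
qed

text \<open>The criterion for a c_0-sum of functions: as \<open>e\<close> tends to 0, the finite
  sums over the pieces on which \<open>F\<close> reaches \<open>e\<close> converge uniformly to
  \<open>F\<close>, because all omitted values have norm below \<open>e\<close>.\<close>

lemma continuous_on_disjoint_family:
  fixes F :: "'a::topological_space \<Rightarrow> 'b::real_normed_vector"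
  assumes cont: "\<And>c. c \<in> K \<Longrightarrow> continuous_on UNIV (\<lambda>x. if x \<in> D c then F x else 0)"
    and disj: "disjoint_family_on D K"
    and zero: "\<And>x. x \<notin> (\<Union>c\<in>K. D c) \<Longrightarrow> F x = 0"
    and small: "\<And>e. 0 < e \<Longrightarrow> finite {c \<in> K. \<exists>x\<in>D c. e \<le> norm (F x)}"
  shows "continuous_on UNIV F"
proof (rule uniform_limit_theorem[where F = "at_right 0" and
    f = "\<lambda>e x. \<Sum>c\<in>{c \<in> K. \<exists>x\<in>D c. e \<le> norm (F x)}. if x \<in> D c then F x else 0"])
  show "\<forall>\<^sub>F e in at_right 0. continuous_on UNIV
      (\<lambda>x. \<Sum>c\<in>{c \<in> K. \<exists>x\<in>D c. e \<le> norm (F x)}. if x \<in> D c then F x else 0)"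
    by (intro always_eventually allI continuous_on_sum) (auto intro: cont)
  have *: "norm ((\<Sum>c\<in>{c \<in> K. \<exists>x\<in>D c. e \<le> norm (F x)}. if x \<in> D c then F x else 0) - F x) < e"
    if e: "0 < e" for e x
  proof (cases "\<exists>c\<in>K. x \<in> D c")
    case True
    then obtain c where c: "c \<in> K" "x \<in> D c" by blast
    then have D: "x \<in> D c' \<longleftrightarrow> c' = c" if "c' \<in> K" for c'
      using disj that by (auto simp: disjoint_family_on_def)
    have "(\<Sum>c\<in>{c \<in> K. \<exists>x\<in>D c. e \<le> norm (F x)}. if x \<in> D c then F x else 0) =
        (\<Sum>c'\<in>{c \<in> K. \<exists>x\<in>D c. e \<le> norm (F x)}. if c' = c then F x else 0)"
      by (intro sum.cong) (auto simp: D)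
    also have "\<dots> = (if c \<in> {c \<in> K. \<exists>x\<in>D c. e \<le> norm (F x)} then F x else 0)"
      by (simp add: sum.delta[OF small[OF e]])
    finally show ?thesis using c e by auto
  next
    case False
    then have "F x = 0" using zero by blast
    moreover have "(\<Sum>c\<in>{c \<in> K. \<exists>x\<in>D c. e \<le> norm (F x)}. if x \<in> D c then F x else 0) = 0"
      using False by (intro sum.neutral) auto
    ultimately show ?thesis using e by simp
  qed
  show "uniform_limit UNIV (\<lambda>e x. \<Sum>c\<in>{c \<in> K. \<exists>x\<in>D c. e \<le> norm (F x)}. if x \<in> D c then F x else 0)
      F (at_right 0)"
  proof (rule uniform_limitI)
    fix r :: real assume "0 < r"
    then have "\<forall>\<^sub>F e in at_right 0. 0 < e \<and> e < r"
      unfolding eventually_at_right_field by (intro exI[of _ r]) auto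
    then show "\<forall>\<^sub>F e in at_right 0. \<forall>x\<in>UNIV.
        dist (\<Sum>c\<in>{c \<in> K. \<exists>x\<in>D c. e \<le> norm (F x)}. if x \<in> D c then F x else 0) (F x) < r"
      by eventually_elim (use * in \<open>fastforce simp: dist_norm intro: less_trans\<close>)
  qed
qed simp

subsection \<open>Normal maps between initial segments\<close>

text \<open>Transfinite recursion whose step \<open>G\<close> may depend on the stage
  \<open>j\<close>. The bounded quantifier gives the termination proof access to
  \<open>j < i\<close>. The minimum is meaningful only as long as some \<open>x\<close> meets the
  conditions.\<close>

function normal_rec :: "('a \<Rightarrow> 'a \<Rightarrow> 'a) \<Rightarrow> 'a \<Rightarrow> 'a \<Rightarrow> 'a::wellorder" where
  "normal_rec G b i = (LEAST x. b < x \<and> (\<forall>j\<in>{..<i}. G j (normal_rec G b j) \<le> x))"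
  by pat_completeness auto
termination
proof (relation "inv_image {(x, y). x < y} (\<lambda>(G, b, i). i)")
  show "wf (inv_image {(x, y). x < (y :: 'a)} (\<lambda>(G :: 'a \<Rightarrow> 'a \<Rightarrow> 'a, b :: 'a, i). i))"
    by (rule wf_inv_image) (rule wf)
qed simp

declare normal_rec.simps [simp del]

definition limit_point :: "'a::wellorder \<Rightarrow> bool"
  where "limit_point \<beta> \<longleftrightarrow> (\<exists>v. v < \<beta>) \<and> (\<forall>v<\<beta>. \<exists>w. v < w \<and> w < \<beta>)"

text \<open>The lower adjoint of an increasing map: \<open>h (lower_inv h x)\<close> rounds
  \<open>x\<close> up to the range of \<open>h\<close>.\<close>

definition lower_inv :: "('a::wellorder \<Rightarrow> 'a) \<Rightarrow> 'a \<Rightarrow> 'a"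
  where "lower_inv h x = (LEAST i. x \<le> h i)"

text \<open>A normal function from \<open>{..\<delta>}\<close> into \<open>{b<..\<beta>}\<close>
  that reaches \<beta> exactly at \<delta>. The minimality in \<open>h_least\<close> stands for
  continuity at limit stages.\<close>

locale normal_map =
  fixes b \<delta> \<beta> :: "'a::{wellorder,linorder_topology}" and G :: "'a \<Rightarrow> 'a \<Rightarrow> 'a" and h :: "'a \<Rightarrow> 'a"
  assumes h_top: "h \<delta> = \<beta>"
    and h_less: "i < \<delta> \<Longrightarrow> h i < \<beta>"
    and h_gt: "i \<le> \<delta> \<Longrightarrow> b < h i"
    and h_G: "j < i \<Longrightarrow> i \<le> \<delta> \<Longrightarrow> G j (h j) \<le> h i"
    and h_mono: "j < i \<Longrightarrow> i \<le> \<delta> \<Longrightarrow> h j < h i"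
    and h_least: "i \<le> \<delta> \<Longrightarrow> b < x \<Longrightarrow> (\<And>j. j < i \<Longrightarrow> G j (h j) \<le> x) \<Longrightarrow> h i \<le> x"

text \<open>An increasing recursion satisfies \<open>i \<le> h i\<close> while it stays below
  \<beta>, so it reaches \<beta> at stage \<beta> at the latest; \<delta> is the first stage at
  which it does.\<close>

lemma ex_normal_map:
  fixes b \<beta> :: "'a::{wellorder,linorder_topology}"
  assumes b: "b < \<beta>" and G: "\<And>j y. y < \<beta> \<Longrightarrow> y < G j y \<and> G j y < \<beta>"
  obtains \<delta> where "\<delta> \<le> \<beta>" "normal_map b \<delta> \<beta> G (normal_rec G b)"
proof -
  let ?h = "normal_rec G b"
  \<comment> \<open>While all earlier values are below \<beta>, \<beta> itself meets the conditions,
    so the minimum exists and is at most \<beta>.\<close>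
  have *: "b < ?h i \<and> (\<forall>j<i. G j (?h j) \<le> ?h i) \<and> ?h i \<le> \<beta> \<and>
      (\<forall>x. b < x \<longrightarrow> (\<forall>j<i. G j (?h j) \<le> x) \<longrightarrow> ?h i \<le> x)"
    if "\<And>j. j < i \<Longrightarrow> ?h j < \<beta>" for i
  proof -
    let ?P = "\<lambda>x. b < x \<and> (\<forall>j\<in>{..<i}. G j (?h j) \<le> x)"
    have eq: "?h i = (LEAST x. ?P x)"
      by (subst normal_rec.simps) (rule refl)
    have P: "?P \<beta>" using b G that by (auto intro: less_imp_le)
    show ?thesis
      using LeastI[of ?P, OF P] Least_le[of ?P, OF P] Least_le[of ?P] unfolding eq[symmetric] by blast
  qed
  have ex: "\<exists>i\<le>\<beta>. \<not> ?h i < \<beta>"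
  proof (rule ccontr)
    assume "\<not> ?thesis"
    then have less: "?h i < \<beta>" if "i \<le> \<beta>" for i using that by blast
    have "i \<le> ?h i" if "i \<le> \<beta>" for i
      using that
    proof (induction i rule: less_induct)
      case (less i)
      show ?case
      proof (rule ccontr)
        assume "\<not> i \<le> ?h i"
        then have lt: "?h i < i" by simp
        then have "?h i \<le> ?h (?h i)" using less by auto
        also have "\<dots> < G (?h i) (?h (?h i))"
          using G \<open>\<And>i. i \<le> \<beta> \<Longrightarrow> ?h i < \<beta>\<close> lt less.prems by auto
        also have "\<dots> \<le> ?h i"
          using *[of i] lt less.prems \<open>\<And>i. i \<le> \<beta> \<Longrightarrow> ?h i < \<beta>\<close> by (meson less_imp_le order.trans)
        finally show False by simp
      qed
    qed
    then show False using less[of \<beta>] by (auto simp: not_less[symmetric])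
  qed
  define \<delta> where "\<delta> = (LEAST i. \<not> ?h i < \<beta>)"
  have below: "?h j < \<beta>" if "j < \<delta>" for j
    using that not_less_Least[of j "\<lambda>i. \<not> ?h i < \<beta>"] unfolding \<delta>_def by blast
  have d: "\<not> ?h \<delta> < \<beta>"
    using ex LeastI_ex[of "\<lambda>i. \<not> ?h i < \<beta>"] unfolding \<delta>_def by blast
  have dle: "\<delta> \<le> \<beta>"
    using ex Least_le[of "\<lambda>i. \<not> ?h i < \<beta>"] unfolding \<delta>_def by (blast intro: order.trans)
  have "normal_map b \<delta> \<beta> G ?h"
  proof
    show "?h \<delta> = \<beta>" using d *[of \<delta>] below by auto
    fix i assume i: "i \<le> \<delta>"
    then have i': "\<And>j. j < i \<Longrightarrow> ?h j < \<beta>" using below by auto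
    show "b < ?h i" using *[OF i'] by blast
    show "G j (?h j) \<le> ?h i" if "j < i" for j using *[OF i'] that by blast
    then show "?h j < ?h i" if "j < i" for j
      using that G[OF i'[OF that], of j] by force
    show "?h i \<le> x" if "b < x" "\<And>j. j < i \<Longrightarrow> G j (?h j) \<le> x" for x
      using *[OF i'] that by blast
  qed (use below in auto)
  then show ?thesis using that dle by blast
qed

context normal_map
begin

lemma
  assumes "x \<le> \<beta>"
  shows le_h_lower_inv: "x \<le> h (lower_inv h x)" and lower_inv_le: "lower_inv h x \<le> \<delta>"
proof -
  have "x \<le> h \<delta>" using assms h_top by simp
  then show "x \<le> h (lower_inv h x)" "lower_inv h x \<le> \<delta>"
    unfolding lower_inv_def by (auto intro: LeastI Least_le)
qed

lemma h_less_of_less_lower_inv: "i < lower_inv h x \<Longrightarrow> h i < x"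
  unfolding lower_inv_def using not_less_Least by fastforce

lemma lower_inv_leI: "x \<le> h i \<Longrightarrow> lower_inv h x \<le> i"
  unfolding lower_inv_def by (rule Least_le)

lemma h_mono_le: "j \<le> i \<Longrightarrow> i \<le> \<delta> \<Longrightarrow> h j \<le> h i"
  using h_mono by (cases "j = i") (auto intro: less_imp_le)

lemma h_le: "i \<le> \<delta> \<Longrightarrow> h i \<le> \<beta>"
  using h_mono_le h_top by fastforce

lemma h_less_iff: "i \<le> \<delta> \<Longrightarrow> j \<le> \<delta> \<Longrightarrow> h i < h j \<longleftrightarrow> i < j"
  using h_mono by (metis linorder_neqE not_less_iff_gr_or_eq)

lemma lower_inv_h: "i \<le> \<delta> \<Longrightarrow> lower_inv h (h i) = i"
proof (rule antisym)
  assume i: "i \<le> \<delta>"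
  show "i \<le> lower_inv h (h i)"
  proof (rule ccontr)
    assume "\<not> i \<le> lower_inv h (h i)"
    then have "h (lower_inv h (h i)) < h i" using h_mono i by simp
    then show False using le_h_lower_inv[OF h_le[OF i]] by simp
  qed
qed (auto intro: lower_inv_leI)

text \<open>Only left limits matter. If \<open>w < h z\<close>, then by minimality of
  \<open>h z\<close> either the step at some stage below \<open>z\<close> already exceeds
  \<open>w\<close>, and so do all later values, or \<open>w \<le> b\<close> lies below the whole
  range.\<close>

lemma continuous_comp_h:
  fixes f :: "'a \<Rightarrow> 'k::real_normed_vector"
  assumes f: "continuous_on UNIV f"
  shows "continuous_on UNIV (\<lambda>x. if x \<in> {..\<delta>} then f (h x) else 0)"
  unfolding wellorder_continuous_iff
proof (intro allI impI)
  fix z :: 'a and e :: real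
  assume e: "0 < e" and v: "\<exists>v. v < z"
  show "\<exists>w<z. \<forall>x. w < x \<and> x \<le> z \<longrightarrow>
      dist (if x \<in> {..\<delta>} then f (h x) else 0) (if z \<in> {..\<delta>} then f (h z) else 0) < e"
  proof (cases "z \<le> \<delta>")
    case True
    have "b < h z" using h_gt True by blast
    then obtain w where w: "w < h z" "\<And>x. w < x \<Longrightarrow> x \<le> h z \<Longrightarrow> dist (f x) (f (h z)) < e"
      using wellorder_continuousD[OF f e] by metis
    obtain i where i: "i < z" "\<And>x. i < x \<Longrightarrow> x \<le> z \<Longrightarrow> w < h x"
    proof (cases "b < w")
      case True
      then obtain j where j: "j < z" "w < G j (h j)"
        using h_least[OF \<open>z \<le> \<delta>\<close> True] w(1) by (meson not_le)
      show ?thesis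
        using that[OF j(1)] j h_G \<open>z \<le> \<delta>\<close> by (meson less_le_trans order.trans)
    next
      case False
      from v obtain v where "v < z" by blast
      then show ?thesis
        using that[of v] h_gt \<open>z \<le> \<delta>\<close> False by (meson le_less_trans not_less order.trans)
    qed
    have "dist (f (h x)) (f (h z)) < e" if "i < x" "x \<le> z" for x
      using w(2)[OF i(2)[OF that]] h_mono_le that True by blast
    then show ?thesis using i(1) True by (intro exI[of _ i]) auto
  next
    case False
    then show ?thesis using e by (intro exI[of _ \<delta>]) auto
  qed
qed

text \<open>If \<open>w\<close> is below \<open>lower_inv h z\<close>, then \<open>{h w<..z}\<close>
  is mapped above \<open>w\<close>. If no such \<open>w\<close> exists, \<open>lower_inv h\<close>
  is constant on \<open>{..z}\<close>.\<close>

lemma continuous_comp_lower_inv: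
  fixes f :: "'a \<Rightarrow> 'k::real_normed_vector"
  assumes f: "continuous_on UNIV f"
  shows "continuous_on UNIV (\<lambda>x. if x \<in> {..\<beta>} then f (lower_inv h x) else 0)"
  unfolding wellorder_continuous_iff
proof (intro allI impI)
  fix z :: 'a and e :: real
  assume e: "0 < e" and v: "\<exists>v. v < z"
  show "\<exists>w<z. \<forall>x. w < x \<and> x \<le> z \<longrightarrow>
      dist (if x \<in> {..\<beta>} then f (lower_inv h x) else 0) (if z \<in> {..\<beta>} then f (lower_inv h z) else 0) < e"
  proof (cases "z \<le> \<beta>")
    case True
    have le: "lower_inv h x \<le> lower_inv h z" if "x \<le> z" for x
      using lower_inv_leI[of x "lower_inv h z"] le_h_lower_inv[OF True] that by simp
    show ?thesis
    proof (cases "\<exists>v. v < lower_inv h z")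
      case True
      then obtain w where w: "w < lower_inv h z" "\<And>x. w < x \<Longrightarrow> x \<le> lower_inv h z \<Longrightarrow> dist (f x) (f (lower_inv h z)) < e"
        using wellorder_continuousD[OF f e] by metis
      have "w < lower_inv h x" if "h w < x" "x \<le> z" for x
      proof (rule ccontr)
        assume "\<not> w < lower_inv h x"
        moreover have "w \<le> \<delta>" using w(1) lower_inv_le[OF \<open>z \<le> \<beta>\<close>] by simp
        ultimately have "h (lower_inv h x) \<le> h w" using h_mono_le by simp
        moreover have "x \<le> h (lower_inv h x)" using le_h_lower_inv that \<open>z \<le> \<beta>\<close> by simp
        ultimately show False using that by simp
      qed
      then have "dist (f (lower_inv h x)) (f (lower_inv h z)) < e" if "h w < x" "x \<le> z" for x
        using w(2) le that by blast
      then show ?thesis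
        using h_less_of_less_lower_inv[OF w(1)] \<open>z \<le> \<beta>\<close> by (intro exI[of _ "h w"]) auto
    next
      case False
      then have eq: "lower_inv h x = lower_inv h z" if "x \<le> z" for x
        using le[OF that] by (meson order.order_iff_strict)
      obtain u where "u < z" using v by blast
      moreover have "dist (f (lower_inv h x)) (f (lower_inv h z)) < e" if "x \<le> z" for x
        using e by (simp add: eq[OF that])
      ultimately show ?thesis using \<open>z \<le> \<beta>\<close> by (intro exI[of _ u]) auto
    qed
  next
    case False
    then show ?thesis using e by (intro exI[of _ \<beta>]) auto
  qed
qed

end

subsection \<open>Basic operators\<close>

lemma ops_eqI:
  fixes S T :: "('a::topological_space \<Rightarrow>\<^sub>C 'k::real_normed_field) \<Rightarrow>\<^sub>L ('a \<Rightarrow>\<^sub>C 'k)"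
  assumes "\<And>f x. apply_bcontfun (blinfun_apply S f) x = apply_bcontfun (blinfun_apply T f) x"
  shows "S = T"
  by (intro blinfun_eqI bcontfun_eqI assms)

definition clopen :: "'a::topological_space set \<Rightarrow> bool"
  where "clopen A \<longleftrightarrow> open A \<and> closed A"

lemma clopen_atMost [simp, intro]: "clopen {..x :: 'a::{wellorder,linorder_topology}}"
  by (simp add: clopen_def wellorder_open_atMost)

lemma clopen_greaterThanAtMost [simp, intro]: "clopen {x<..y :: 'a::{wellorder,linorder_topology}}"
proof -
  have "{x<..y} = {..y} \<inter> - {..x}" by auto
  moreover have "closed ({..y} \<inter> - {..x})"
    by (rule closed_Int[OF closed_atMost closed_Compl[OF wellorder_open_atMost]])
  ultimately have "closed {x<..y}" by simp
  then show ?thesis by (simp add: clopen_def wellorder_open_greaterThanAtMost)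
qed

definition restrict_op :: "'a::topological_space set \<Rightarrow> ('a \<Rightarrow>\<^sub>C 'k::real_normed_field) \<Rightarrow>\<^sub>L ('a \<Rightarrow>\<^sub>C 'k)"
  where "restrict_op A = comp_op A id"

lemma
  assumes "clopen A"
  shows restrict_op_apply [simp]: "apply_bcontfun (blinfun_apply (restrict_op A) f) x = (if x \<in> A then apply_bcontfun f x else 0)"
    and restrict_op_mem [simp, intro]: "restrict_op A \<in> bounded_ops"
  using assms unfolding restrict_op_def
  by (subst comp_op_apply comp_op_mem; auto simp: clopen_def intro!: continuous_on_if_clopen continuous_on_apply_bcontfun)+

section \<open>Rank-one operators and the ideal\<close>

definition const_op :: "'a::topological_space set \<Rightarrow> 'a \<Rightarrow> ('a \<Rightarrow>\<^sub>C 'k::real_normed_field) \<Rightarrow>\<^sub>L ('a \<Rightarrow>\<^sub>C 'k)"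
  where "const_op A z = comp_op A (\<lambda>_. z)"

lemma
  assumes "clopen A"
  shows const_op_apply [simp]: "apply_bcontfun (blinfun_apply (const_op A z) f) x = (if x \<in> A then apply_bcontfun f z else 0)"
    and const_op_mem [simp, intro]: "const_op A z \<in> bounded_ops"
  using assms unfolding const_op_def
  by (subst comp_op_apply comp_op_mem; auto simp: clopen_def intro!: continuous_on_if_clopen)+

text \<open>Points with finitely many predecessors are isolated. Either all points are of this kind,
  or the least point that is not has infinitely many of them below it.\<close>

lemma infinite_isolated:
  assumes "infinite (UNIV :: 'a::{wellorder,linorder_topology} set)"
  shows "infinite {y :: 'a. clopen {y}}"
proof -
  have fin: "clopen {y}" if "finite {..<y}" for y :: 'a
  proof -
    have "{y} = {..y} - {..<y}" by auto
    moreover have "open ({..y} - {..<y})"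
      using that by (intro open_Diff wellorder_open_atMost finite_imp_closed)
    ultimately have "open {y}" by simp
    then show ?thesis by (simp add: clopen_def)
  qed
  show ?thesis
  proof (cases "\<exists>y :: 'a. infinite {..<y}")
    case True
    then have "infinite {..<LEAST y :: 'a. infinite {..<y}}"
      by (rule LeastI_ex)
    moreover have "{..<LEAST y :: 'a. infinite {..<y}} \<subseteq> {y. clopen {y}}"
      using not_less_Least fin by blast
    ultimately show ?thesis using finite_subset by blast
  next
    case False
    then have "{y :: 'a. clopen {y}} = UNIV" using fin by blast
    then show ?thesis using assms by simp
  qed
qed

text \<open>A rank-one projection has infinitely many copies: the value at \<open>z\<close> is
  deposited at the isolated points \<open>\<iota> n\<close> and read off there again.\<close>

lemma (in ops_ideal) const_op_mem_ideal:
  fixes A :: "'a set"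
  assumes A: "clopen A" "z \<in> A" and iso: "infinite {y :: 'a. clopen {y}}"
  shows "const_op A z \<in> I"
proof -
  obtain \<iota> :: "nat \<Rightarrow> 'a" where \<iota>: "inj \<iota>" "range \<iota> \<subseteq> {y. clopen {y}}"
    using infinite_countable_subset[OF iso] by blast
  then have [simp]: "clopen {\<iota> n}" "\<iota> m = \<iota> n \<longleftrightarrow> m = n" for m n
    by (auto simp: inj_eq)
  show ?thesis
  proof (rule infinite_multiple[of _ "\<lambda>n. const_op {\<iota> n} z" "\<lambda>n. const_op A (\<iota> n)"])
    show "const_op A z o\<^sub>L const_op A z = (const_op A z :: ('a \<Rightarrow>\<^sub>C 'k) \<Rightarrow>\<^sub>L _)"
      using A by (intro ops_eqI) simp
    show "const_op A (\<iota> m) o\<^sub>L const_op {\<iota> n} z = (if m = n then const_op A z else (0 :: ('a \<Rightarrow>\<^sub>C 'k) \<Rightarrow>\<^sub>L _))"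
      for m n using A by (intro ops_eqI) auto
  qed (use A in auto)
qed

abbreviation initial_op :: "'a::{wellorder,linorder_topology} \<Rightarrow> ('a \<Rightarrow>\<^sub>C 'k::real_normed_field) \<Rightarrow>\<^sub>L ('a \<Rightarrow>\<^sub>C 'k)"
  where "initial_op \<delta> \<equiv> restrict_op {..\<delta>}"

text \<open>Ordinal addition, sending \<open>i\<close> to \<open>d + 1 + i\<close> as long as this
  exists in the space.\<close>

definition enum_above :: "'a::wellorder \<Rightarrow> 'a \<Rightarrow> 'a"
  where "enum_above d = normal_rec (\<lambda>_ y. LEAST z. y < z) d"

text \<open>A recursion by successors skips no point: the values at stages before
  \<open>lower_inv h x\<close> lie below \<open>x\<close>, so their successors are at most
  \<open>x\<close>, and \<open>h_least\<close> applies.\<close>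

lemma normal_map_Suc_lower_inv:
  assumes h: "normal_map d \<delta> \<beta> (\<lambda>_ y. LEAST z. y < z) h" and x: "d < x" "x \<le> \<beta>"
  shows "h (lower_inv h x) = x"
proof -
  interpret normal_map d \<delta> \<beta> "\<lambda>_ y. LEAST z. y < z" h by (rule h)
  show ?thesis
    using x le_h_lower_inv[of x] lower_inv_le[of x]
    by (intro antisym h_least) (auto intro!: Least_le h_less_of_less_lower_inv)
qed

section \<open>The least initial segment whose projection is outside an ideal\<close>

locale critical_ideal = ops_ideal I
  for I :: "(('a::{wellorder,linorder_topology} \<Rightarrow>\<^sub>C 'k::{real_normed_field,banach}) \<Rightarrow>\<^sub>L ('a \<Rightarrow>\<^sub>C 'k)) set" +
  fixes \<beta> :: 'a
  assumes infinite: "infinite (UNIV :: 'a set)"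
    and initial_op_notin: "initial_op \<beta> \<notin> I"
    and initial_op_mem: "\<delta> < \<beta> \<Longrightarrow> initial_op \<delta> \<in> I"
begin

lemma const_mem: "clopen A \<Longrightarrow> z \<in> A \<Longrightarrow> const_op A z \<in> I"
  by (rule const_op_mem_ideal[OF _ _ infinite_isolated[OF infinite]])

text \<open>If \<beta> were the least element, \<open>initial_op \<beta>\<close> would be a rank-one
  operator; if it were the successor of \<open>v\<close>, it would be \<open>initial_op v\<close>
  plus a rank-one operator.\<close>

lemma limit: "limit_point \<beta>"
  unfolding limit_point_def
proof (intro conjI allI impI)
  show "\<exists>v. v < \<beta>"
  proof (rule ccontr)
    assume "\<not> ?thesis"
    then have [simp]: "x \<le> \<beta> \<longleftrightarrow> x = \<beta>" for x by (auto simp: not_less intro: antisym)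
    have "initial_op \<beta> = (const_op {..\<beta>} \<beta> :: ('a \<Rightarrow>\<^sub>C 'k) \<Rightarrow>\<^sub>L _)"
      by (rule ops_eqI) auto
    then show False using initial_op_notin const_mem[of "{..\<beta>}" \<beta>] by simp
  qed
  fix v assume v: "v < \<beta>"
  show "\<exists>w. v < w \<and> w < \<beta>"
  proof (rule ccontr)
    assume "\<not> ?thesis"
    then have "\<not> x < \<beta>" if "v < x" for x using that by blast
    then have *: "x \<le> \<beta> \<longleftrightarrow> x \<le> v \<or> x = \<beta>" for x
      using v by (cases "v < x") (auto simp: order.order_iff_strict)
    have "initial_op \<beta> = initial_op v + (const_op {v<..\<beta>} \<beta> :: ('a \<Rightarrow>\<^sub>C 'k) \<Rightarrow>\<^sub>L _)"
      by (rule ops_eqI) (use v in \<open>auto simp: * blinfun.add_left\<close>)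
    then show False
      using initial_op_notin add[OF initial_op_mem[OF v] const_mem[of "{v<..\<beta>}" \<beta>]] v by simp
  qed
qed

lemma Suc_less: "v < \<beta> \<Longrightarrow> (LEAST z. v < z) < \<beta>" and less_Suc: "v < \<beta> \<Longrightarrow> v < (LEAST z. v < z)"
proof -
  assume "v < \<beta>"
  then obtain w where w: "v < w" "w < \<beta>" using limit by (auto simp: limit_point_def)
  then show "(LEAST z. v < z) < \<beta>" using Least_le[of "\<lambda>z. v < z" w] by simp
  show "v < (LEAST z. v < z)" using LeastI[of "\<lambda>z. v < z" w] w by simp
qed

text \<open>\<open>T\<close> is composition with rounding up to the range of \<open>h\<close>. It
  factors through the functions on \<open>{..\<delta>}\<close>, and
  \<open>initial_op \<delta>\<close> is in the ideal.\<close>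

lemma normal_map_lower_inv_op:
  assumes h: "normal_map b \<delta> \<beta> G h" and "\<delta> < \<beta>"
    and T: "T \<in> bounded_ops" "\<And>f x. apply_bcontfun (blinfun_apply T f) x =
      (if x \<le> \<beta> then apply_bcontfun f (h (lower_inv h x)) else 0)"
  shows "T \<in> I"
proof -
  interpret normal_map b \<delta> \<beta> G h by (rule h)
  have cont: "continuous_on UNIV (apply_bcontfun f)" for f :: "'a \<Rightarrow>\<^sub>C 'k"
    by (rule continuous_on_apply_bcontfun)
  note U = comp_op_apply[where 'k = 'k, OF continuous_comp_lower_inv[OF cont]]
    comp_op_mem[where 'k = 'k, OF continuous_comp_lower_inv[OF cont]]
  note V = comp_op_apply[where 'k = 'k, OF continuous_comp_h[OF cont]]
    comp_op_mem[where 'k = 'k, OF continuous_comp_h[OF cont]]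
  have "T = comp_op {..\<beta>} (lower_inv h) o\<^sub>L initial_op \<delta> o\<^sub>L comp_op {..\<delta>} h"
    by (rule ops_eqI) (auto simp: T(2) U V lower_inv_le)
  moreover have "comp_op {..\<beta>} (lower_inv h) o\<^sub>L initial_op \<delta> o\<^sub>L comp_op {..\<delta>} h \<in> I"
    by (rule rmult[OF lmult[OF U(2) initial_op_mem[OF \<open>\<delta> < \<beta>\<close>]] V(2)])
  ultimately show ?thesis by simp
qed

text \<open>This says that \<beta> is additively indecomposable: \<open>{d<..\<beta>}\<close> has
  the order type of \<open>{..\<beta>}\<close>. If the enumeration ended at some
  \<open>\<delta> < \<beta>\<close>, restriction to \<open>{d<..\<beta>}\<close> would factor
  through \<open>initial_op \<delta>\<close>, and \<open>initial_op \<beta>\<close> would be in the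
  ideal.\<close>

lemma enum_above:
  assumes d: "d < \<beta>"
  shows "normal_map d \<beta> \<beta> (\<lambda>_ y. LEAST z. y < z) (enum_above d)"
proof -
  obtain \<delta> where \<delta>: "\<delta> \<le> \<beta>" and h: "normal_map d \<delta> \<beta> (\<lambda>_ y. LEAST z. y < z) (enum_above d)"
    using ex_normal_map[OF d, of "\<lambda>_ y. LEAST z. y < z"] Suc_less less_Suc
    unfolding enum_above_def by blast
  interpret normal_map d \<delta> \<beta> "\<lambda>_ y. LEAST z. y < z" "enum_above d" by (rule h)
  have "\<delta> = \<beta>"
  proof (rule ccontr)
    assume "\<delta> \<noteq> \<beta>"
    then have lt: "\<delta> < \<beta>" using \<delta> by simp
    let ?h = "enum_above d"
    have eq: "?h (lower_inv ?h x) = x" if "d < x" "x \<le> \<beta>" for x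
      using h that by (rule normal_map_Suc_lower_inv)
    have cont: "continuous_on UNIV (apply_bcontfun f)" for f :: "'a \<Rightarrow>\<^sub>C 'k"
      by (rule continuous_on_apply_bcontfun)
    note U = comp_op_apply[where 'k = 'k, OF continuous_comp_lower_inv[OF cont]]
      comp_op_mem[where 'k = 'k, OF continuous_comp_lower_inv[OF cont]]
    note V = comp_op_apply[where 'k = 'k, OF continuous_comp_h[OF cont]]
      comp_op_mem[where 'k = 'k, OF continuous_comp_h[OF cont]]
    let ?T = "comp_op {..\<beta>} (lower_inv ?h) o\<^sub>L comp_op {..\<delta>} ?h :: ('a \<Rightarrow>\<^sub>C 'k) \<Rightarrow>\<^sub>L ('a \<Rightarrow>\<^sub>C 'k)"
    have "?T \<in> I"
      by (rule normal_map_lower_inv_op[OF h lt])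
        (auto simp: U V lower_inv_le intro!: bounded_ops_compose)
    moreover have "initial_op \<beta> = initial_op d + (restrict_op {d<..\<beta>} o\<^sub>L ?T)"
      by (rule ops_eqI) (use d in \<open>auto simp: U V lower_inv_le eq blinfun.add_left\<close>)
    ultimately show False
      using initial_op_notin add[OF initial_op_mem[OF d] lmult[of "restrict_op {d<..\<beta>}" ?T]] by simp
  qed
  then show ?thesis using h by simp
qed

lemma enum_above_lower_inv:
  assumes "d < x" "x \<le> \<beta>"
  shows "enum_above d (lower_inv (enum_above d) x) = x"
  using normal_map_Suc_lower_inv[OF enum_above] assms by simp

definition vanish_op :: "('a \<Rightarrow>\<^sub>C 'k) \<Rightarrow>\<^sub>L ('a \<Rightarrow>\<^sub>C 'k)"
  where "vanish_op = initial_op \<beta> - const_op {..\<beta>} \<beta>"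

lemma vanish_op_apply [simp]:
  "apply_bcontfun (blinfun_apply vanish_op f) x = (if x \<le> \<beta> then apply_bcontfun f x - apply_bcontfun f \<beta> else 0)"
  by (auto simp: vanish_op_def blinfun.diff_left)

lemma vanish_op_mem [simp, intro]: "vanish_op \<in> bounded_ops"
  unfolding vanish_op_def by (intro bounded_ops_diff) auto

lemma vanish_op_notin: "vanish_op \<notin> I"
proof
  assume "vanish_op \<in> I"
  from add[OF this const_mem[of "{..\<beta>}" \<beta>]] show False
    using initial_op_notin by (simp add: vanish_op_def)
qed

text \<open>Otherwise \<open>\<beta> = \<omega>\<close>, and \<open>c\<^sub>0\<close> is the \<open>c\<^sub>0\<close>-sum of infinitely many copies of itself.\<close>

lemma infinite_below: "\<exists>y<\<beta>. infinite {..<y}"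
proof (rule ccontr)
  assume "\<not> ?thesis"
  then have fin: "finite {..<y}" if "y < \<beta>" for y using that by blast
  define A where "A = {..<\<beta>}"
  have "infinite A"
  proof
    assume "finite A"
    moreover have "A \<noteq> {}" using limit by (auto simp: A_def limit_point_def)
    ultimately have "Max A \<in> A" "\<And>x. x \<in> A \<Longrightarrow> x \<le> Max A" by auto
    then show False using limit unfolding A_def limit_point_def by (metis lessThan_iff not_le)
  qed
  moreover have "countable A"
  proof (rule countableI[where f = "\<lambda>y. card {..<y}"], rule inj_onI)
    fix x y assume "x \<in> A" "y \<in> A" "card {..<x} = card {..<y}"
    moreover have "card {..<u} < card {..<v}" if "u < v" "v \<in> A" for u v
      using that fin by (intro psubset_card_mono) (auto simp: A_def)
    ultimately show "x = y" by (metis linorder_neqE less_irrefl)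
  qed
  ultimately obtain t :: "'a \<Rightarrow> nat" and b where
    t: "\<And>n. b n \<in> A" "\<And>n. t (b n) = n" "\<And>x. x \<in> A \<Longrightarrow> b (t x) = x"
    using that[of "from_nat_into A" "to_nat_on A"] from_nat_into[of A] by fastforce
  \<comment> \<open>The points of \<open>A\<close> are isolated. Since \<open>u\<close> is injective
    and \<open>f\<close> tends to \<open>f \<beta>\<close> at \<beta>, the difference reaches
    \<open>e\<close> at finitely many points only.\<close>
  have op: "continuous_on UNIV (diff_comp S u S (\<lambda>_. \<beta>) (apply_bcontfun f))"
    if S: "S \<subseteq> A" "u ` S \<subseteq> A" "inj_on u S" for S u and f :: "'a \<Rightarrow>\<^sub>C 'k"
  proof (rule continuous_on_disjoint_family[where K = S and D = "\<lambda>c. {c}"])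
    fix c assume c: "c \<in> S"
    have "{c} = {..c} - {..<c}" by auto
    moreover have "open ({..c} - {..<c})"
      using fin[of c] c S by (intro open_Diff wellorder_open_atMost finite_imp_closed) (auto simp: A_def)
    ultimately have "open {c}" by simp
    moreover have "(\<lambda>x. if x \<in> {c} then diff_comp S u S (\<lambda>_. \<beta>) (apply_bcontfun f) x else 0) =
        (\<lambda>x. if x \<in> {c} then diff_comp S u S (\<lambda>_. \<beta>) (apply_bcontfun f) c else 0)" by auto
    ultimately show "continuous_on UNIV (\<lambda>x. if x \<in> {c} then diff_comp S u S (\<lambda>_. \<beta>) (apply_bcontfun f) x else 0)"
      by (simp only:) (intro continuous_on_if_clopen continuous_on_const closed_singleton)
  next
    fix e :: real assume e: "0 < e"
    obtain v where "v < \<beta>" using limit by (auto simp: limit_point_def)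
    then obtain w where w: "w < \<beta>" "\<And>x. w < x \<Longrightarrow> x \<le> \<beta> \<Longrightarrow> dist (apply_bcontfun f x) (apply_bcontfun f \<beta>) < e"
      using wellorder_continuousD[OF continuous_on_apply_bcontfun e] by metis
    have "{..w} = insert w {..<w}" by auto
    then have "finite {..w}" using fin[OF w(1)] by simp
    then have "finite (u -` {..w} \<inter> S)" by (rule finite_vimage_IntI) (rule S)
    moreover have "{c \<in> S. \<exists>x\<in>{c}. e \<le> norm (diff_comp S u S (\<lambda>_. \<beta>) (apply_bcontfun f) x)} \<subseteq> u -` {..w} \<inter> S"
      using w(2) S by (force simp: diff_comp_def dist_norm A_def not_le[symmetric])
    ultimately show "finite {c \<in> S. \<exists>x\<in>{c}. e \<le> norm (diff_comp S u S (\<lambda>_. \<beta>) (apply_bcontfun f) x)}"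
      by (rule rev_finite_subset)
  qed (auto simp: disjoint_family_on_def diff_comp_def)
  \<comment> \<open>The pairing of natural numbers splits \<open>A\<close> into infinitely many sets
    \<open>S n\<close>, each mapped bijectively onto \<open>A\<close> by \<open>u\<close>, with
    inverse \<open>v n\<close>.\<close>
  define S u v where "S n = {y \<in> A. fst (prod_decode (t y)) = n}"
    and "u y = b (snd (prod_decode (t y)))" and "v n y = b (prod_encode (n, t y))" for n y
  have "inj_on u (S n)" for n
  proof (rule inj_onI)
    fix x y assume xy: "x \<in> S n" "y \<in> S n" "u x = u y"
    then have "snd (prod_decode (t x)) = snd (prod_decode (t y))"
      using t(2) unfolding u_def by metis
    with xy have "prod_decode (t x) = prod_decode (t y)"
      by (simp add: S_def prod_eq_iff)
    then have "t x = t y" by (simp add: prod_decode_eq)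
    with xy show "x = y" using t(3) by (metis (lifting) S_def mem_Collect_eq)
  qed
  then have "S n \<subseteq> A" "u ` S n \<subseteq> A" "inj_on u (S n)" for n
    using t(1) by (auto simp: S_def u_def)
  note U = diff_comp_op_apply[OF op[OF this]] diff_comp_op_mem[OF op[OF this]]
  have "inj_on (v n) A" for n
  proof (rule inj_onI)
    fix x y assume xy: "x \<in> A" "y \<in> A" "v n x = v n y"
    then have "prod_encode (n, t x) = prod_encode (n, t y)"
      using t(2) unfolding v_def by metis
    with xy show "x = y" using t(3) by (metis prod_encode_eq prod.inject)
  qed
  then have "A \<subseteq> A" "v n ` A \<subseteq> A" "inj_on (v n) A" for n
    using t(1) by (auto simp: v_def)
  note V = diff_comp_op_apply[OF op[OF this]] diff_comp_op_mem[OF op[OF this]]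
  have [simp]: "\<beta> \<notin> A" "\<beta> \<notin> S n" for n by (auto simp: A_def S_def)
  have [simp]: "x < \<beta> \<longleftrightarrow> x \<in> A" for x by (auto simp: A_def)
  have [simp]: "v m x \<in> S n \<longleftrightarrow> m = n" "u (v m x) = x" if "x \<in> A" for m n x
    using t that by (auto simp: v_def S_def u_def)
  have "vanish_op \<in> I"
  proof (rule infinite_multiple[of _ "\<lambda>n. diff_comp_op (S n) u (S n) (\<lambda>_. \<beta>)" "\<lambda>n. diff_comp_op A (v n) A (\<lambda>_. \<beta>)"])
    show "vanish_op o\<^sub>L vanish_op = vanish_op"
      by (rule ops_eqI) auto
    show "diff_comp_op A (v m) A (\<lambda>_. \<beta>) o\<^sub>L diff_comp_op (S n) u (S n) (\<lambda>_. \<beta>) =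
        (if m = n then vanish_op else 0)" for m n
      by (rule ops_eqI) (auto simp: U V le_less)
  qed (auto intro: U V)
  then show False using vanish_op_notin by simp
qed

end

subsection \<open>Closed cofinal sets\<close>

text \<open>\<open>C\<close> is the disjoint union of the orbits of \<open>s\<close>, each starting
  at a point outside the image of \<open>s\<close>. On each orbit, a copy of the natural numbers,
  \<open>r n\<close> moves the k-th element to the position that codes the pair of k and n.\<close>

lemma ex_disjoint_shifts:
  fixes s :: "'a::wellorder \<Rightarrow> 'a"
  assumes s: "\<And>c. c \<in> C \<Longrightarrow> s c \<in> C" "\<And>c. c \<in> C \<Longrightarrow> c < s c" and inj: "inj_on s C"
  obtains r :: "nat \<Rightarrow> 'a \<Rightarrow> 'a" where "\<And>n c. c \<in> C \<Longrightarrow> r n c \<in> C" "\<And>n c. c \<in> C \<Longrightarrow> c \<le> r n c"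
    "\<And>m n c d. c \<in> C \<Longrightarrow> d \<in> C \<Longrightarrow> r m c = r n d \<Longrightarrow> m = n \<and> c = d"
proof -
  have dec: "\<exists>k l. l \<in> C \<and> l \<notin> s ` C \<and> c = (s ^^ k) l" if "c \<in> C" for c
    using that
  proof (induction c rule: less_induct)
    case (less c)
    show ?case
    proof (cases "c \<in> s ` C")
      case True
      then obtain d where d: "d \<in> C" "c = s d" by blast
      then obtain k l where "l \<in> C" "l \<notin> s ` C" "d = (s ^^ k) l"
        using less.IH[of d] s by blast
      then show ?thesis using d by (intro exI[of _ "Suc k"] exI[of _ l]) simp
    next
      case False
      then show ?thesis using less.prems by (intro exI[of _ 0] exI[of _ c]) simp
    qed
  qed
  then obtain k l where kl: "\<And>c. c \<in> C \<Longrightarrow> l c \<in> C" "\<And>c. c \<in> C \<Longrightarrow> l c \<notin> s ` C"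
      "\<And>c. c \<in> C \<Longrightarrow> c = (s ^^ k c) (l c)"
    by metis
  have mem: "(s ^^ i) c \<in> C" if "c \<in> C" for i c
    using that s by (induction i) auto
  have le: "c \<le> (s ^^ i) c" if "c \<in> C" for i c
  proof (induction i)
    case (Suc i)
    then show ?case using s(2)[OF mem[OF that, of i]] by simp
  qed simp
  have unique: "i = j \<and> x = y"
    if "x \<in> C" "y \<in> C" "x \<notin> s ` C" "y \<notin> s ` C" "(s ^^ i) x = (s ^^ j) y" for i j x y
    using that(5)
  proof (induction i arbitrary: j)
    case 0
    then show ?case using that mem[of y] by (cases j) auto
  next
    case (Suc i)
    show ?case
    proof (cases j)
      case 0
      then show ?thesis using Suc.prems that mem[of x i] by auto
    next
      case (Suc j')
      then have "(s ^^ i) x = (s ^^ j') y"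
        using Suc.prems inj_onD[OF inj _ mem[OF that(1)] mem[OF that(2)]] by simp
      then show ?thesis using Suc.IH Suc by blast
    qed
  qed
  show ?thesis
  \<comment> \<open>Injectivity of the pairing gives disjointness. The code of a pair is at least
    its first component, which gives \<open>c \<le> r n c\<close>.\<close>
  proof (rule that[of "\<lambda>n c. (s ^^ prod_encode (k c, n)) (l c)"])
    fix n c assume c: "c \<in> C"
    show "(s ^^ prod_encode (k c, n)) (l c) \<in> C"
      by (rule mem[OF kl(1)[OF c]])
    have "(s ^^ prod_encode (k c, n)) (l c) = (s ^^ (prod_encode (k c, n) - k c)) ((s ^^ k c) (l c))"
      using le_prod_encode_1[of "k c" n] by (simp add: funpow_add[symmetric, unfolded o_def, THEN fun_cong])
    then show "c \<le> (s ^^ prod_encode (k c, n)) (l c)"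
      using le[OF c] kl(3)[OF c] by simp
  next
    fix m n c d assume c: "c \<in> C" "d \<in> C"
      and eq: "(s ^^ prod_encode (k c, m)) (l c) = (s ^^ prod_encode (k d, n)) (l d)"
    have "prod_encode (k c, m) = prod_encode (k d, n) \<and> l c = l d"
      using unique[OF _ _ _ _ eq] kl c by blast
    then have "k c = k d" "m = n" "l c = l d" by (simp_all add: prod_encode_eq)
    then show "m = n \<and> c = d"
      using kl(3)[OF c(1)] kl(3)[OF c(2)] by simp
  qed
qed

text \<open>Closed and cofinal in \<open>{..<\<beta>}\<close>. The premise \<open>v < z\<close>
  keeps out the least element, for which the condition of accumulation is vacuous.\<close>

locale club =
  fixes \<beta> :: "'a::{wellorder,linorder_topology}" and C :: "'a set"
  assumes below: "c \<in> C \<Longrightarrow> c < \<beta>"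
    and cofinal: "y < \<beta> \<Longrightarrow> \<exists>c\<in>C. y < c"
    and closed_below: "z < \<beta> \<Longrightarrow> v < z \<Longrightarrow> (\<And>w. w < z \<Longrightarrow> \<exists>c\<in>C. w < c \<and> c < z) \<Longrightarrow> z \<in> C"
begin

definition up :: "'a \<Rightarrow> 'a"
  where "up x = (LEAST c. (c \<in> C \<or> c = \<beta>) \<and> x \<le> c)"

lemma
  assumes "x \<le> \<beta>"
  shows up_mem: "up x \<in> C \<or> up x = \<beta>" and le_up: "x \<le> up x"
  using LeastI[of "\<lambda>c. (c \<in> C \<or> c = \<beta>) \<and> x \<le> c" \<beta>] assms unfolding up_def by auto

lemma up_least: "c \<in> C \<or> c = \<beta> \<Longrightarrow> x \<le> c \<Longrightarrow> up x \<le> c"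
  unfolding up_def by (rule Least_le) simp

lemma up_eq: "c \<in> C \<or> c = \<beta> \<Longrightarrow> up c = c"
  using below by (intro antisym up_least le_up) (auto intro: less_imp_le)

lemma up_in: "x < \<beta> \<Longrightarrow> up x \<in> C"
  using cofinal[of x] up_least[of _ x] below up_mem[of x] by fastforce

definition fiber :: "'a \<Rightarrow> 'a set"
  where "fiber c = {x. x < \<beta> \<and> up x = c}"

lemma fiberD: "x \<in> fiber c \<Longrightarrow> x < \<beta>" "x \<in> fiber c \<Longrightarrow> up x = c" "x \<in> fiber c \<Longrightarrow> x \<le> c"
  using le_up[of x] by (auto simp: fiber_def)

lemma mem_fiber_up: "x < \<beta> \<Longrightarrow> x \<in> fiber (up x)" "c \<in> C \<Longrightarrow> c \<in> fiber c"
  using below up_eq by (auto simp: fiber_def)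

text \<open>If \<open>C\<close> accumulates at \<open>c\<close> from below, the fiber is
  \<open>{c}\<close>. Otherwise it reaches down to the preceding element of \<open>C\<close>, or to
  the bottom if there is none.\<close>

lemma fiber_cases:
  assumes c: "c \<in> C"
  shows "fiber c = {c} \<or> (\<exists>w. fiber c = {w<..c}) \<or> fiber c = {..c}"
proof (cases "\<exists>w<c. \<forall>c'\<in>C. \<not> (w < c' \<and> c' < c)")
  case False
  have "x = c" if "x \<in> fiber c" for x
  proof (rule ccontr)
    assume "x \<noteq> c"
    with fiberD(3)[OF that] have "x < c" by simp
    with False obtain c' where "c' \<in> C" "x < c'" "c' < c" by blast
    then have "up x \<le> c'" by (intro up_least) auto
    then show False using fiberD(2)[OF that] \<open>c' < c\<close> by simp
  qed
  then have "fiber c = {c}" using mem_fiber_up(2)[OF c] by blast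
  then show ?thesis by blast
next
  case True
  \<comment> \<open>If the least such \<open>w\<close> is in \<open>C\<close>, it is the preceding
    element of \<open>C\<close>. Otherwise it is the bottom: if anything were smaller,
    \<open>C\<close> would accumulate at \<open>w\<close>, and closedness would put \<open>w\<close>
    into \<open>C\<close>.\<close>
  define w where "w = (LEAST w. w < c \<and> (\<forall>c'\<in>C. \<not> (w < c' \<and> c' < c)))"
  from True have "w < c \<and> (\<forall>c'\<in>C. \<not> (w < c' \<and> c' < c))"
    unfolding w_def by (rule LeastI_ex)
  then have w: "w < c" "\<And>c'. c' \<in> C \<Longrightarrow> w < c' \<Longrightarrow> c \<le> c'" by (auto simp: not_less)
  have least: "\<exists>c'\<in>C. v < c' \<and> c' < c" if "v < w" for v
    using not_less_Least[OF that[unfolded w_def]] that w(1) by auto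
  have up: "up x = c" if "w < x" "x \<le> c" for x
  proof (rule antisym)
    have "x < \<beta>" using that below[OF c] by simp
    moreover have "w < up x" using le_up[of x] that \<open>x < \<beta>\<close> by (meson less_imp_le less_le_trans)
    ultimately show "c \<le> up x" using w(2)[OF up_in] by blast
  qed (use c that in \<open>auto intro: up_least\<close>)
  have cb: "c < \<beta>" by (rule below[OF c])
  show ?thesis
  proof (cases "w \<in> C")
    case True
    have "x \<in> fiber c \<longleftrightarrow> w < x \<and> x \<le> c" for x
    proof
      assume x: "x \<in> fiber c"
      have "\<not> x \<le> w"
        using up_least[of w x] True w(1) fiberD(2)[OF x] by auto
      then show "w < x \<and> x \<le> c" using fiberD(3)[OF x] by simp
    qed (use up cb in \<open>auto simp: fiber_def\<close>)
    then have "fiber c = {w<..c}" unfolding set_eq_iff by simp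
    then show ?thesis by blast
  next
    case False
    have "\<not> v < w" for v
    proof
      assume v: "v < w"
      have "w \<in> C"
      proof (rule closed_below[OF _ v])
        show "w < \<beta>" using w(1) cb by simp
        fix u assume u: "u < w"
        with least obtain c' where "c' \<in> C" "u < c'" "c' < c" by blast
        then show "\<exists>c\<in>C. u < c \<and> c < w"
          using w(2)[of c'] False by (metis linorder_neqE leD)
      qed
      with False show False ..
    qed
    then have "w < x" if "x \<in> C" for x using that False by (metis linorder_neqE)
    then have C: "c \<le> x" if "x \<in> C" for x using w(2) that by blast
    have "up x = c" if "x \<le> c" for x
    proof (rule antisym)
      have "x < \<beta>" using that cb by simp
      then show "c \<le> up x" by (intro C up_in)
    qed (use c that in \<open>auto intro: up_least\<close>)
    then have "x \<in> fiber c" if "x \<le> c" for x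
      using that le_less_trans[OF that cb] by (simp add: fiber_def)
    then have "fiber c = {..c}"
      using fiberD(3) by (intro equalityI subsetI) simp_all
    then show ?thesis by blast
  qed
qed

text \<open>Otherwise the fibers with large oscillation would accumulate at some point.\<close>

lemma finite_oscillation:
  fixes f :: "'a \<Rightarrow> 'b::metric_space"
  assumes f: "continuous_on UNIV f" and e: "0 < e"
  shows "finite {c \<in> C. \<exists>a\<in>fiber c. \<exists>b\<in>fiber c. e \<le> dist (f a) (f b)}"
proof (rule ccontr)
  define D where "D = {c \<in> C. \<exists>a\<in>fiber c. \<exists>b\<in>fiber c. e \<le> dist (f a) (f b)}"
  assume "infinite {c \<in> C. \<exists>a\<in>fiber c. \<exists>b\<in>fiber c. e \<le> dist (f a) (f b)}"
  then have "infinite D" by (simp add: D_def)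
  \<comment> \<open>The first point below which infinitely many bad fibers occur, hence an
    accumulation point of \<open>D\<close>.\<close>
  define z where "z = (LEAST z. infinite (D \<inter> {..<z}))"
  have "D \<inter> {..<\<beta>} = D" using below by (auto simp: D_def)
  then have z: "infinite (D \<inter> {..<z})"
    unfolding z_def using \<open>infinite D\<close> by (intro LeastI[of "\<lambda>z. infinite (D \<inter> {..<z})" \<beta>]) simp
  have inf': "infinite (D \<inter> {w<..<z})" if "w < z" for w
  proof
    assume "finite (D \<inter> {w<..<z})"
    moreover have "finite (D \<inter> {..<w})"
      using not_less_Least[OF that[unfolded z_def]] by blast
    moreover have "D \<inter> {..<z} \<subseteq> (D \<inter> {w<..<z}) \<union> (D \<inter> {..<w}) \<union> {w}"
      by (auto simp: not_less)
    ultimately show False using z by (meson finite.emptyI finite.insertI finite_UnI finite_subset)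
  qed
  have ex: "\<exists>c\<in>D. w < c \<and> c < z" if "w < z" for w
    using inf'[OF that] by (metis finite.emptyI ex_in_conv Int_iff greaterThanLessThan_iff)
  have "D \<inter> {..<z} \<noteq> {}" using z by force
  then obtain v where v: "v < z" by blast
  obtain w where w: "w < z" "\<And>x. w < x \<Longrightarrow> x \<le> z \<Longrightarrow> dist (f x) (f z) < e / 2"
    using wellorder_continuousD[OF f _ v, of "e / 2"] e by auto
  \<comment> \<open>The intermediate \<open>c'\<close> keeps the whole fiber of \<open>c\<close>
    above \<open>w\<close>.\<close>
  obtain c' where c': "c' \<in> D" "w < c'" "c' < z" using ex[OF w(1)] by blast
  obtain c where c: "c \<in> D" "c' < c" "c < z" using ex[OF c'(3)] by blast
  have near: "dist (f a) (f z) < e / 2" if a: "a \<in> fiber c" for a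
  proof (rule w(2))
    have "\<not> a \<le> c'"
    proof
      assume "a \<le> c'"
      then have "up a \<le> c'" using c'(1) by (intro up_least) (auto simp: D_def)
      then show False using fiberD(2)[OF a] c(2) by simp
    qed
    then show "w < a" using c'(2) by simp
    show "a \<le> z" using fiberD(3)[OF a] c(3) by simp
  qed
  from c(1) obtain a b where ab: "a \<in> fiber c" "b \<in> fiber c" "e \<le> dist (f a) (f b)"
    by (auto simp: D_def)
  then show False
    using dist_triangle_half_l[OF near[OF ab(1)] near[OF ab(2)]] by simp
qed

text \<open>On \<open>D c\<close> the difference is bounded by the oscillation of \<open>f\<close>
  on the single fiber of \<open>t c\<close>. As \<open>t\<close> is injective, only finitely many
  pieces carry values of size \<open>e\<close>, so this is a c_0-sum. By \<open>piece\<close>, the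
  difference is zero on \<open>D c\<close>, or \<open>D c\<close> is clopen and carries a continuous
  function minus a constant.\<close>

lemma continuous_on_diff_comp_fibers:
  fixes f :: "'a \<Rightarrow> 'k::real_normed_field"
  assumes f: "continuous_on UNIV f" and D: "disjoint_family_on D C"
    and t: "inj_on t C" "t ` C \<subseteq> C"
    and uv: "\<And>c x. c \<in> C \<Longrightarrow> x \<in> D c \<Longrightarrow> u x \<in> fiber (t c) \<and> v x \<in> fiber (t c)"
    and piece: "\<And>c. c \<in> C \<Longrightarrow> (\<forall>x\<in>D c. u x = v x) \<or>
      (clopen (D c) \<and> (\<exists>g k. continuous_on UNIV g \<and> (\<forall>x\<in>D c. f (u x) = g x \<and> v x = k)))"
  shows "continuous_on UNIV (diff_comp (\<Union>c\<in>C. D c) u (\<Union>c\<in>C. D c) v f)"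
proof (rule continuous_on_disjoint_family[OF _ D])
  fix c assume c: "c \<in> C"
  let ?F = "diff_comp (\<Union>c\<in>C. D c) u (\<Union>c\<in>C. D c) v f"
  have F: "(\<lambda>x. if x \<in> D c then ?F x else 0) = (\<lambda>x. if x \<in> D c then f (u x) - f (v x) else 0)"
    using c by (auto simp: diff_comp_def)
  show "continuous_on UNIV (\<lambda>x. if x \<in> D c then ?F x else 0)"
    using piece[OF c]
  proof (elim disjE conjE exE)
    assume "\<forall>x\<in>D c. u x = v x"
    then have "(\<lambda>x. if x \<in> D c then ?F x else 0) = (\<lambda>_. 0)" unfolding F by auto
    then show ?thesis by (simp only: continuous_on_const)
  next
    fix g k assume D: "clopen (D c)" and g: "continuous_on UNIV g" "\<forall>x\<in>D c. f (u x) = g x \<and> v x = k"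
    have "continuous_on UNIV (\<lambda>x. if x \<in> D c then g x - f k else 0)"
      using D continuous_on_subset[OF g(1)]
      by (intro continuous_on_if_clopen continuous_intros) (auto simp: clopen_def)
    moreover have "(\<lambda>x. if x \<in> D c then ?F x else 0) = (\<lambda>x. if x \<in> D c then g x - f k else 0)"
      unfolding F using g(2) by auto
    ultimately show ?thesis by (simp only:)
  qed
next
  fix e :: real assume "0 < e"
  let ?F = "diff_comp (\<Union>c\<in>C. D c) u (\<Union>c\<in>C. D c) v f"
  let ?B = "{c \<in> C. \<exists>a\<in>fiber c. \<exists>b\<in>fiber c. e \<le> dist (f a) (f b)}"
  have "finite (t -` ?B \<inter> C)"
    by (rule finite_vimage_IntI[OF finite_oscillation[OF f \<open>0 < e\<close>] t(1)])
  moreover have "{c \<in> C. \<exists>x\<in>D c. e \<le> norm (?F x)} \<subseteq> t -` ?B \<inter> C"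
  proof
    fix c assume "c \<in> {c \<in> C. \<exists>x\<in>D c. e \<le> norm (?F x)}"
    then obtain x where c: "c \<in> C" and x: "x \<in> D c" "e \<le> norm (?F x)" by blast
    from c x have "x \<in> (\<Union>c\<in>C. D c)" by blast
    with x have "e \<le> dist (f (u x)) (f (v x))" by (simp add: diff_comp_def dist_norm)
    then show "c \<in> t -` ?B \<inter> C"
      using uv[OF c x(1)] t(2) c by blast
  qed
  ultimately show "finite {c \<in> C. \<exists>x\<in>D c. e \<le> norm (?F x)}"
    by (rule rev_finite_subset)
qed (auto simp: diff_comp_def)

lemma Union_fiber: "(\<Union>c\<in>C. fiber c) = {..<\<beta>}"
  using mem_fiber_up(1) up_in fiberD(1) by auto

lemma disjoint_fiber: "disjoint_family_on fiber C"
  by (auto simp: disjoint_family_on_def fiber_def)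

lemma fiber_cases':
  assumes "c \<in> C"
  shows "fiber c = {c} \<or> clopen (fiber c)"
  using fiber_cases[OF assms] by (metis clopen_atMost clopen_greaterThanAtMost)

text \<open>The projection onto the functions that are supported below \<beta> and vanish on
  \<open>C\<close>. Its complement in \<open>initial_op \<beta>\<close> is composition with
  \<open>up\<close>, whose range is a copy of the continuous functions on
  \<open>C \<union> {\<beta>}\<close>.\<close>

definition fluctuation_op :: "('a \<Rightarrow>\<^sub>C 'k) \<Rightarrow>\<^sub>L ('a \<Rightarrow>\<^sub>C 'k::real_normed_field)"
  where "fluctuation_op = diff_comp_op {..<\<beta>} id {..<\<beta>} up"

lemma continuous_fluctuation:
  "continuous_on UNIV (diff_comp {..<\<beta>} id {..<\<beta>} up (apply_bcontfun (f :: 'a \<Rightarrow>\<^sub>C 'k::real_normed_field)))"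
  unfolding Union_fiber[symmetric]
proof (rule continuous_on_diff_comp_fibers[OF _ disjoint_fiber, where t = id])
  fix c assume c: "c \<in> C"
  show "id x \<in> fiber (id c) \<and> up x \<in> fiber (id c)" if "x \<in> fiber c" for x
    using that mem_fiber_up(2)[OF c] fiberD(2)[OF that] by simp
  show "(\<forall>x\<in>fiber c. id x = up x) \<or> (clopen (fiber c) \<and>
      (\<exists>g k. continuous_on UNIV g \<and> (\<forall>x\<in>fiber c. apply_bcontfun f (id x) = g x \<and> up x = k)))"
    using fiber_cases'[OF c]
  proof
    assume "clopen (fiber c)"
    then show ?thesis
      using fiberD(2) continuous_on_apply_bcontfun[of UNIV f] by auto
  qed (use up_eq c in auto)
qed auto

lemma
  fixes f :: "'a \<Rightarrow>\<^sub>C 'k::real_normed_field"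
  shows fluctuation_op_apply [simp]: "apply_bcontfun (blinfun_apply fluctuation_op f) x =
      (if x < \<beta> then apply_bcontfun f x - apply_bcontfun f (up x) else 0)"
    and fluctuation_op_mem [simp, intro]: "(fluctuation_op :: ('a \<Rightarrow>\<^sub>C 'k) \<Rightarrow>\<^sub>L _) \<in> bounded_ops"
  unfolding fluctuation_op_def
  by (simp_all add: diff_comp_op_apply[OF continuous_fluctuation] diff_comp_op_mem[OF continuous_fluctuation])

end

section \<open>Functions vanishing on a sparse club\<close>

context critical_ideal
begin

text \<open>
  By \<open>fast\<close>, the fiber of \<open>c\<close> embeds into the fiber of the successor in \<open>C\<close> of each \<open>d \<ge> c\<close> in \<open>C\<close>.
  Choosing \<open>d = r n c\<close> with \<open>r\<close> injective yields disjoint copies for different \<open>n\<close>.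
\<close>

lemma fluctuation_mem:
  assumes C: "club \<beta> C" and fast: "\<And>c d. c \<in> C \<Longrightarrow> d \<in> C \<Longrightarrow> c < d \<Longrightarrow> enum_above c c \<le> d"
  shows "club.fluctuation_op \<beta> C \<in> I"
proof -
  interpret club \<beta> C by (rule C)
  define s where "s c = (LEAST d. d \<in> C \<and> c < d)" for c
  have s: "s c \<in> C" "c < s c" "\<And>d. d \<in> C \<Longrightarrow> c < d \<Longrightarrow> s c \<le> d" if "c \<in> C" for c
    using LeastI_ex[of "\<lambda>d. d \<in> C \<and> c < d"] Least_le[of "\<lambda>d. d \<in> C \<and> c < d"]
      cofinal[OF below[OF that]] unfolding s_def by blast+
  have inj_s: "inj_on s C"
    using s by (intro inj_onI) (metis leD linorder_neqE)
  obtain r :: "nat \<Rightarrow> 'a \<Rightarrow> 'a" where r: "\<And>n c. c \<in> C \<Longrightarrow> r n c \<in> C" "\<And>n c. c \<in> C \<Longrightarrow> c \<le> r n c"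
      "\<And>m n c d. c \<in> C \<Longrightarrow> d \<in> C \<Longrightarrow> r m c = r n d \<Longrightarrow> m = n \<and> c = d"
    using ex_disjoint_shifts[OF s(1,2) inj_s] by blast
  define \<phi> :: "'a \<Rightarrow> 'a \<Rightarrow> 'a" where "\<phi> = enum_above"
  have \<phi>: "normal_map d \<beta> \<beta> (\<lambda>_ y. LEAST z. y < z) (\<phi> d)" if "d \<in> C" for d
    unfolding \<phi>_def by (rule enum_above[OF below[OF that]])
  \<comment> \<open>\<open>u n\<close> copies the fiber of \<open>c\<close> in increasing order to a
    place beyond \<open>r n c\<close>; here \<open>up x\<close> recovers \<open>c\<close> from a
    point \<open>x\<close> of its fiber.\<close>
  define u where "u n x = \<phi> (r n (up x)) x" for n x
  \<comment> \<open>The map \<open>\<phi> ?d\<close> sends every \<open>x \<le> ?d\<close> above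
    \<open>?d\<close> but, by \<open>fast\<close>, not beyond \<open>s ?d\<close>, hence into the
    fiber of \<open>s ?d\<close>.\<close>
  have fib: "\<phi> (r n c) x \<in> fiber (s (r n c))" if c: "c \<in> C" and x: "x \<in> fiber c" for n c x
  proof -
    let ?d = "r n c"
    interpret normal_map ?d \<beta> \<beta> "\<lambda>_ y. LEAST z. y < z" "\<phi> ?d"
      by (rule \<phi>[OF r(1)[OF c]])
    note d = r(1)[OF c, of n]
    have x': "x < \<beta>" "x \<le> ?d"
      by (rule fiberD(1)[OF x]) (rule order.trans[OF fiberD(3)[OF x] r(2)[OF c]])
    have lt: "?d < \<phi> ?d x" "\<phi> ?d x < \<beta>"
      by (rule h_gt[OF less_imp_le[OF x'(1)]]) (rule h_less[OF x'(1)])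
    have "\<phi> ?d x \<le> \<phi> ?d ?d"
      by (rule h_mono_le[OF x'(2) less_imp_le[OF below[OF d]]])
    also have "\<dots> \<le> s ?d"
      unfolding \<phi>_def by (rule fast[OF d s(1)[OF d] s(2)[OF d]])
    finally have "up (\<phi> ?d x) \<le> s ?d"
      by (rule up_least[OF disjI1[OF s(1)[OF d]]])
    moreover have "s ?d \<le> up (\<phi> ?d x)"
      by (rule s(3)[OF d up_in[OF lt(2)] less_le_trans[OF lt(1) le_up[OF less_imp_le[OF lt(2)]]]])
    ultimately have "up (\<phi> ?d x) = s ?d" by (rule antisym)
    then show ?thesis using lt(2) by (simp add: fiber_def)
  qed
  have u_fib: "u n x \<in> fiber (s (r n c))" if "c \<in> C" "x \<in> fiber c" for n c x
    using fib[OF that] fiberD(2)[OF that(2)] by (simp add: u_def)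
  \<comment> \<open>The fiber that contains the value determines \<open>r n (up x)\<close>, hence
    both \<open>n\<close> and \<open>up x\<close>. Within one fiber the map is strictly
    increasing.\<close>
  have inj_u: "m = n \<and> x = y" if eq: "u m x = u n y" and xy: "x < \<beta>" "y < \<beta>" for m n x y
  proof -
    have "s (r m (up x)) = s (r n (up y))"
      using u_fib[OF up_in mem_fiber_up(1)] xy eq fiberD(2) by metis
    then have "r m (up x) = r n (up y)"
      using inj_onD[OF inj_s] r(1) up_in xy by blast
    then have *: "m = n" "up x = up y" using r(3) up_in xy by blast+
    interpret normal_map "r m (up x)" \<beta> \<beta> "\<lambda>_ y. LEAST z. y < z" "\<phi> (r m (up x))"
      by (rule \<phi>[OF r(1)[OF up_in[OF xy(1)]]])
    have "x = y"
      using eq xy * h_less_iff[of x y] h_less_iff[of y x] unfolding u_def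
      by (metis less_imp_le linorder_neqE less_irrefl)
    with * show ?thesis by blast
  qed
  have inj_t: "inj_on (\<lambda>c. s (r n c)) C" for n
    using inj_onD[OF inj_s] r by (intro inj_onI) blast
  define W where "W n = u n ` {..<\<beta>}" for n
  define w where "w n = inv_into {..<\<beta>} (u n)" for n
  have w: "w n (u n x) = x" if "x < \<beta>" for n x
    unfolding w_def using inj_u that by (intro inv_into_f_f inj_onI) auto
  have W: "u m x \<in> W n \<longleftrightarrow> m = n" if "x < \<beta>" for m n x
    using inj_u that unfolding W_def by blast
  \<comment> \<open>The operators \<open>V n\<close> pull back along \<open>u n\<close>, the
    operators \<open>U n\<close> along its inverse \<open>w n\<close> on the image
    \<open>W n\<close>. Subtracting the value belonging to the largest point of the fiber makes both
    results extend continuously by zero.\<close>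
  have opV: "continuous_on UNIV (diff_comp {..<\<beta>} (u n) {..<\<beta>} (\<lambda>x. u n (up x)) (apply_bcontfun f))"
    for n and f :: "'a \<Rightarrow>\<^sub>C 'k"
    unfolding Union_fiber[symmetric]
  proof (rule continuous_on_diff_comp_fibers[OF _ disjoint_fiber inj_t])
    show "(\<lambda>c. s (r n c)) ` C \<subseteq> C" using s r by auto
    fix c assume c: "c \<in> C"
    show "u n x \<in> fiber (s (r n c)) \<and> u n (up x) \<in> fiber (s (r n c))" if "x \<in> fiber c" for x
      using u_fib[OF c that] u_fib[OF c mem_fiber_up(2)[OF c]] fiberD(2)[OF that] by simp
    show "(\<forall>x\<in>fiber c. u n x = u n (up x)) \<or> (clopen (fiber c) \<and>
        (\<exists>g k. continuous_on UNIV g \<and> (\<forall>x\<in>fiber c. apply_bcontfun f (u n x) = g x \<and> u n (up x) = k)))"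
      using fiber_cases'[OF c]
    proof
      assume *: "clopen (fiber c)"
      interpret normal_map "r n c" \<beta> \<beta> "\<lambda>_ y. LEAST z. y < z" "\<phi> (r n c)"
        by (rule \<phi>[OF r(1)[OF c]])
      have "continuous_on UNIV (\<lambda>x. if x \<in> {..\<beta>} then apply_bcontfun f (\<phi> (r n c) x) else 0)"
        by (intro continuous_comp_h continuous_on_apply_bcontfun)
      moreover have "\<forall>x\<in>fiber c. apply_bcontfun f (u n x) =
          (if x \<in> {..\<beta>} then apply_bcontfun f (\<phi> (r n c) x) else 0) \<and> u n (up x) = u n c"
        using fiberD(1,2) less_imp_le by (simp add: u_def) blast
      ultimately show ?thesis using * by blast
    qed (use up_eq c in auto)
  qed (auto intro: continuous_on_apply_bcontfun)
  have W_eq: "W n = (\<Union>c\<in>C. u n ` fiber c)" for n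
    unfolding W_def Union_fiber[symmetric] by blast
  have opU: "continuous_on UNIV (diff_comp (W n) (w n) (W n) (\<lambda>x. up (w n x)) (apply_bcontfun f))"
    for n and f :: "'a \<Rightarrow>\<^sub>C 'k"
    unfolding W_eq
  proof (rule continuous_on_diff_comp_fibers[where t = id])
    show "disjoint_family_on (\<lambda>c. u n ` fiber c) C"
      unfolding disjoint_family_on_def
    proof (intro ballI impI equals0I)
      fix c d y assume "c \<noteq> d" "y \<in> u n ` fiber c \<inter> u n ` fiber d"
      then obtain x x' where x: "x \<in> fiber c" "x' \<in> fiber d" "u n x = u n x'" by auto
      then have "x = x'" using inj_u[OF x(3)] fiberD(1) by blast
      with x \<open>c \<noteq> d\<close> show False using fiberD(2) by blast
    qed
    fix c assume c: "c \<in> C"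
    have wx: "w n x \<in> fiber c" "u n (w n x) = x" if "x \<in> u n ` fiber c" for x
      using that w[OF fiberD(1)] by auto
    then show "w n x \<in> fiber (id c) \<and> up (w n x) \<in> fiber (id c)" if "x \<in> u n ` fiber c" for x
      using that fiberD(2)[OF wx(1)[OF that]] mem_fiber_up(2)[OF c] by simp
    let ?d = "r n c"
    interpret normal_map ?d \<beta> \<beta> "\<lambda>_ y. LEAST z. y < z" "\<phi> ?d"
      by (rule \<phi>[OF r(1)[OF c]])
    have u_eq: "u n x = \<phi> ?d x" if "x \<in> fiber c" for x
      using fiberD(2)[OF that] by (simp add: u_def)
    have cb: "c < \<beta>" by (rule below[OF c])
    have h_le_iff: "\<phi> ?d x \<le> \<phi> ?d y \<longleftrightarrow> x \<le> y" if "x \<le> \<beta>" "y \<le> \<beta>" for x y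
      using h_less_iff[OF that(2,1)] by (simp add: not_less[symmetric])
    have surj: "\<exists>x\<le>\<beta>. \<phi> ?d x = y" if "?d < y" "y \<le> \<beta>" for y
      using enum_above_lower_inv[OF that] lower_inv_le[OF that(2)] unfolding \<phi>_def by blast
    \<comment> \<open>Since the values of \<open>\<phi> ?d\<close> fill
      \<open>{?d<..\<beta>}\<close>, an interval fiber is carried onto an interval that is again
      clopen.\<close>
    have clopen_image: "clopen (u n ` fiber c)" if ne: "fiber c \<noteq> {c}"
    proof -
      consider a where "fiber c = {a<..c}" | "fiber c = {..c}"
        using fiber_cases[OF c] ne by metis
      then show ?thesis
      proof cases
        case 1
        then have ac: "a < c" using mem_fiber_up(2)[OF c] by simp
        have "a \<le> \<beta>" "c \<le> \<beta>" using ac cb by simp_all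
        have "u n ` fiber c = {\<phi> ?d a<..\<phi> ?d c}"
        proof (intro equalityI subsetI)
          fix y assume "y \<in> u n ` fiber c"
          then obtain x where x: "x \<in> fiber c" "y = u n x" by blast
          then have "a < x" "x \<le> c" using 1 by simp_all
          then show "y \<in> {\<phi> ?d a<..\<phi> ?d c}"
            using h_mono[of a x] h_mono_le[of x c] \<open>c \<le> \<beta>\<close> x by (simp add: u_eq)
        next
          fix y assume y: "y \<in> {\<phi> ?d a<..\<phi> ?d c}"
          then have y': "\<phi> ?d a < y" "y \<le> \<phi> ?d c" by simp_all
          have "?d < y" "y \<le> \<beta>"
            by (rule less_trans[OF h_gt[OF \<open>a \<le> \<beta>\<close>] y'(1)])
              (rule order.trans[OF y'(2) h_le[OF \<open>c \<le> \<beta>\<close>]])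
          then obtain x where x: "x \<le> \<beta>" "\<phi> ?d x = y" using surj by blast
          with y have "\<not> \<phi> ?d x \<le> \<phi> ?d a" "\<phi> ?d x \<le> \<phi> ?d c" by (simp_all add: not_le)
          then have "x \<in> fiber c"
            using 1 h_le_iff[OF x(1) \<open>a \<le> \<beta>\<close>] h_le_iff[OF x(1) \<open>c \<le> \<beta>\<close>] by (simp add: not_le)
          then show "y \<in> u n ` fiber c" using x(2) u_eq by (metis image_eqI)
        qed
        then show ?thesis by simp
      next
        case 2
        have "c \<le> \<beta>" using cb by simp
        have "u n ` fiber c = {?d<..\<phi> ?d c}"
        proof (intro equalityI subsetI)
          fix y assume "y \<in> u n ` fiber c"
          then obtain x where x: "x \<in> fiber c" "y = u n x" by blast
          then have "x \<le> c" "x \<le> \<beta>" using 2 fiberD(1)[OF x(1)] by simp_all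
          then show "y \<in> {?d<..\<phi> ?d c}"
            using h_gt[of x] h_mono_le[of x c] \<open>c \<le> \<beta>\<close> x by (simp add: u_eq)
        next
          fix y assume y: "y \<in> {?d<..\<phi> ?d c}"
          then have y': "?d < y" "y \<le> \<phi> ?d c" by simp_all
          then have "?d < y" "y \<le> \<beta>"
            using order.trans[OF y'(2) h_le[OF \<open>c \<le> \<beta>\<close>]] by simp_all
          then obtain x where x: "x \<le> \<beta>" "\<phi> ?d x = y" using surj by blast
          with y have "\<phi> ?d x \<le> \<phi> ?d c" by simp
          then have "x \<in> fiber c"
            using 2 h_le_iff[OF x(1) \<open>c \<le> \<beta>\<close>] by simp
          then show "y \<in> u n ` fiber c" using x(2) u_eq by (metis image_eqI)
        qed
        then show ?thesis by simp
      qed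
    qed
    show "(\<forall>x\<in>u n ` fiber c. w n x = up (w n x)) \<or> (clopen (u n ` fiber c) \<and>
        (\<exists>g k. continuous_on UNIV g \<and> (\<forall>x\<in>u n ` fiber c. apply_bcontfun f (w n x) = g x \<and> up (w n x) = k)))"
    proof (cases "fiber c = {c}")
      case True
      then have "w n x = c" if "x \<in> u n ` fiber c" for x using wx(1)[OF that] by simp
      moreover have "up c = c" using c by (simp add: up_eq)
      ultimately show ?thesis by (intro disjI1 ballI) metis
    next
      case False
      have "continuous_on UNIV (\<lambda>x. if x \<in> {..\<beta>} then apply_bcontfun f (lower_inv (\<phi> ?d) x) else 0)"
        by (intro continuous_comp_lower_inv continuous_on_apply_bcontfun)
      moreover have "\<forall>x\<in>u n ` fiber c. apply_bcontfun f (w n x) =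
          (if x \<in> {..\<beta>} then apply_bcontfun f (lower_inv (\<phi> ?d) x) else 0) \<and> up (w n x) = c"
      proof
        fix y assume "y \<in> u n ` fiber c"
        then obtain x where x: "x \<in> fiber c" "y = u n x" by blast
        then have "x < \<beta>" "up x = c" "w n y = x" "lower_inv (\<phi> ?d) y = x" "y \<le> \<beta>"
          using fiberD(1,2)[OF x(1)] w[OF fiberD(1)[OF x(1)], of n] u_eq[OF x(1)] lower_inv_h[of x] h_le[of x]
          by simp_all
        then show "apply_bcontfun f (w n y) =
            (if y \<in> {..\<beta>} then apply_bcontfun f (lower_inv (\<phi> ?d) y) else 0) \<and> up (w n y) = c"
          by simp
      qed
      ultimately show ?thesis using clopen_image[OF False] by blast
    qed
  qed (auto intro: continuous_on_apply_bcontfun)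
  note U = diff_comp_op_apply[OF opU] diff_comp_op_mem[OF opU]
  note V = diff_comp_op_apply[OF opV] diff_comp_op_mem[OF opV]
  show ?thesis
  proof (rule infinite_multiple[of _ "\<lambda>n. diff_comp_op (W n) (w n) (W n) (\<lambda>x. up (w n x))"
        "\<lambda>n. diff_comp_op {..<\<beta>} (u n) {..<\<beta>} (\<lambda>x. u n (up x))"])
    have up_less: "up x < \<beta>" if "x < \<beta>" for x using below[OF up_in[OF that]] .
    show "fluctuation_op o\<^sub>L fluctuation_op = (fluctuation_op :: ('a \<Rightarrow>\<^sub>C 'k) \<Rightarrow>\<^sub>L _)"
      by (rule ops_eqI) (auto simp: up_less up_eq up_in)
    show "diff_comp_op {..<\<beta>} (u m) {..<\<beta>} (\<lambda>x. u m (up x)) o\<^sub>L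
        diff_comp_op (W n) (w n) (W n) (\<lambda>x. up (w n x)) =
        (if m = n then fluctuation_op else (0 :: ('a \<Rightarrow>\<^sub>C 'k) \<Rightarrow>\<^sub>L _))" for m n
      by (rule ops_eqI) (auto simp: U V W w up_less up_eq up_in)
  qed (auto intro: U V)
qed

subsection \<open>Regularity\<close>

text \<open>
  If \<open>g\<close> were unbounded, \<open>\<beta>\<close> would be the top of the range of a normal map on \<open>{..\<delta>}\<close> with
  \<open>\<delta> < \<beta>\<close>, and restriction to this range factors through \<open>initial_op \<delta>\<close>.
\<close>

lemma regular:
  assumes \<gamma>: "\<gamma> < \<beta>" and g: "\<And>j. j < \<gamma> \<Longrightarrow> g j < \<beta>"
  shows "\<exists>b<\<beta>. \<forall>j<\<gamma>. g j \<le> b"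
proof (rule ccontr)
  assume "\<not> ?thesis"
  then have unbdd: "\<exists>j<\<gamma>. b < g j" if "b < \<beta>" for b using that by (meson not_le)
  \<comment> \<open>Three demands are built into \<open>G\<close>: strict growth, the sparseness
    required by \<open>fluctuation_mem\<close>, and domination of \<open>g j\<close> at stage
    \<open>j\<close>. From stage \<gamma> on, the value \<open>y\<close> is neutral in the
    maximum.\<close>
  define G where "G j y = max (max (LEAST z. y < z) (enum_above y y)) (if j < \<gamma> then g j else y)" for j y
  have G: "y < G j y \<and> G j y < \<beta>" if y: "y < \<beta>" for j y
  proof -
    interpret normal_map y \<beta> \<beta> "\<lambda>_ y. LEAST z. y < z" "enum_above y"
      by (rule enum_above[OF y])
    show ?thesis
      unfolding G_def using less_Suc[OF y] Suc_less[OF y] h_less[OF y] g[of j] y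
      by (auto simp: less_max_iff_disj)
  qed
  note G1 = G[THEN conjunct1] and G2 = G[THEN conjunct2]
  have G_ge: "enum_above y y \<le> G j y" "j < \<gamma> \<Longrightarrow> g j \<le> G j y" for j y
    by (auto simp: G_def le_max_iff_disj)
  obtain b where b: "b < \<beta>" using limit by (auto simp: limit_point_def)
  obtain \<delta> where "\<delta> \<le> \<beta>" and nm: "normal_map b \<delta> \<beta> G (normal_rec G b)"
    by (rule ex_normal_map[OF b G])
  define h where "h = normal_rec G b"
  have nm: "normal_map b \<delta> \<beta> G h" using nm by (simp add: h_def)
  interpret normal_map b \<delta> \<beta> G h by (rule nm)
  \<comment> \<open>If stage \<gamma> still had a value below \<beta>, that value would bound every
    \<open>g j\<close>.\<close>
  have "\<delta> \<le> \<gamma>"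
  proof (rule ccontr)
    assume "\<not> \<delta> \<le> \<gamma>"
    then have lt: "\<gamma> < \<delta>" by simp
    obtain j where j: "j < \<gamma>" "h \<gamma> < g j" using unbdd[OF h_less[OF lt]] by blast
    have "G j (h j) \<le> h \<gamma>" by (rule h_G[OF j(1) less_imp_le[OF lt]])
    then show False using G_ge(2)[OF j(1), of "h j"] j(2) by simp
  qed
  then have "\<delta> < \<beta>" using \<gamma> by simp
  define C where "C = h ` {..<\<delta>}"
  have C_iff: "c \<in> C \<or> c = \<beta> \<longleftrightarrow> (\<exists>i\<le>\<delta>. c = h i)" for c
    unfolding C_def using h_top by (auto simp: order.order_iff_strict)
  have next_lt: "\<exists>j'<\<delta>. j < j'" if j: "j < \<delta>" for j
  proof (rule ccontr)
    assume "\<not> ?thesis"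
    then have le: "i \<le> j" if "i < \<delta>" for i using that by (meson not_le)
    have "h \<delta> \<le> G j (h j)"
    proof (rule h_least[OF order_refl])
      show "b < G j (h j)"
        by (rule less_trans[OF h_gt[OF less_imp_le[OF j]] G1[OF h_less[OF j]]])
      show "G i (h i) \<le> G j (h j)" if "i < \<delta>" for i
      proof (cases "i = j")
        case False
        then have "i < j" using le[OF that] by simp
        then have "G i (h i) \<le> h j" using h_G less_imp_le[OF j] by blast
        then show ?thesis using G1[OF h_less[OF j], of j] by simp
      qed simp
    qed
    then show False using G2[OF h_less[OF j], of j] h_top by simp
  qed
  have cof: "\<exists>j<\<delta>. y < h j" if "y < \<beta>" for y
  proof -
    have "\<exists>j<\<delta>. y < G j (h j)"
    proof (rule ccontr)
      assume "\<not> ?thesis"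
      then have "G j (h j) \<le> y" if "j < \<delta>" for j using that by (meson not_le)
      \<comment> \<open>\<open>G \<delta> b\<close> serves as a point strictly between
        \<open>b\<close> and \<beta>, as \<open>h_least\<close> asks for.\<close>
      then have "h \<delta> \<le> max (G \<delta> b) y"
        using G1[OF b, of \<delta>] by (intro h_least) (simp_all add: le_max_iff_disj less_max_iff_disj)
      moreover have "max (G \<delta> b) y < \<beta>" using that G2[OF b, of \<delta>] by simp
      ultimately show False using h_top by (metis leD)
    qed
    then obtain j where j: "j < \<delta>" "y < G j (h j)" by blast
    then obtain j' where j': "j < j'" "j' < \<delta>" using next_lt by blast
    have "y < h j'" using h_G[OF j'(1) less_imp_le[OF j'(2)]] j(2) by simp
    then show ?thesis using j'(2) by blast
  qed
  have club: "club \<beta> C"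
  proof
    fix c assume "c \<in> C"
    then show "c < \<beta>" using h_less by (auto simp: C_def)
  next
    fix y assume "y < \<beta>"
    then show "\<exists>c\<in>C. y < c" using cof[of y] by (auto simp: C_def)
  next
    fix z v assume z: "z < \<beta>" "v < z" and lim: "\<And>w. w < z \<Longrightarrow> \<exists>c\<in>C. w < c \<and> c < z"
    let ?i = "lower_inv h z"
    obtain i where i: "i < \<delta>" "z < h i" using cof[OF z(1)] by blast
    then have "?i \<le> i" by (intro lower_inv_leI) simp
    then have "?i < \<delta>" using i(1) by simp
    have "h ?i \<le> z"
    proof (rule h_least)
      show "?i \<le> \<delta>" using \<open>?i < \<delta>\<close> by simp
      obtain j where "j < \<delta>" "h j < z" using lim[OF z(2)] by (auto simp: C_def)
      then show "b < z" using h_gt[OF less_imp_le[of j \<delta>]] by simp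
      fix j assume j: "j < ?i"
      then have "h j < z" by (rule h_less_of_less_lower_inv)
      then obtain j' where j': "j' < \<delta>" "h j < h j'" "h j' < z" using lim by (auto simp: C_def)
      have "j < \<delta>" using j \<open>?i < \<delta>\<close> by simp
      then have "j < j'" using h_less_iff[OF less_imp_le less_imp_le, of j j'] j' by simp
      then have "G j (h j) \<le> h j'" using h_G less_imp_le[OF j'(1)] by blast
      then show "G j (h j) \<le> z" using j'(3) by simp
    qed
    moreover have "z \<le> h ?i" by (rule le_h_lower_inv) (use z in simp)
    ultimately have "z = h ?i" by (rule antisym[rotated])
    then show "z \<in> C" using \<open>?i < \<delta>\<close> unfolding C_def by blast
  qed
  interpret club \<beta> C by (rule club)
  have Q: "fluctuation_op \<in> I"
  proof (rule fluctuation_mem[OF club])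
    fix c d assume "c \<in> C" "d \<in> C" "c < d"
    then obtain i j where ij: "i < \<delta>" "j < \<delta>" "c = h i" "d = h j" by (auto simp: C_def)
    then have "i < j" using h_less_iff[OF less_imp_le less_imp_le, of i j] \<open>c < d\<close> by simp
    then have "G i c \<le> d" using h_G[OF _ less_imp_le, of i j] ij by simp
    then show "enum_above c c \<le> d" using G_ge(1)[of c i] by simp
  qed
  \<comment> \<open>Rounding up to \<open>C\<close> agrees with rounding up to the range of
    \<open>h\<close>, so the complementary projection factors through the functions on
    \<open>{..\<delta>}\<close>.\<close>
  have up_eq_h: "up x = h (lower_inv h x)" if xb: "x \<le> \<beta>" for x
  proof (rule antisym)
    show "up x \<le> h (lower_inv h x)"
      using lower_inv_le[OF xb] le_h_lower_inv[OF xb] C_iff by (intro up_least) blast+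
    obtain i where i: "i \<le> \<delta>" "up x = h i" using up_mem[OF xb] C_iff by blast
    then have "lower_inv h x \<le> i" using le_up[OF xb] by (intro lower_inv_leI) simp
    then show "h (lower_inv h x) \<le> up x" using h_mono_le i by simp
  qed
  have "initial_op \<beta> - fluctuation_op \<in> I"
  proof (rule normal_map_lower_inv_op[OF nm \<open>\<delta> < \<beta>\<close>])
    show "initial_op \<beta> - (fluctuation_op :: ('a \<Rightarrow>\<^sub>C 'k) \<Rightarrow>\<^sub>L _) \<in> bounded_ops"
      by (intro bounded_ops_diff) auto
    fix f :: "'a \<Rightarrow>\<^sub>C 'k" and x
    have "up \<beta> = \<beta>" by (simp add: up_eq)
    then show "apply_bcontfun (blinfun_apply (initial_op \<beta> - fluctuation_op) f) x =
        (if x \<le> \<beta> then apply_bcontfun f (h (lower_inv h x)) else 0)"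
      using up_eq_h[of x] by (auto simp: blinfun.diff_left le_less)
  qed
  from add[OF this Q] show False using initial_op_notin by simp
qed

text \<open>\<beta> has uncountable cofinality: some \<open>\<gamma> < \<beta>\<close> has
  infinitely many predecessors, so a sequence can be indexed by ordinals below \<gamma>, and
  regularity bounds it.\<close>

lemma sequence_bounded:
  assumes y: "\<And>n::nat. y n < \<beta>"
  shows "\<exists>b<\<beta>. \<forall>n. y n \<le> b"
proof -
  obtain \<gamma> where \<gamma>: "\<gamma> < \<beta>" "infinite {..<\<gamma>}" using infinite_below by blast
  then obtain \<iota> :: "nat \<Rightarrow> 'a" where \<iota>: "inj \<iota>" "range \<iota> \<subseteq> {..<\<gamma>}"
    using infinite_countable_subset by blast
  obtain b where b: "b < \<beta>" "\<And>j. j < \<gamma> \<Longrightarrow> y (inv \<iota> j) \<le> b"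
    using regular[OF \<gamma>(1), of "\<lambda>j. y (inv \<iota> j)"] y by blast
  have "y n \<le> b" for n
    using b(2)[of "\<iota> n"] \<iota> by auto
  then show ?thesis using b(1) by blast
qed

lemma increasing_sequence_sup:
  assumes s: "\<And>n::nat. s n < \<beta>" and s_less: "\<And>n. s n < s (Suc n)"
  obtains z where "z < \<beta>" "\<And>n. s n < z" "\<And>w. w < z \<Longrightarrow> \<exists>n. w < s n"
proof -
  define z where "z = (LEAST b. \<forall>n. s n \<le> b)"
  obtain b where b: "b < \<beta>" "\<forall>n. s n \<le> b" using sequence_bounded[of s, OF s] by blast
  have z: "\<And>n. s n \<le> z" unfolding z_def using LeastI[of "\<lambda>b. \<forall>n. s n \<le> b", OF b(2)] by blast
  have "z \<le> b" unfolding z_def by (rule Least_le[of "\<lambda>b. \<forall>n. s n \<le> b", OF b(2)])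
  show ?thesis
  proof (rule that)
    show "z < \<beta>" using \<open>z \<le> b\<close> b(1) by simp
    show "s n < z" for n using s_less[of n] z[of "Suc n"] by simp
    show "\<exists>n. w < s n" if w: "w < z" for w
      using not_less_Least[OF w[unfolded z_def]] by (meson not_le)
  qed
qed

text \<open>The closing-off argument: the points closed under a function form a club, cofinal
  because the supremum of countably many iterations stays below \<beta>. Merging
  \<open>enum_above\<close> into the function makes the club sparse enough for
  \<open>fluctuation_mem\<close>.\<close>

lemma ex_club_closed_under:
  assumes g: "\<And>\<eta>. \<eta> < \<beta> \<Longrightarrow> g \<eta> < \<beta>"
  obtains C where "club \<beta> C" "\<And>\<xi>. \<xi> \<in> C \<Longrightarrow> \<exists>v. v < \<xi>" "\<And>\<xi> \<eta>. \<xi> \<in> C \<Longrightarrow> \<eta> < \<xi> \<Longrightarrow> g \<eta> < \<xi>"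
    "club.fluctuation_op \<beta> C \<in> I"
proof -
  define G where "G y = max (max (LEAST z. y < z) (enum_above y y)) (g y)" for y
  have G: "y < G y" "G y < \<beta>" if y: "y < \<beta>" for y
  proof -
    interpret normal_map y \<beta> \<beta> "\<lambda>_ y. LEAST z. y < z" "enum_above y"
      by (rule enum_above[OF y])
    show "y < G y" "G y < \<beta>"
      unfolding G_def using less_Suc[OF y] Suc_less[OF y] h_less[OF y] g[of y] y
      by (auto simp: less_max_iff_disj)
  qed
  define C where "C = {\<xi>. \<xi> < \<beta> \<and> (\<exists>v. v < \<xi>) \<and> (\<forall>\<eta><\<xi>. G \<eta> < \<xi>)}"
  have sup: "\<exists>b<\<beta>. \<forall>\<eta>\<le>y. G \<eta> \<le> b" if y: "y < \<beta>" for y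
  proof -
    obtain b where b: "b < \<beta>" "\<And>\<eta>. \<eta> < (LEAST z. y < z) \<Longrightarrow> G \<eta> \<le> b"
      using regular[OF Suc_less[OF y], of G] G(2) Suc_less[OF y] by (meson less_trans)
    then show ?thesis using less_Suc[OF y] by (meson le_less_trans)
  qed
  then obtain H where H: "\<And>y. y < \<beta> \<Longrightarrow> H y < \<beta>" "\<And>y \<eta>. y < \<beta> \<Longrightarrow> \<eta> \<le> y \<Longrightarrow> G \<eta> \<le> H y"
    by metis
  have club: "club \<beta> C"
  proof
    show "c < \<beta>" if "c \<in> C" for c using that by (simp add: C_def)
    fix y assume y: "y < \<beta>"
    define s where "s n = (H ^^ n) y" for n
    have s: "s n < \<beta>" for n by (induction n) (auto simp: s_def y H)
    have s_Suc: "G \<eta> \<le> s (Suc n)" if "\<eta> \<le> s n" for \<eta> n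
      using H(2)[OF s that] by (simp add: s_def)
    have s_less: "s n < s (Suc n)" for n
      using G(1)[OF s, of n] s_Suc[OF order_refl, of n] by simp
    obtain z where z: "z < \<beta>" "\<And>n. s n < z" "\<And>w. w < z \<Longrightarrow> \<exists>n. w < s n"
      using increasing_sequence_sup[of s, OF s s_less] by blast
    have "G \<eta> < z" if \<eta>: "\<eta> < z" for \<eta>
    proof -
      obtain n where "\<eta> < s n" using z(3)[OF \<eta>] by blast
      then have "G \<eta> \<le> s (Suc n)" by (intro s_Suc) simp
      then show ?thesis using z(2)[of "Suc n"] by simp
    qed
    then have "z \<in> C" using z by (auto simp: C_def)
    then show "\<exists>c\<in>C. y < c" using z(2)[of 0] by (auto simp: s_def)
  next
    fix z v assume z: "z < \<beta>" "v < z" and lim: "\<And>w. w < z \<Longrightarrow> \<exists>c\<in>C. w < c \<and> c < z"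
    have "G \<eta> < z" if \<eta>: "\<eta> < z" for \<eta>
    proof -
      obtain c where c: "c \<in> C" "\<eta> < c" "c < z" using lim[OF \<eta>] by blast
      then have "G \<eta> < c" by (simp add: C_def)
      then show ?thesis using c(3) by simp
    qed
    then show "z \<in> C" using z by (auto simp: C_def)
  qed
  show ?thesis
  proof (rule that[OF club])
    show "club.fluctuation_op \<beta> C \<in> I"
    proof (rule fluctuation_mem[OF club])
      fix c d assume "c \<in> C" "d \<in> C" "c < d"
      then have "G c < d" by (simp add: C_def)
      then show "enum_above c c \<le> d" by (auto simp: G_def)
    qed
    show "\<exists>v. v < \<xi>" if "\<xi> \<in> C" for \<xi> using that by (simp add: C_def)
    show "g \<eta> < \<xi>" if "\<xi> \<in> C" "\<eta> < \<xi>" for \<xi> \<eta>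
    proof -
      from that have "G \<eta> < \<xi>" by (simp add: C_def)
      then show ?thesis by (simp add: G_def)
    qed
  qed
qed

end

subsection \<open>Approximation by indicators of initial segments\<close>

definition initial_ind :: "'a::{wellorder,linorder_topology} \<Rightarrow> ('a \<Rightarrow>\<^sub>C 'k::real_normed_field)"
  where "initial_ind \<eta> = blinfun_apply (initial_op \<eta>) (const_bcontfun 1)"

lemma initial_ind_apply [simp]: "apply_bcontfun (initial_ind \<eta>) x = (if x \<le> \<eta> then 1 else 0)"
  by (simp add: initial_ind_def const_bcontfun.rep_eq)

lemma bounded_ops_scaleK_apply:
  "T \<in> bounded_ops \<Longrightarrow> blinfun_apply T (scaleK_bcontfun c f) = scaleK_bcontfun c (blinfun_apply T f)"
  by (simp add: bounded_ops_def)

lemma norm_apply_op_le: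
  "norm (apply_bcontfun (blinfun_apply T f) x) \<le> norm T * norm (f :: 'a::topological_space \<Rightarrow>\<^sub>C 'k::real_normed_field)"
  using norm_bounded[of "blinfun_apply T f" x] norm_blinfun[of T f] by linarith

lemma eq_zero_of_norm_le_mult:
  fixes a :: "'b::real_normed_vector"
  assumes "\<And>e. 0 < e \<Longrightarrow> norm a \<le> M * e"
  shows "a = 0"
proof (rule ccontr)
  assume "a \<noteq> 0"
  then have "0 < norm a / (2 * (\<bar>M\<bar> + 1))" by simp
  then have "norm a \<le> M * (norm a / (2 * (\<bar>M\<bar> + 1)))" by (rule assms)
  also have "\<dots> \<le> (\<bar>M\<bar> + 1) * (norm a / (2 * (\<bar>M\<bar> + 1)))"
    by (intro mult_right_mono) auto
  also have "\<dots> = norm a / 2" by (simp add: field_simps add_nonneg_eq_0_iff)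
  finally show False using \<open>a \<noteq> 0\<close> by simp
qed

text \<open>Transfinite induction: just below \<eta> the function is almost constant, so on
  \<open>{..\<eta>}\<close> it is close to its restriction to some \<open>{..w}\<close> plus a
  multiple of the difference of two indicators.\<close>

lemma op_initial_eq_zero:
  fixes T :: "('a::{wellorder,linorder_topology} \<Rightarrow>\<^sub>C 'k::real_normed_field) \<Rightarrow>\<^sub>L ('a \<Rightarrow>\<^sub>C 'k)"
  assumes T: "T \<in> bounded_ops"
    and ind: "\<And>\<eta>'. \<eta>' \<le> \<eta> \<Longrightarrow> apply_bcontfun (blinfun_apply T (initial_ind \<eta>')) x = 0"
  shows "apply_bcontfun (blinfun_apply T (blinfun_apply (initial_op \<eta>) f)) x = 0"
  using ind
proof (induction \<eta> rule: less_induct)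
  case (less \<eta>)
  show ?case
  proof (cases "\<exists>v. v < \<eta>")
    case False
    then have "initial_op \<eta> f = scaleK_bcontfun (apply_bcontfun f \<eta>) (initial_ind \<eta>)"
      by (intro bcontfun_eqI) (auto simp: not_less intro: arg_cong[of _ _ "apply_bcontfun f"] antisym)
    then show ?thesis
      using less.prems by (simp add: bounded_ops_scaleK_apply[OF T])
  next
    case True
    show ?thesis
    proof (rule eq_zero_of_norm_le_mult)
      fix e :: real assume e: "0 < e"
      obtain w where w: "w < \<eta>" "\<And>y. w < y \<Longrightarrow> y \<le> \<eta> \<Longrightarrow> dist (apply_bcontfun f y) (apply_bcontfun f \<eta>) < e"
        using wellorder_continuousD[OF continuous_on_apply_bcontfun e] True by metis
      define q where "q = scaleK_bcontfun (apply_bcontfun f \<eta>) (initial_ind \<eta> - initial_ind w)"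
      define r where "r = blinfun_apply (initial_op \<eta>) f - blinfun_apply (initial_op w) f - q"
      have "apply_bcontfun (blinfun_apply T (blinfun_apply (initial_op w) f)) x = 0"
        using w(1) less.prems by (intro less.IH) auto
      moreover have "apply_bcontfun (blinfun_apply T q) x = 0"
        using less.prems[of \<eta>] less.prems[of w] w(1)
        by (simp add: q_def bounded_ops_scaleK_apply[OF T] blinfun.diff_right)
      ultimately have "apply_bcontfun (blinfun_apply T (blinfun_apply (initial_op \<eta>) f)) x =
          apply_bcontfun (blinfun_apply T r) x"
        by (simp add: r_def blinfun.diff_right)
      moreover have "norm r \<le> e"
      proof (rule norm_bound)
        fix y
        have "w < y \<or> y \<le> w" "y \<le> w \<Longrightarrow> y \<le> \<eta>" using w(1) by auto
        then show "norm (apply_bcontfun r y) \<le> e"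
          using w e by (auto simp: r_def q_def dist_norm less_imp_le)
      qed
      then have "norm T * norm r \<le> norm T * e" by (intro mult_left_mono) auto
      ultimately show "norm (apply_bcontfun (blinfun_apply T (blinfun_apply (initial_op \<eta>) f)) x) \<le> norm T * e"
        using norm_apply_op_le[of T r x] by simp
    qed
  qed
qed

text \<open>As \<open>f\<close> vanishes from \<xi> on, continuity makes it small on some
  \<open>{w<..\<xi>}\<close>, so its restriction to \<open>{..w}\<close> approximates it in
  norm.\<close>

lemma op_eq_zero_below:
  fixes T :: "('a::{wellorder,linorder_topology} \<Rightarrow>\<^sub>C 'k::real_normed_field) \<Rightarrow>\<^sub>L ('a \<Rightarrow>\<^sub>C 'k)"
  assumes T: "T \<in> bounded_ops" and v: "v < \<xi>"
    and ind: "\<And>\<eta>. \<eta> < \<xi> \<Longrightarrow> apply_bcontfun (blinfun_apply T (initial_ind \<eta>)) x = 0"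
    and f: "\<And>y. \<xi> \<le> y \<Longrightarrow> apply_bcontfun f y = 0"
  shows "apply_bcontfun (blinfun_apply T f) x = 0"
proof (rule eq_zero_of_norm_le_mult)
  fix e :: real assume e: "0 < e"
  obtain w where w: "w < \<xi>" "\<And>y. w < y \<Longrightarrow> y \<le> \<xi> \<Longrightarrow> dist (apply_bcontfun f y) (apply_bcontfun f \<xi>) < e"
    using wellorder_continuousD[OF continuous_on_apply_bcontfun e v] by metis
  define r where "r = f - blinfun_apply (initial_op w) f"
  have "apply_bcontfun (blinfun_apply T (blinfun_apply (initial_op w) f)) x = 0"
    using w(1) by (intro op_initial_eq_zero[OF T] ind) auto
  then have "apply_bcontfun (blinfun_apply T f) x = apply_bcontfun (blinfun_apply T r) x"
    by (simp add: r_def blinfun.diff_right)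
  moreover have "norm r \<le> e"
  proof (rule norm_bound)
    fix y
    show "norm (apply_bcontfun r y) \<le> e"
    proof (cases "w < y \<and> y \<le> \<xi>")
      case True
      then have "norm (apply_bcontfun f y) < e" using w(2)[of y] f[of \<xi>] by simp
      then show ?thesis using True by (auto simp: r_def not_le[symmetric])
    next
      case False
      then have "y \<le> w \<or> apply_bcontfun f y = 0" using f[of y] by (metis less_imp_le not_le)
      then show ?thesis using e by (auto simp: r_def)
    qed
  qed
  then have "norm T * norm r \<le> norm T * e" by (intro mult_left_mono) auto
  ultimately show "norm (apply_bcontfun (blinfun_apply T f) x) \<le> norm T * e"
    using norm_apply_op_le[of T r x] by simp
qed

section \<open>Tails of functions and of rows of operators\<close>

context critical_ideal
begin

text \<open>As on the first uncountable ordinal: pairs whose values are \<open>e\<close> apart,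
  chosen ever higher, would accumulate at some \<open>z < \<beta>\<close> and contradict continuity
  there. Continuity is expressed by extensions \<open>F\<close> because \<open>s\<close> matters on
  \<open>D\<close> only.\<close>

lemma eventually_constant:
  fixes s :: "'a \<Rightarrow> 'c::metric_space"
  assumes ext: "\<And>y. y < \<beta> \<Longrightarrow> \<exists>F. continuous_on UNIV F \<and> (\<forall>x\<in>D. x \<le> y \<longrightarrow> s x = F x)"
    and D: "D \<subseteq> {..<\<beta>}"
  shows "\<exists>b<\<beta>. \<forall>x\<in>D. \<forall>x'\<in>D. b < x \<longrightarrow> b < x' \<longrightarrow> s x = s x'"
proof -
  obtain b0 where b0: "b0 < \<beta>" using limit by (auto simp: limit_point_def)
  have "\<exists>b<\<beta>. \<forall>x\<in>D. \<forall>x'\<in>D. b < x \<longrightarrow> b < x' \<longrightarrow> dist (s x) (s x') < e" if e: "0 < e" for e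
  proof (rule ccontr)
    assume "\<not> ?thesis"
    then have "\<forall>b. \<exists>x x'. b < \<beta> \<longrightarrow> x \<in> D \<and> x' \<in> D \<and> b < x \<and> b < x' \<and> \<not> dist (s x) (s x') < e"
      by blast
    then obtain X X' where X: "\<And>b. b < \<beta> \<Longrightarrow> X b \<in> D \<and> X' b \<in> D \<and> b < X b \<and> b < X' b \<and>
        \<not> dist (s (X b)) (s (X' b)) < e"
      by metis
    \<comment> \<open>Both points chosen above \<open>t n\<close> lie at or below
      \<open>t (Suc n)\<close>, so both sequences are squeezed towards the supremum of the
      \<open>t n\<close>.\<close>
    define t where "t n = ((\<lambda>b. max (X b) (X' b)) ^^ n) b0" for n
    have t: "t n < \<beta>" for n
      using X D by (induction n) (auto simp: t_def b0)
    have t_Suc: "X (t n) \<le> t (Suc n)" "X' (t n) \<le> t (Suc n)" for n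
      by (auto simp: t_def)
    have t_less: "t n < t (Suc n)" for n
      using t_Suc(1)[of n] X[OF t[of n]] by (meson less_le_trans)
    obtain z where z: "z < \<beta>" "\<And>n. t n < z" "\<And>w. w < z \<Longrightarrow> \<exists>n. w < t n"
      using increasing_sequence_sup[of t, OF t t_less] by blast
    obtain F where F: "continuous_on UNIV F" "\<And>x. x \<in> D \<Longrightarrow> x \<le> z \<Longrightarrow> s x = F x"
      using ext[OF z(1)] by blast
    obtain w where w: "w < z" "\<And>x. w < x \<Longrightarrow> x \<le> z \<Longrightarrow> dist (F x) (F z) < e / 2"
      using wellorder_continuousD[OF F(1) _ z(2), of "e / 2"] e by auto
    obtain n where n: "w < t n" using z(3)[OF w(1)] by blast
    note Xn = X[OF t[of n]]
    have "w < X (t n)" "w < X' (t n)" using n Xn by (meson less_trans)+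
    moreover have "X (t n) \<le> z" "X' (t n) \<le> z"
      using t_Suc[of n] z(2)[of "Suc n"] by (meson less_imp_le order.trans)+
    ultimately have "dist (s (X (t n))) (s (X' (t n))) < e"
      using w(2) F(2) Xn dist_triangle_half_l[of "F (X (t n))" "F z" e "F (X' (t n))"] by simp
    then show False using Xn by blast
  qed
  then obtain b where b: "\<And>e. 0 < e \<Longrightarrow> b e < \<beta> \<and> (\<forall>x\<in>D. \<forall>x'\<in>D. b e < x \<longrightarrow> b e < x' \<longrightarrow> dist (s x) (s x') < e)"
    by metis
  have pos: "0 < 1 / real (Suc n)" for n by simp
  obtain c where c: "c < \<beta>" "\<And>n. b (1 / real (Suc n)) \<le> c"
    using sequence_bounded[of "\<lambda>n. b (1 / real (Suc n))"] b pos by blast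
  have "s x = s x'" if "x \<in> D" "x' \<in> D" "c < x" "c < x'" for x x'
  proof (rule ccontr)
    assume "s x \<noteq> s x'"
    then obtain n where "1 / real (Suc n) < dist (s x) (s x')"
      using nat_approx_posE[of "dist (s x) (s x')"] by auto
    moreover have "dist (s x) (s x') < 1 / real (Suc n)"
      using b[OF pos, of n] that c(2)[of n] by (meson le_less_trans)
    ultimately show False by simp
  qed
  then show ?thesis using c(1) by blast
qed

lemma continuous_eventually_eq_top:
  fixes F :: "'a \<Rightarrow> 'c::metric_space"
  assumes F: "continuous_on UNIV F"
  shows "\<exists>b<\<beta>. \<forall>x. b < x \<longrightarrow> x \<le> \<beta> \<longrightarrow> F x = F \<beta>"
proof -
  obtain b where b: "b < \<beta>" "\<And>x x'. x < \<beta> \<Longrightarrow> x' < \<beta> \<Longrightarrow> b < x \<Longrightarrow> b < x' \<Longrightarrow> F x = F x'"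
    using eventually_constant[of "{..<\<beta>}" F] F by blast
  have "F x = F \<beta>" if x: "b < x" "x < \<beta>" for x
  proof (rule ccontr)
    assume "F x \<noteq> F \<beta>"
    then obtain w where w: "w < \<beta>" "\<And>y. w < y \<Longrightarrow> y \<le> \<beta> \<Longrightarrow> dist (F y) (F \<beta>) < dist (F x) (F \<beta>)"
      using wellorder_continuousD[OF F _ x(2), of "dist (F x) (F \<beta>)"] by auto
    have "max b w < \<beta>" using b(1) w(1) by simp
    then obtain y where "max b w < y" "y < \<beta>" using limit unfolding limit_point_def by blast
    then have y: "b < y" "w < y" "y < \<beta>" by simp_all
    have "F y = F x" by (rule b(2)[OF y(3) x(2) y(1) x(1)])
    then show False using w(2)[OF y(2) less_imp_le[OF y(3)]] by simp
  qed
  then show ?thesis using b(1) by (auto simp: order.order_iff_strict)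
qed

lemma continuous_eventually_zero:
  fixes F :: "'a \<Rightarrow> 'c::real_normed_vector"
  assumes F: "continuous_on UNIV F" and zero: "\<And>x. \<beta> \<le> x \<Longrightarrow> F x = 0"
  shows "\<exists>b<\<beta>. \<forall>x>b. F x = 0"
proof -
  obtain b where b: "b < \<beta>" "\<And>x. b < x \<Longrightarrow> x \<le> \<beta> \<Longrightarrow> F x = F \<beta>"
    using continuous_eventually_eq_top[OF F] by blast
  have "F x = 0" if "b < x" for x
    using b(2)[OF that] zero[of x] zero[of \<beta>] by (cases "x \<le> \<beta>") auto
  then show ?thesis using b(1) by blast
qed

text \<open>Otherwise there would be functions in the unit ball with disjoint supports, ever higher,
  on which the row exceeds a fixed \<open>e\<close>. With suitable scalars their sums stay in the
  unit ball and give unbounded values.\<close>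

lemma row_eventually_zero:
  fixes T :: "('a \<Rightarrow>\<^sub>C 'k) \<Rightarrow>\<^sub>L ('a \<Rightarrow>\<^sub>C 'k)"
  assumes T: "T \<in> bounded_ops"
  shows "\<exists>\<delta><\<beta>. \<forall>f. (\<forall>y. apply_bcontfun f y \<noteq> 0 \<longrightarrow> \<delta> < y \<and> y < \<beta>) \<longrightarrow> apply_bcontfun (blinfun_apply T f) x = 0"
proof -
  define S where "S \<delta> = {f :: 'a \<Rightarrow>\<^sub>C 'k. \<forall>y. apply_bcontfun f y \<noteq> 0 \<longrightarrow> \<delta> < y \<and> y < \<beta>}" for \<delta>
  define \<mu> where "\<mu> f = apply_bcontfun (blinfun_apply T f) x" for f
  have "\<exists>\<delta><\<beta>. \<forall>f\<in>S \<delta>. norm f \<le> 1 \<longrightarrow> norm (\<mu> f) \<le> e" if e: "0 < e" for e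
  proof (rule ccontr)
    assume "\<not> ?thesis"
    then have big: "\<exists>f\<in>S \<delta>. norm f \<le> 1 \<and> e < norm (\<mu> f)" if "\<delta> < \<beta>" for \<delta>
      using that by (meson not_le)
    have "\<exists>f\<in>S \<delta>. norm f \<le> 1 \<and> real N * e \<le> norm (\<mu> f)" if "\<delta> < \<beta>" for N \<delta>
    proof (induction N)
      case 0
      show ?case by (rule bexI[of _ 0]) (auto simp: S_def)
    next
      case (Suc N)
      then obtain f where f: "f \<in> S \<delta>" "norm f \<le> 1" "real N * e \<le> norm (\<mu> f)" by blast
      \<comment> \<open>A function in \<open>S \<delta>\<close> vanishes at \<beta>, hence beyond
        some \<open>b < \<beta>\<close>. This leaves room for a function \<open>g\<close> with
        disjoint support.\<close>
      obtain b where b: "b < \<beta>" "\<And>y. b < y \<Longrightarrow> y \<le> \<beta> \<Longrightarrow> apply_bcontfun f y = apply_bcontfun f \<beta>"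
        using continuous_eventually_eq_top[OF continuous_on_apply_bcontfun[of UNIV f]] by blast
      have "apply_bcontfun f \<beta> = 0" using f(1) unfolding S_def by blast
      then have fz: "apply_bcontfun f y = 0" if "b < y" for y
        using b(2)[OF that] f(1) unfolding S_def by (cases "y \<le> \<beta>") force+
      have "max b \<delta> < \<beta>" using b(1) \<open>\<delta> < \<beta>\<close> by simp
      then obtain g where g: "g \<in> S (max b \<delta>)" "norm g \<le> 1" "e < norm (\<mu> g)" using big by blast
      \<comment> \<open>A scalar of modulus 1 that turns \<open>\<mu> g\<close> into the direction
        of \<open>\<mu> f\<close>, so that the norms add up; for \<open>\<mu> f = 0\<close> the
        value 1 will do.\<close>
      define c where "c = (if \<mu> f = 0 then 1 else of_real (norm (\<mu> g) / norm (\<mu> f)) * \<mu> f / \<mu> g)"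
      have "\<mu> g \<noteq> 0" using g(3) e by auto
      have c: "norm c = 1"
        using \<open>\<mu> g \<noteq> 0\<close> by (simp add: c_def norm_mult norm_divide)
      have "norm (\<mu> f + c * \<mu> g) = norm (\<mu> f) + norm (\<mu> g)"
      proof (cases "\<mu> f = 0")
        case False
        have "\<mu> f + c * \<mu> g = of_real (1 + norm (\<mu> g) / norm (\<mu> f)) * \<mu> f"
          using False \<open>\<mu> g \<noteq> 0\<close> by (simp add: c_def distrib_right)
        also have "norm \<dots> = (1 + norm (\<mu> g) / norm (\<mu> f)) * norm (\<mu> f)"
          by (simp only: norm_mult norm_of_real) (simp add: abs_of_nonneg)
        finally show ?thesis using False by (simp add: distrib_right)
      qed (simp add: c_def)
      moreover have "\<mu> (f + scaleK_bcontfun c g) = \<mu> f + c * \<mu> g"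
        by (simp add: \<mu>_def blinfun.add_right bounded_ops_scaleK_apply[OF T])
      ultimately have "real (Suc N) * e \<le> norm (\<mu> (f + scaleK_bcontfun c g))"
        using f(3) g(3) by (simp add: distrib_right)
      moreover have gz: "apply_bcontfun g y = 0" if "y \<le> b" for y
        using g(1) that unfolding S_def by force
      have "norm (f + scaleK_bcontfun c g) \<le> 1"
      proof (rule norm_bound)
        fix y
        show "norm (apply_bcontfun (f + scaleK_bcontfun c g) y) \<le> 1"
          using fz[of y] gz[of y] f(2) g(2) norm_bounded[of f y] norm_bounded[of g y] c
          by (cases "y \<le> b") (auto simp: norm_mult not_le intro: order.trans)
      qed
      moreover have "f + scaleK_bcontfun c g \<in> S \<delta>"
        unfolding S_def
      proof safe
        fix y assume "apply_bcontfun (f + scaleK_bcontfun c g) y \<noteq> 0"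
        then have "apply_bcontfun f y \<noteq> 0 \<or> apply_bcontfun g y \<noteq> 0" by auto
        then have "\<delta> < y \<and> y < \<beta>"
          using f(1) g(1) unfolding S_def by auto
        then show "\<delta> < y" "y < \<beta>" by auto
      qed
      ultimately show ?case by blast
    qed
    moreover obtain \<delta> where "\<delta> < \<beta>" using limit by (auto simp: limit_point_def)
    ultimately have ex: "\<exists>f. norm f \<le> 1 \<and> real N * e \<le> norm (\<mu> f)" for N
      by blast
    have "real N * e \<le> norm T" for N
    proof -
      obtain f where "norm f \<le> 1" "real N * e \<le> norm (\<mu> f)"
        using ex by blast
      moreover have "norm (\<mu> f) \<le> norm T * norm f" unfolding \<mu>_def by (rule norm_apply_op_le)
      moreover have "norm T * norm f \<le> norm T * 1" using \<open>norm f \<le> 1\<close> by (intro mult_left_mono) auto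
      ultimately show ?thesis by simp
    qed
    then show False
      using reals_Archimedean3[OF e] by (meson not_le)
  qed
  then obtain d where d: "\<And>e. 0 < e \<Longrightarrow> d e < \<beta> \<and> (\<forall>f\<in>S (d e). norm f \<le> 1 \<longrightarrow> norm (\<mu> f) \<le> e)"
    by metis
  have pos: "0 < 1 / real (Suc n)" for n by simp
  obtain \<delta> where \<delta>: "\<delta> < \<beta>" "\<And>n. d (1 / real (Suc n)) \<le> \<delta>"
    using sequence_bounded[of "\<lambda>n. d (1 / real (Suc n))"] d pos by blast
  have "\<mu> f = 0" if f: "f \<in> S \<delta>" for f
  proof (rule ccontr)
    assume nz: "\<mu> f \<noteq> 0"
    then have "f \<noteq> 0" by (auto simp: \<mu>_def)
    define g where "g = (1 / norm f) *\<^sub>R f"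
    have g: "norm g \<le> 1" "\<mu> g = (1 / norm f) *\<^sub>R \<mu> f"
      using \<open>f \<noteq> 0\<close> by (simp_all add: g_def \<mu>_def blinfun.scaleR_right)
    then have "0 < norm (\<mu> g)" using nz \<open>f \<noteq> 0\<close> by simp
    then obtain n where n: "1 / real (Suc n) < norm (\<mu> g)" using nat_approx_posE by blast
    have "g \<in> S (d (1 / real (Suc n)))"
      using f \<delta>(2)[of n] unfolding S_def g_def by (auto intro: le_less_trans)
    then have "norm (\<mu> g) \<le> 1 / real (Suc n)" using d[OF pos, of n] g(1) by blast
    with n show False by simp
  qed
  then show ?thesis using \<delta>(1) unfolding S_def \<mu>_def by blast
qed

subsection \<open>Sequences of operators\<close>

text \<open>Images of indicators vanish far out. Uncountable cofinality makes the bound uniform in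
  \<open>n\<close>, regularity makes it uniform in \<open>\<eta> < \<gamma>\<close>, and indicators
  control all functions that vanish from \<gamma> on.\<close>

lemma range_initial:
  fixes A :: "nat \<Rightarrow> ('a \<Rightarrow>\<^sub>C 'k) \<Rightarrow>\<^sub>L ('a \<Rightarrow>\<^sub>C 'k)"
  assumes A: "\<And>n. A n \<in> bounded_ops" and \<gamma>: "\<gamma> < \<beta>" "v < \<gamma>"
    and zero: "\<And>n f x. \<beta> \<le> x \<Longrightarrow> apply_bcontfun (blinfun_apply (A n) f) x = 0"
    and dom: "\<And>n f. \<exists>g. blinfun_apply (A n) f = blinfun_apply (A n) g \<and> (\<forall>y\<ge>\<gamma>. apply_bcontfun g y = 0)"
  shows "\<exists>\<delta><\<beta>. \<forall>n. initial_op \<delta> o\<^sub>L A n = A n"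
proof -
  have "\<exists>b<\<beta>. \<forall>x>b. apply_bcontfun (blinfun_apply (A n) (initial_ind \<eta>)) x = 0" for n \<eta>
    by (intro continuous_eventually_zero continuous_on_apply_bcontfun zero)
  then obtain b where b: "\<And>n \<eta>. b n \<eta> < \<beta>"
      "\<And>n \<eta> x. b n \<eta> < x \<Longrightarrow> apply_bcontfun (blinfun_apply (A n) (initial_ind \<eta>)) x = 0"
    by metis
  have "\<exists>c<\<beta>. \<forall>n. b n \<eta> \<le> c" for \<eta> using b(1) by (intro sequence_bounded)
  then obtain c where c: "\<And>\<eta>. c \<eta> < \<beta>" "\<And>n \<eta>. b n \<eta> \<le> c \<eta>" by metis
  obtain \<delta> where \<delta>: "\<delta> < \<beta>" "\<And>\<eta>. \<eta> < \<gamma> \<Longrightarrow> c \<eta> \<le> \<delta>"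
    using regular[OF \<gamma>(1), of c] c(1) by blast
  have "apply_bcontfun (blinfun_apply (A n) f) x = 0" if x: "\<delta> < x" for n f x
  proof -
    obtain g where g: "blinfun_apply (A n) f = blinfun_apply (A n) g" "\<And>y. \<gamma> \<le> y \<Longrightarrow> apply_bcontfun g y = 0"
      using dom by blast
    have "apply_bcontfun (blinfun_apply (A n) g) x = 0"
    proof (rule op_eq_zero_below[OF A \<gamma>(2) _ g(2)])
      fix \<eta> assume "\<eta> < \<gamma>"
      then have "b n \<eta> < x" using c(2)[of n \<eta>] \<delta>(2) x by (meson le_less_trans order.trans)
      then show "apply_bcontfun (blinfun_apply (A n) (initial_ind \<eta>)) x = 0" by (rule b(2))
    qed
    then show ?thesis by (simp add: g(1))
  qed
  then have "initial_op \<delta> o\<^sub>L A n = A n" for n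
    by (intro ops_eqI) (auto simp: not_le)
  then show ?thesis using \<delta>(1) by blast
qed

text \<open>The counterpart for short ranges: only rows below \<gamma> count, each ignores functions
  far out, and regularity makes the bound uniform.\<close>

lemma domain_initial:
  fixes A :: "nat \<Rightarrow> ('a \<Rightarrow>\<^sub>C 'k) \<Rightarrow>\<^sub>L ('a \<Rightarrow>\<^sub>C 'k)"
  assumes A: "\<And>n. A n \<in> bounded_ops" and \<gamma>: "\<gamma> < \<beta>"
    and zero: "\<And>n f x. \<gamma> \<le> x \<Longrightarrow> apply_bcontfun (blinfun_apply (A n) f) x = 0"
  shows "\<exists>\<delta><\<beta>. \<forall>n f. (\<forall>y. apply_bcontfun f y \<noteq> 0 \<longrightarrow> \<delta> < y \<and> y < \<beta>) \<longrightarrow> blinfun_apply (A n) f = 0"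
proof -
  obtain b where b: "\<And>n x. b n x < \<beta>" "\<And>n x f. (\<And>y. apply_bcontfun f y \<noteq> 0 \<Longrightarrow> b n x < y \<and> y < \<beta>) \<Longrightarrow>
      apply_bcontfun (blinfun_apply (A n) f) x = 0"
    using row_eventually_zero[OF A] by metis
  have "\<exists>c<\<beta>. \<forall>n. b n x \<le> c" for x using b(1) by (intro sequence_bounded)
  then obtain c where c: "\<And>x. c x < \<beta>" "\<And>n x. b n x \<le> c x" by metis
  obtain \<delta> where \<delta>: "\<delta> < \<beta>" "\<And>x. x < \<gamma> \<Longrightarrow> c x \<le> \<delta>"
    using regular[OF \<gamma>, of c] c(1) by blast
  have "blinfun_apply (A n) f = 0" if f: "\<And>y. apply_bcontfun f y \<noteq> 0 \<Longrightarrow> \<delta> < y \<and> y < \<beta>" for n f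
  proof (rule bcontfun_eqI)
    fix x
    show "apply_bcontfun (blinfun_apply (A n) f) x = apply_bcontfun 0 x"
    proof (cases "x < \<gamma>")
      case True
      then have "b n x \<le> \<delta>" using c(2)[of n x] \<delta>(2) by (meson order.trans)
      then have "apply_bcontfun (blinfun_apply (A n) f) x = 0"
        using f by (intro b(2)) (meson le_less_trans)
      then show ?thesis by simp
    qed (simp add: zero)
  qed
  then show ?thesis using \<delta>(1) by blast
qed

text \<open>Images of indicators and rows both die out below \<beta>. At a limit \<xi> closed under
  these bounds, the parts of \<open>f\<close> before and beyond \<xi> contribute nothing, so
  \<open>A n\<close> acts at \<xi> as multiplication by a number. These numbers are eventually
  constant in \<xi>.\<close>

lemma diagonal_on_club:
  fixes A :: "nat \<Rightarrow> ('a \<Rightarrow>\<^sub>C 'k) \<Rightarrow>\<^sub>L ('a \<Rightarrow>\<^sub>C 'k)"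
  assumes A: "\<And>n. A n \<in> bounded_ops"
    and zero: "\<And>n f x. \<beta> \<le> x \<Longrightarrow> apply_bcontfun (blinfun_apply (A n) f) x = 0"
  obtains C s where "club \<beta> C" "club.fluctuation_op \<beta> C \<in> I" "\<And>n. norm (s n) \<le> norm (A n)"
    "\<And>n f \<xi>. \<xi> \<in> C \<Longrightarrow> (\<And>y. \<beta> \<le> y \<Longrightarrow> apply_bcontfun f y = 0) \<Longrightarrow>
      apply_bcontfun (blinfun_apply (A n) f) \<xi> = s n * apply_bcontfun f \<xi>"
proof -
  have "\<exists>b<\<beta>. \<forall>x>b. apply_bcontfun (blinfun_apply (A n) (initial_ind \<eta>)) x = 0" for n \<eta>
    by (intro continuous_eventually_zero continuous_on_apply_bcontfun zero)
  then obtain b1 where b1: "\<And>n \<eta>. b1 n \<eta> < \<beta>"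
      "\<And>n \<eta> x. b1 n \<eta> < x \<Longrightarrow> apply_bcontfun (blinfun_apply (A n) (initial_ind \<eta>)) x = 0"
    by metis
  obtain b2 where b2: "\<And>n x. b2 n x < \<beta>" "\<And>n x f. (\<And>y. apply_bcontfun f y \<noteq> 0 \<Longrightarrow> b2 n x < y \<and> y < \<beta>) \<Longrightarrow>
      apply_bcontfun (blinfun_apply (A n) f) x = 0"
    using row_eventually_zero[OF A] by metis
  have "\<exists>c<\<beta>. \<forall>n. max (b1 n x) (b2 n x) \<le> c" for x
    using b1(1) b2(1) by (intro sequence_bounded) simp
  then obtain c where c: "\<And>x. c x < \<beta>" "\<And>n x. max (b1 n x) (b2 n x) \<le> c x" by metis
  \<comment> \<open>\<open>c\<close> bounds both kinds of tails for all \<open>n\<close>; the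
    successor makes the points of \<open>D\<close> limits.\<close>
  define g where "g x = max (c x) (LEAST z. x < z)" for x
  have g: "g x < \<beta>" if "x < \<beta>" for x
    using c(1) Suc_less[OF that] by (simp add: g_def)
  define D where "D = {\<xi>. \<xi> < \<beta> \<and> (\<exists>v. v < \<xi>) \<and> (\<forall>\<eta><\<xi>. g \<eta> < \<xi>)}"
  have diag: "apply_bcontfun (blinfun_apply (A n) f) \<xi> =
      apply_bcontfun f \<xi> * apply_bcontfun (blinfun_apply (A n) (initial_ind \<xi>)) \<xi>"
    if \<xi>: "\<xi> \<in> D" and f: "\<And>y. \<beta> \<le> y \<Longrightarrow> apply_bcontfun f y = 0" for n f \<xi>
  proof -
    obtain v where v: "v < \<xi>" using \<xi> by (auto simp: D_def)
    have close: "b1 n \<eta> < \<xi>" "b2 n \<eta> < \<xi>" "(LEAST z. \<eta> < z) < \<xi>" "\<eta> < (LEAST z. \<eta> < z)" if \<eta>: "\<eta> < \<xi>" for \<eta>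
    proof -
      have "max (b1 n \<eta>) (b2 n \<eta>) < \<xi>" "(LEAST z. \<eta> < z) < \<xi>"
        using \<xi> c(2)[of n \<eta>] \<eta> unfolding D_def g_def by (auto intro: le_less_trans)
      then show "b1 n \<eta> < \<xi>" "b2 n \<eta> < \<xi>" "(LEAST z. \<eta> < z) < \<xi>" by simp_all
      show "\<eta> < (LEAST z. \<eta> < z)" by (rule LeastI[of "\<lambda>z. \<eta> < z", OF \<eta>])
    qed
    define f1 where "f1 = blinfun_apply (initial_op \<xi>) f - scaleK_bcontfun (apply_bcontfun f \<xi>) (initial_ind \<xi>)"
    define f2 where "f2 = f - blinfun_apply (initial_op \<xi>) f"
    have "apply_bcontfun (blinfun_apply (A n) f1) \<xi> = 0"
      by (rule op_eq_zero_below[OF A v b1(2)[OF close(1)]]) (auto simp: f1_def)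
    \<comment> \<open>Rows below \<xi> ignore \<open>f2\<close>, whose support lies beyond \<xi>;
      continuity of the image carries the zero to \<xi> itself.\<close>
    moreover have "apply_bcontfun (blinfun_apply (A n) f2) \<xi> = 0"
    proof (rule ccontr)
      assume nz: "apply_bcontfun (blinfun_apply (A n) f2) \<xi> \<noteq> 0"
      obtain w where w: "w < \<xi>" "\<And>y. w < y \<Longrightarrow> y \<le> \<xi> \<Longrightarrow> dist (apply_bcontfun (blinfun_apply (A n) f2) y)
          (apply_bcontfun (blinfun_apply (A n) f2) \<xi>) < norm (apply_bcontfun (blinfun_apply (A n) f2) \<xi>)"
        using wellorder_continuousD[OF continuous_on_apply_bcontfun _ v] nz
        by (metis zero_less_norm_iff)
      define \<eta> where "\<eta> = (LEAST z. w < z)"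
      have \<eta>: "w < \<eta>" "\<eta> < \<xi>" using close(3,4)[OF w(1)] by (simp_all add: \<eta>_def)
      have "apply_bcontfun (blinfun_apply (A n) f2) \<eta> = 0"
      proof (rule b2(2))
        fix y assume "apply_bcontfun f2 y \<noteq> 0"
        then have "\<not> y \<le> \<xi>" "apply_bcontfun f y \<noteq> 0" by (auto simp: f2_def split: if_splits)
        then show "b2 n \<eta> < y \<and> y < \<beta>"
          using close(2)[OF \<eta>(2)] f[of y] by (metis less_trans not_le)
      qed
      then show False using w(2)[OF \<eta>(1) less_imp_le[OF \<eta>(2)]] by simp
    qed
    moreover have "f = f1 + f2 + scaleK_bcontfun (apply_bcontfun f \<xi>) (initial_ind \<xi>)"
      by (simp add: f1_def f2_def)
    then have "blinfun_apply (A n) f = blinfun_apply (A n) f1 + blinfun_apply (A n) f2 +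
        scaleK_bcontfun (apply_bcontfun f \<xi>) (blinfun_apply (A n) (initial_ind \<xi>))"
      by (metis blinfun.add_right bounded_ops_scaleK_apply[OF A])
    ultimately show ?thesis by simp
  qed
  define t where "t n \<xi> = apply_bcontfun (blinfun_apply (A n) (initial_ind \<xi>)) \<xi>" for n \<xi>
  have "\<exists>b<\<beta>. \<forall>x\<in>D. \<forall>x'\<in>D. b < x \<longrightarrow> b < x' \<longrightarrow> t n x = t n x'" for n
  proof (rule eventually_constant)
    show "D \<subseteq> {..<\<beta>}" by (auto simp: D_def)
    fix y assume y: "y < \<beta>"
    \<comment> \<open>The indicator of \<open>{..y}\<close> has the value 1 at every
      \<open>x \<le> y\<close>, so on these points \<open>t n\<close> agrees with one continuous
      function.\<close>
    have "t n x = apply_bcontfun (blinfun_apply (A n) (initial_ind y)) x" if "x \<in> D" "x \<le> y" for x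
      using diag[OF that(1), of "initial_ind y" n] that(2) y by (auto simp: t_def not_le[symmetric])
    then show "\<exists>F. continuous_on UNIV F \<and> (\<forall>x\<in>D. x \<le> y \<longrightarrow> t n x = F x)"
      by (intro exI[of _ "apply_bcontfun (blinfun_apply (A n) (initial_ind y))"]) simp
  qed
  then obtain d where d: "\<And>n. d n < \<beta>" "\<And>n x x'. x \<in> D \<Longrightarrow> x' \<in> D \<Longrightarrow> d n < x \<Longrightarrow> d n < x' \<Longrightarrow> t n x = t n x'"
    by metis
  obtain e where e: "e < \<beta>" "\<And>n. d n \<le> e" using sequence_bounded[of d, OF d(1)] by blast
  \<comment> \<open>Including the constant \<open>e\<close> pushes the club beyond \<open>e\<close>,
    where every \<open>t n\<close> is constant on \<open>D\<close>.\<close>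
  have ge: "max (g \<eta>) e < \<beta>" if "\<eta> < \<beta>" for \<eta> using g[OF that] e(1) by simp
  obtain C where C: "club \<beta> C" "\<And>\<xi>. \<xi> \<in> C \<Longrightarrow> \<exists>v. v < \<xi>"
      "\<And>\<xi> \<eta>. \<xi> \<in> C \<Longrightarrow> \<eta> < \<xi> \<Longrightarrow> max (g \<eta>) e < \<xi>" "club.fluctuation_op \<beta> C \<in> I"
    using ex_club_closed_under[of "\<lambda>\<eta>. max (g \<eta>) e", OF ge] by blast
  interpret club \<beta> C by (rule C(1))
  have CD: "\<xi> \<in> D \<and> e < \<xi>" if "\<xi> \<in> C" for \<xi>
    using C(2,3)[OF that] below[OF that] unfolding D_def by auto
  obtain \<xi>0 where \<xi>0: "\<xi>0 \<in> C" using cofinal[OF e(1)] by blast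
  have t_eq: "t n \<xi> = t n \<xi>0" if "\<xi> \<in> C" for \<xi> n
    using d(2)[of \<xi> \<xi>0 n] CD[OF that] CD[OF \<xi>0] e(2)[of n] by (meson le_less_trans)
  show ?thesis
  proof (rule that[OF C(1,4)])
    fix n
    have "norm (t n \<xi>0) \<le> norm (A n) * norm (initial_ind \<xi>0 :: 'a \<Rightarrow>\<^sub>C 'k)"
      unfolding t_def by (rule norm_apply_op_le)
    also have "\<dots> \<le> norm (A n) * 1"
      by (intro mult_left_mono norm_bound) auto
    finally show "norm (t n \<xi>0) \<le> norm (A n)" by simp
  next
    fix n \<xi> and f :: "'a \<Rightarrow>\<^sub>C 'k"
    assume \<xi>: "\<xi> \<in> C" and f: "\<And>y. \<beta> \<le> y \<Longrightarrow> apply_bcontfun f y = 0"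
    show "apply_bcontfun (blinfun_apply (A n) f) \<xi> = t n \<xi>0 * apply_bcontfun f \<xi>"
      using diag[OF conjunct1[OF CD[OF \<xi>]] f, of n] t_eq[OF \<xi>, of n] by (simp add: t_def mult.commute)
  qed
qed

end

subsection \<open>Continuity of homomorphisms\<close>

context ops_hom
begin

text \<open>A compression between isolated points is a scalar multiple of the single operator
  \<open>const_op {y} z\<close>, and \<theta> is homogeneous.\<close>

lemma sandwich_bounded_matrix_unit:
  fixes y z :: 'a
  assumes y: "clopen {y}" and z: "clopen {z}"
  shows "sandwich_bounded (restrict_op {y}) (restrict_op {z})"
  unfolding sandwich_bounded_def
proof (intro exI ballI)
  fix S :: "('a \<Rightarrow>\<^sub>C 'k) \<Rightarrow>\<^sub>L ('a \<Rightarrow>\<^sub>C 'k)"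
  assume S: "S \<in> bounded_ops"
  define i :: "'a \<Rightarrow>\<^sub>C 'k" where "i = blinfun_apply (restrict_op {z}) (const_bcontfun 1)"
  define c where "c = apply_bcontfun (blinfun_apply S i) y"
  have i: "apply_bcontfun i x = (if x = z then 1 else 0)" for x
    using z by (simp add: i_def const_bcontfun.rep_eq)
  have "restrict_op {z} f = scaleK_bcontfun (apply_bcontfun f z) i" for f :: "'a \<Rightarrow>\<^sub>C 'k"
    by (rule bcontfun_eqI) (use z in \<open>simp add: i\<close>)
  then have "restrict_op {y} o\<^sub>L S o\<^sub>L restrict_op {z} = scaleK_op c (const_op {y} z)"
    using S y by (intro ops_eqI) (simp add: scaleK_op_apply bounded_ops_def c_def)
  then have "norm (\<theta> (restrict_op {y} o\<^sub>L S o\<^sub>L restrict_op {z})) = norm c * norm (\<theta> (const_op {y} z))"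
    using y by (simp add: hom_scaleK norm_scl)
  also have "norm c \<le> norm S * norm i" unfolding c_def by (rule norm_apply_op_le)
  also have "\<dots> \<le> norm S * 1"
    by (intro mult_left_mono norm_bound) (auto simp: i)
  finally show "norm (\<theta> (restrict_op {y} o\<^sub>L S o\<^sub>L restrict_op {z})) \<le> norm (\<theta> (const_op {y} z)) * norm S"
    by (simp add: mult.commute mult_right_mono)
qed

text \<open>Serves finite spaces, where the identity is a finite sum of restrictions to
  points.\<close>

lemma sandwich_bounded_finite:
  fixes A B :: "'a set"
  assumes fin: "finite A" "finite B" and clopen: "\<And>C :: 'a set. clopen C"
  shows "sandwich_bounded (restrict_op A) (restrict_op B)"
proof -
  have split: "restrict_op (insert y C) = restrict_op {y} + (restrict_op C :: ('a \<Rightarrow>\<^sub>C 'k) \<Rightarrow>\<^sub>L _)"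
    if "y \<notin> C" for y and C :: "'a set"
    using that clopen by (intro ops_eqI) (auto simp: blinfun.add_left)
  have "restrict_op {} = (0 :: ('a \<Rightarrow>\<^sub>C 'k) \<Rightarrow>\<^sub>L _)"
    using clopen by (intro ops_eqI) auto
  then have empty: "sandwich_bounded (restrict_op {}) R" "sandwich_bounded R (restrict_op {})" for R
    unfolding sandwich_bounded_def using hom_scaleR[OF bounded_ops_zero, of 0]
    by (auto intro!: exI[of _ 0])
  have row: "sandwich_bounded (restrict_op {y}) (restrict_op B)" for y
    using fin(2)
  proof (induction B)
    case (insert z B)
    then show ?case
      unfolding split[OF insert.hyps(2)]
      by (intro sandwich_bounded_add_right sandwich_bounded_matrix_unit restrict_op_mem clopen)
  qed (rule empty)
  show ?thesis
    using fin(1)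
  proof (induction A)
    case (insert z A)
    then show ?case using row
      unfolding split[OF insert.hyps(2)]
      by (intro sandwich_bounded_add_left restrict_op_mem clopen)
  qed (rule empty)
qed

end

lemma ops_ideal_critical:
  fixes I :: "(('a::{wellorder,linorder_topology} \<Rightarrow>\<^sub>C 'k::{real_normed_field,banach}) \<Rightarrow>\<^sub>L ('a \<Rightarrow>\<^sub>C 'k)) set"
  assumes I: "ops_ideal I" and inf: "infinite (UNIV :: 'a set)"
    and top: "UNIV = {..\<alpha> :: 'a}" and notin: "id_blinfun \<notin> I"
  obtains \<beta> where "critical_ideal I \<beta>"
proof -
  have "x \<le> \<alpha>" for x using top by (metis UNIV_I atMost_iff)
  then have "id_blinfun = (initial_op \<alpha> :: ('a \<Rightarrow>\<^sub>C 'k) \<Rightarrow>\<^sub>L _)"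
    by (intro ops_eqI) simp
  then have "initial_op \<alpha> \<notin> I" using notin by simp
  then have "initial_op (LEAST x. initial_op x \<notin> I) \<notin> I"
    by (rule LeastI)
  moreover have "initial_op \<delta> \<in> I" if "\<delta> < (LEAST x. initial_op x \<notin> I)" for \<delta>
    using not_less_Least[OF that] by blast
  ultimately have "critical_ideal I (LEAST x. initial_op x \<notin> I)"
    using I inf by (auto simp: critical_ideal_def critical_ideal_axioms_def)
  then show ?thesis by (rule that)
qed

lemma hom_continuous_on_ops:
  fixes scl :: "'k::{real_normed_field,banach} \<Rightarrow> 'b::{real_normed_algebra,banach} \<Rightarrow> 'b"
    and \<theta> :: "(('a::{wellorder,linorder_topology} \<Rightarrow>\<^sub>C 'k) \<Rightarrow>\<^sub>L ('a \<Rightarrow>\<^sub>C 'k)) \<Rightarrow> 'b"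
  assumes alg: "banach_algebra_over scl" and hom: "algebra_hom_on_ops scl \<theta>"
    and top: "UNIV = {..\<alpha> :: 'a}"
  shows "continuous_on bounded_ops \<theta>"
proof -
  interpret ops_hom scl \<theta>
    by (intro ops_hom.intro ops_hom_axioms.intro alg hom)
  have "sandwich_bounded id_blinfun id_blinfun"
  proof (cases "finite (UNIV :: 'a set)")
    case True
    have clopen: "clopen C" for C :: "'a set"
    proof -
      have "closed D" for D :: "'a set"
        by (rule finite_imp_closed[OF finite_subset[OF subset_UNIV True]])
      then show ?thesis by (simp add: clopen_def open_closed)
    qed
    then have "restrict_op UNIV = (id_blinfun :: ('a \<Rightarrow>\<^sub>C 'k) \<Rightarrow>\<^sub>L _)"
      by (intro ops_eqI) simp
    then show ?thesis using sandwich_bounded_finite[OF True True clopen] by simp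
  next
    case inf: False
    show ?thesis
    proof (rule ccontr)
      assume unbdd: "\<not> ?thesis"
      define I where "I = {T \<in> bounded_ops. sandwich_bounded T id_blinfun}"
      have I: "ops_ideal I" unfolding I_def by (rule ops_ideal_left[OF bounded_ops_id])
      obtain \<beta> where "critical_ideal I \<beta>"
        using ops_ideal_critical[OF I inf top] unbdd by (auto simp: I_def)
      then interpret L: critical_ideal I \<beta> .
      \<comment> \<open>The left factor is now fixed at \<open>initial_op \<beta>\<close>, and the
        same analysis is carried out on the right.\<close>
      define J where "J = {T \<in> bounded_ops. sandwich_bounded (initial_op \<beta>) T}"
      have J: "ops_ideal J" unfolding J_def by (rule ops_ideal_right) simp
      have "id_blinfun \<notin> J" using L.initial_op_notin by (simp add: I_def J_def)
      then obtain \<gamma> where "critical_ideal J \<gamma>"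
        using ops_ideal_critical[OF J inf top] by blast
      then interpret R: critical_ideal J \<gamma> .
      have I_D: "sandwich_bounded T U" if "T \<in> I" "U \<in> bounded_ops" for T U
        using that sandwich_bounded_outer[of T id_blinfun id_blinfun U] by (simp add: I_def bounded_ops_id)
      have J_D: "sandwich_bounded (T o\<^sub>L initial_op \<beta>) U" if "U \<in> J" "T \<in> bounded_ops" for T U
        using that sandwich_bounded_outer[of "initial_op \<beta>" U T id_blinfun] by (simp add: J_def bounded_ops_id)
      \<comment> \<open>Each \<open>vanish_op\<close> differs from its initial projection by a
        rank-one operator in \<open>I\<close> or \<open>J\<close>. Boundedness would therefore pass
        to the pair of initial projections, against the choice of \<gamma>.\<close>
      have "\<not> sandwich_bounded L.vanish_op R.vanish_op"
      proof
        assume "sandwich_bounded L.vanish_op R.vanish_op"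
        moreover have "L.vanish_op o\<^sub>L initial_op \<beta> = L.vanish_op"
          by (rule ops_eqI) auto
        then have "sandwich_bounded L.vanish_op (const_op {..\<gamma>} \<gamma>)"
          using J_D[OF R.const_mem[of "{..\<gamma>}" \<gamma>] L.vanish_op_mem] by simp
        ultimately have "sandwich_bounded L.vanish_op (R.vanish_op + const_op {..\<gamma>} \<gamma>)"
          by (intro sandwich_bounded_add_right) auto
        moreover have "sandwich_bounded (const_op {..\<beta>} \<beta>) (R.vanish_op + const_op {..\<gamma>} \<gamma>)"
          by (intro I_D L.const_mem bounded_ops_add) auto
        ultimately have "sandwich_bounded (L.vanish_op + const_op {..\<beta>} \<beta>) (R.vanish_op + const_op {..\<gamma>} \<gamma>)"
          by (intro sandwich_bounded_add_left bounded_ops_add) auto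
        then show False
          using R.initial_op_notin by (simp add: J_def L.vanish_op_def R.vanish_op_def)
      qed
      then have "\<exists>S. S \<in> bounded_ops \<and> norm S \<le> 1 \<and> real n < norm (\<theta> (L.vanish_op o\<^sub>L S o\<^sub>L R.vanish_op))" for n
        by (rule sandwich_unboundedE[where e = 1 and N = "real n"]) auto
      then obtain S where S: "\<And>n. S n \<in> bounded_ops" "\<And>n. norm (S n) \<le> 1"
          "\<And>n. real n < norm (\<theta> (L.vanish_op o\<^sub>L S n o\<^sub>L R.vanish_op))"
        by metis
      define A where "A n = L.vanish_op o\<^sub>L S n o\<^sub>L R.vanish_op" for n
      have A: "A n \<in> bounded_ops" for n
        using S by (auto simp: A_def intro!: bounded_ops_compose)
      define N where "N = norm L.vanish_op * norm R.vanish_op"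
      have A_norm: "norm (A n) \<le> N" for n
      proof -
        have "norm (A n) \<le> norm (L.vanish_op o\<^sub>L S n) * norm R.vanish_op"
          unfolding A_def by (rule norm_blinfun_compose)
        also have "\<dots> \<le> (norm L.vanish_op * norm (S n)) * norm R.vanish_op"
          by (intro mult_right_mono norm_blinfun_compose) auto
        also have "\<dots> \<le> (norm L.vanish_op * 1) * norm R.vanish_op"
          using S(2) by (intro mult_right_mono mult_left_mono) auto
        finally show ?thesis by (simp add: N_def)
      qed
      have A_zero: "apply_bcontfun (blinfun_apply (A n) f) x = 0" if "\<beta> \<le> x" for n f x
        using that by (auto simp: A_def)
      have "R.vanish_op o\<^sub>L R.vanish_op = R.vanish_op"
        by (rule ops_eqI) auto
      then have "A n o\<^sub>L R.vanish_op = A n" for n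
        by (simp add: A_def blinfun_compose_assoc)
      then have A_vanish: "blinfun_apply (A n) (blinfun_apply R.vanish_op f) = blinfun_apply (A n) f" for n f
        by (metis blinfun_apply_blinfun_compose)
      have A_initial: "initial_op \<beta> o\<^sub>L A n = A n" for n
        by (rule ops_eqI) (auto simp: A_zero)
      have bound: False if M: "\<And>n. norm (\<theta> (A n)) \<le> M" for M
      proof -
        obtain n where "M < real n" using reals_Archimedean2 by blast
        then show False using S(3)[of n] M[of n] by (simp add: A_def)
      qed
      have initial_bound: "\<exists>M\<ge>0. \<forall>S\<in>bounded_ops. norm (\<theta> (T o\<^sub>L S)) \<le> M * norm S" if "T \<in> I" for T
        using that unfolding I_def by (auto elim!: sandwich_boundedE)
      consider "\<gamma> < \<beta>" | "\<beta> < \<gamma>" | "\<gamma> = \<beta>" by (rule linorder_cases)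
      then show False
      proof cases
        case 1
        obtain v where v: "v < \<gamma>" using R.limit by (auto simp: limit_point_def)
        have "\<exists>g. blinfun_apply (A n) f = blinfun_apply (A n) g \<and> (\<forall>y\<ge>\<gamma>. apply_bcontfun g y = 0)" for n f
          by (intro exI[of _ "blinfun_apply R.vanish_op f"]) (simp add: A_vanish)
        \<comment> \<open>The \<open>A n\<close> depend only on functions that vanish from \<gamma>
          on, so their ranges live on a common \<open>{..\<delta>}\<close> with
          \<open>\<delta> < \<beta>\<close>.\<close>
        then obtain \<delta> where \<delta>: "\<delta> < \<beta>" "\<And>n. initial_op \<delta> o\<^sub>L A n = A n"
          using L.range_initial[of A, OF A 1 v A_zero] by blast
        obtain M where M: "M \<ge> 0" "\<And>S. S \<in> bounded_ops \<Longrightarrow> norm (\<theta> (initial_op \<delta> o\<^sub>L S)) \<le> M * norm S"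
          using initial_bound[OF L.initial_op_mem[OF \<delta>(1)]] by blast
        have "norm (\<theta> (A n)) \<le> M * N" for n
          using M(2)[OF A[of n]] mult_left_mono[OF A_norm[of n] M(1)] by (simp add: \<delta>(2))
        then show False by (rule bound)
      next
        case 2
        obtain \<delta> where \<delta>: "\<delta> < \<gamma>" "\<And>n f. (\<And>y. apply_bcontfun f y \<noteq> 0 \<Longrightarrow> \<delta> < y \<and> y < \<gamma>) \<Longrightarrow> blinfun_apply (A n) f = 0"
          using R.domain_initial[of A, OF A 2 A_zero] by blast
        \<comment> \<open>The choice of \<delta> concerns functions supported strictly between
          \<delta> and \<gamma>, so \<open>R.vanish_op\<close> is applied first; it is split off by
          multiplicativity.\<close>
        have A_eq: "A n = (initial_op \<beta> o\<^sub>L A n o\<^sub>L initial_op \<delta>) o\<^sub>L R.vanish_op" for n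
        proof (rule blinfun_eqI)
          fix f
          define g where "g = blinfun_apply R.vanish_op f"
          have "blinfun_apply (A n) (g - blinfun_apply (initial_op \<delta>) g) = 0"
            by (rule \<delta>(2)) (auto simp: g_def not_le order.order_iff_strict split: if_splits)
          then have "blinfun_apply (A n) g = blinfun_apply (A n) (blinfun_apply (initial_op \<delta>) g)"
            by (simp add: blinfun.diff_right)
          moreover have "blinfun_apply (A n) f = blinfun_apply (A n) g"
            by (simp add: g_def A_vanish)
          ultimately show "blinfun_apply (A n) f =
              blinfun_apply (initial_op \<beta> o\<^sub>L A n o\<^sub>L initial_op \<delta> o\<^sub>L R.vanish_op) f"
            by (simp add: A_initial g_def)
        qed
        have "sandwich_bounded (initial_op \<beta>) (initial_op \<delta>)"
          using R.initial_op_mem[OF \<delta>(1)] by (simp add: J_def)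
        then obtain M where M: "M \<ge> 0" "\<And>S. S \<in> bounded_ops \<Longrightarrow>
            norm (\<theta> (initial_op \<beta> o\<^sub>L S o\<^sub>L initial_op \<delta>)) \<le> M * norm S"
          by (rule sandwich_boundedE) blast
        have "norm (\<theta> (A n)) \<le> M * N * norm (\<theta> R.vanish_op)" for n
        proof -
          have "\<theta> (A n) = \<theta> (initial_op \<beta> o\<^sub>L A n o\<^sub>L initial_op \<delta>) * \<theta> R.vanish_op"
            by (subst A_eq, subst hom_mult) (auto intro!: bounded_ops_compose A)
          then have "norm (\<theta> (A n)) \<le> norm (\<theta> (initial_op \<beta> o\<^sub>L A n o\<^sub>L initial_op \<delta>)) * norm (\<theta> R.vanish_op)"
            by (simp add: norm_mult_ineq)
          also have "\<dots> \<le> (M * norm (A n)) * norm (\<theta> R.vanish_op)"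
            using M(2)[OF A] by (intro mult_right_mono) auto
          also have "\<dots> \<le> (M * N) * norm (\<theta> R.vanish_op)"
            using A_norm M(1) by (intro mult_right_mono mult_left_mono) auto
          finally show ?thesis .
        qed
        then show False by (rule bound)
      next
        case 3
        obtain C s where C: "club \<beta> C" "club.fluctuation_op \<beta> C \<in> I" "\<And>n. norm (s n) \<le> norm (A n)"
            "\<And>n f \<xi>. \<xi> \<in> C \<Longrightarrow> (\<And>y. \<beta> \<le> y \<Longrightarrow> apply_bcontfun f y = 0) \<Longrightarrow>
              apply_bcontfun (blinfun_apply (A n) f) \<xi> = s n * apply_bcontfun f \<xi>"
          using L.diagonal_on_club[of A, OF A A_zero] by blast
        interpret club \<beta> C by (rule C(1))
        define E where "E = (initial_op \<beta> - fluctuation_op) o\<^sub>L R.vanish_op"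
        have E: "E \<in> bounded_ops"
          unfolding E_def by (intro bounded_ops_compose bounded_ops_diff) auto
        \<comment> \<open>Below \<beta>, \<open>A n f\<close> is its fluctuation plus its
          composition with \<open>up\<close>. The latter depends on the values on the club, where
          \<open>A n\<close> multiplies by \<open>s n\<close>; hence one operator \<open>E\<close>
          serves all \<open>n\<close>.\<close>
        have A_eq: "A n = (fluctuation_op o\<^sub>L A n) + scaleK_op (s n) E" for n
        proof (rule ops_eqI)
          fix f x
          have zero: "apply_bcontfun (blinfun_apply R.vanish_op f) y = 0" if "\<beta> \<le> y" for y
            using that 3 by auto
          have "apply_bcontfun (blinfun_apply (A n) f) (up x) = s n * apply_bcontfun (blinfun_apply R.vanish_op f) (up x)"
            if x: "x < \<beta>"
            using C(4)[OF up_in[OF x] zero, of n] by (simp only: A_vanish)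
          moreover have "apply_bcontfun (blinfun_apply E f) x =
              (if x < \<beta> then apply_bcontfun (blinfun_apply R.vanish_op f) (up x) else 0)"
            using zero[of x] unfolding E_def
            by (auto simp: blinfun.diff_left simp del: R.vanish_op_apply)
          ultimately show "apply_bcontfun (blinfun_apply (A n) f) x =
              apply_bcontfun (blinfun_apply ((fluctuation_op o\<^sub>L A n) + scaleK_op (s n) E) f) x"
            using A_zero[of x n f] by (cases "x < \<beta>") (simp_all add: blinfun.add_left scaleK_op_apply not_less del: R.vanish_op_apply)
        qed
        obtain M where M: "M \<ge> 0" "\<And>S. S \<in> bounded_ops \<Longrightarrow> norm (\<theta> (fluctuation_op o\<^sub>L S)) \<le> M * norm S"
          using initial_bound[OF C(2)] by blast
        have "norm (\<theta> (A n)) \<le> M * N + N * norm (\<theta> E)" for n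
        proof -
          have "\<theta> (A n) = \<theta> (fluctuation_op o\<^sub>L A n) + scl (s n) (\<theta> E)"
            by (subst A_eq, subst hom_add) (auto intro!: bounded_ops_compose bounded_ops_scaleK A E simp: hom_scaleK[OF E])
          then have "norm (\<theta> (A n)) \<le> norm (\<theta> (fluctuation_op o\<^sub>L A n)) + norm (s n) * norm (\<theta> E)"
            by (metis norm_triangle_ineq norm_scl)
          also have "\<dots> \<le> M * norm (A n) + norm (A n) * norm (\<theta> E)"
            using M(2)[OF A] C(3) by (intro add_mono mult_right_mono) auto
          also have "\<dots> \<le> M * N + N * norm (\<theta> E)"
            using A_norm M(1) by (intro add_mono mult_left_mono mult_right_mono) auto
          finally show ?thesis .
        qed
        then show False by (rule bound)
      qed
    qed
  qed
  then show ?thesis by (rule continuous_on_hom)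
qed

theorem theorem1p3:
  fixes \<alpha> :: "'a::{wellorder,linorder_topology}"
    and scl_real :: "real \<Rightarrow> 'b::{real_normed_algebra,banach} \<Rightarrow> 'b"
    and \<theta>_real :: "(('a \<Rightarrow>\<^sub>C real) \<Rightarrow>\<^sub>L ('a \<Rightarrow>\<^sub>C real)) \<Rightarrow> 'b"
    and scl_complex :: "complex \<Rightarrow> 'c::{real_normed_algebra,banach} \<Rightarrow> 'c"
    and \<theta>_complex :: "(('a \<Rightarrow>\<^sub>C complex) \<Rightarrow>\<^sub>L ('a \<Rightarrow>\<^sub>C complex)) \<Rightarrow> 'c"
  assumes "(UNIV :: 'a set) = {..\<alpha>}"
  shows "(banach_algebra_over scl_real \<and> algebra_hom_on_ops scl_real \<theta>_real
            \<longrightarrow> continuous_on bounded_ops \<theta>_real) \<and>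
         (banach_algebra_over scl_complex \<and> algebra_hom_on_ops scl_complex \<theta>_complex
            \<longrightarrow> continuous_on bounded_ops \<theta>_complex)"
  using hom_continuous_on_ops[OF _ _ assms, of scl_real \<theta>_real]
    hom_continuous_on_ops[OF _ _ assms, of scl_complex \<theta>_complex] by blast

end
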